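(* Let $\alpha=(\sqrt{5}-1)/2$ and assume $m\ge 2$. There exists a polynomial-time deterministic online algorithm with kill-and-restart for minimizing total flow time on $m$ identical machines, which does not know the number of jobs $n$ in advance, that is $O(n^{\alpha}/\sqrt{m})$-competitive against the optimal offline preemptive schedule.
   Context: Online scheduling of jobs on $m$ identical machines; each job $j$ has release time $r_j\ge0$ and processing time $p_j>0$ and becomes known only at $r_j$; the total number $n$ of jobs is not known to the algorithm. Each machine processes at most one job at a time. Kill-and-restart model: the algorithm may terminate a running job; its processed work is lost and it must later be run again from scratch for $p_j$ uninterrupted time units, possibly on another machine. Flow time of $j$ is $C_j-r_j$; objective is total flow time $F$. $\mathrm{OPT}(J)$ is the minimum total flow time over offline preemptive schedules without migration (jobs may be interrupted and later resumed on the same machine without loss). $\Gamma$-competitive means $F(\mathrm{ALG}(J))\le\Gamma\cdot\mathrm{OPT}(J)$ for every instance $J$ with $n$ jobs.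
   Formalization: The competitive ratio is proved as C·max(1, n^α/√m) with one absolute constant C for all m ≥ 2 and all n; without the maximum with 1 the bound fails when m is large compared with n (one job on many machines), since no ratio can be below 1. *)

theory Defs
  imports Complex_Main
begin

section \<open>Instances and schedules\<close>

text \<open>A job is a pair (release time, processing time); jobs are named by their position in the
  list. Sortedness only fixes these names: jobs are numbered in order of arrival, so that the name
  of a job reveals nothing about jobs released strictly later.\<close>

type_synonym jobs = "(real \<times> real) list"

abbreviation release :: "jobs \<Rightarrow> nat \<Rightarrow> real" where
  "release J j \<equiv> fst (J ! j)"

abbreviation proc :: "jobs \<Rightarrow> nat \<Rightarrow> real" where
  "proc J j \<equiv> snd (J ! j)"

definition valid_jobs :: "jobs \<Rightarrow> bool" where
  "valid_jobs J \<longleftrightarrow> sorted (map fst J) \<and> (\<forall>j<length J. 0 \<le> release J j \<and> 0 < proc J j)"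

text \<open>A segment is an uninterrupted run of a job on a machine, during the time interval
  \<open>[start, fin)\<close>. Machines are numbered \<open>0, ..., m - 1\<close>.\<close>

record segment =
  job :: nat
  machine :: nat
  start :: real
  fin :: real

type_synonym schedule = "segment set"

definition basic_schedule :: "nat \<Rightarrow> jobs \<Rightarrow> schedule \<Rightarrow> bool" where
  "basic_schedule m J S \<longleftrightarrow>
     finite S \<and>
     (\<forall>x\<in>S. job x < length J \<and> machine x < m \<and> release J (job x) \<le> start x \<and> start x < fin x) \<and>
     (\<forall>x\<in>S. \<forall>y\<in>S. x \<noteq> y \<and> (machine x = machine y \<or> job x = job y) \<longrightarrow>
        fin x \<le> start y \<or> fin y \<le> start x)"

text \<open>Kill-and-restart: the last run of every job has full length; all earlier runs were killed
  before completion.\<close>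

definition kill_restart_schedule :: "nat \<Rightarrow> jobs \<Rightarrow> schedule \<Rightarrow> bool" where
  "kill_restart_schedule m J S \<longleftrightarrow>
     basic_schedule m J S \<and>
     (\<forall>j<length J. \<exists>x\<in>S. job x = j \<and> fin x - start x = proc J j \<and>
        (\<forall>y\<in>S. job y = j \<and> y \<noteq> x \<longrightarrow> fin y - start y < proc J j \<and> fin y \<le> start x))"

definition preemptive_schedule :: "nat \<Rightarrow> jobs \<Rightarrow> schedule \<Rightarrow> bool" where
  "preemptive_schedule m J S \<longleftrightarrow>
     basic_schedule m J S \<and>
     (\<forall>x\<in>S. \<forall>y\<in>S. job x = job y \<longrightarrow> machine x = machine y) \<and>
     (\<forall>j<length J. (\<Sum>x | x \<in> S \<and> job x = j. fin x - start x) = proc J j)"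

definition completion :: "schedule \<Rightarrow> nat \<Rightarrow> real" where
  "completion S j = Max (fin ` {x \<in> S. job x = j})"

definition total_flow :: "jobs \<Rightarrow> schedule \<Rightarrow> real" where
  "total_flow J S = (\<Sum>j<length J. completion S j - release J j)"

definition OPT :: "nat \<Rightarrow> jobs \<Rightarrow> real" where
  "OPT m J = Inf {total_flow J S | S. preemptive_schedule m J S}"


section \<open>Online algorithms\<close>

text \<open>A deterministic online algorithm is a non-anticipating map from instances to schedules:
  what it has done up to and including time \<open>t\<close> is a function of the jobs released up to
  time \<open>t\<close>. In particular it cannot depend on the total number of jobs. Comparing runs
  truncated at \<open>t\<close> suffices also for kills at time \<open>t\<close> itself: two instances with the same jobs up
  to \<open>t\<close> have the same jobs up to some \<open>t' > t\<close>, where such a kill is visible.\<close>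

definition released :: "real \<Rightarrow> jobs \<Rightarrow> jobs" where
  "released t J = filter (\<lambda>(r, p). r \<le> t) J"

definition history :: "real \<Rightarrow> schedule \<Rightarrow> schedule" where
  "history t S = (\<lambda>x. x\<lparr>fin := min (fin x) t\<rparr>) ` {x \<in> S. start x \<le> t}"

definition non_anticipating :: "(jobs \<Rightarrow> schedule) \<Rightarrow> bool" where
  "non_anticipating A \<longleftrightarrow>
     (\<forall>J J' t. valid_jobs J \<and> valid_jobs J' \<and> released t J = released t J' \<longrightarrow>
        history t (A J) = history t (A J'))"

definition online_kill_restart_algorithm :: "nat \<Rightarrow> (jobs \<Rightarrow> schedule) \<Rightarrow> bool" where
  "online_kill_restart_algorithm m A \<longleftrightarrow>
     non_anticipating A \<and> (\<forall>J. valid_jobs J \<longrightarrow> kill_restart_schedule m J (A J))"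

definition competitive :: "nat \<Rightarrow> (nat \<Rightarrow> real) \<Rightarrow> (jobs \<Rightarrow> schedule) \<Rightarrow> bool" where
  "competitive m \<Gamma> A \<longleftrightarrow>
     (\<forall>J. valid_jobs J \<longrightarrow> total_flow J (A J) \<le> \<Gamma> (length J) * OPT m J)"


section \<open>Polynomial time\<close>

text \<open>The machine model is a RAM with arrays of natural numbers (usable as indices) and arrays of
  reals (for time values). Arithmetic is restricted to addition, subtraction, comparison and
  scaling of reals by rational constants of the program. Without multiplication, the bit lengths
  of all numbers grow only polynomially in the number of steps and the size of the input, so on
  rational inputs unit-cost polynomial time implies polynomial time in the bit model. Scalar
  variables are the entries with index 0. Expressions have a size fixed by the program, hence
  evaluating one is charged a single unit.\<close>

type_synonym vname = string

record store =
  nmem :: "vname \<Rightarrow> nat \<Rightarrow> nat"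
  rmem :: "vname \<Rightarrow> nat \<Rightarrow> real"

datatype nexp = NConst nat | NArr vname nexp | NAdd nexp nexp | NSub nexp nexp

datatype rexp = RConst rat | RArr vname nexp | RAdd rexp rexp | RSub rexp rexp | RScale rat rexp

datatype bexp = NLess nexp nexp | RLess rexp rexp | BNot bexp | BAnd bexp bexp

datatype com =
    Skip
  | NAssign vname nexp nexp
  | RAssign vname nexp rexp
  | Seq com com
  | Cond bexp com com
  | While bexp com

primrec nval :: "nexp \<Rightarrow> store \<Rightarrow> nat" where
  "nval (NConst k) s = k"
| "nval (NArr a i) s = nmem s a (nval i s)"
| "nval (NAdd e f) s = nval e s + nval f s"
| "nval (NSub e f) s = nval e s - nval f s"

primrec rval :: "rexp \<Rightarrow> store \<Rightarrow> real" where
  "rval (RConst q) s = of_rat q"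
| "rval (RArr a i) s = rmem s a (nval i s)"
| "rval (RAdd e f) s = rval e s + rval f s"
| "rval (RSub e f) s = rval e s - rval f s"
| "rval (RScale q e) s = of_rat q * rval e s"

primrec bval :: "bexp \<Rightarrow> store \<Rightarrow> bool" where
  "bval (NLess e f) s = (nval e s < nval f s)"
| "bval (RLess e f) s = (rval e s < rval f s)"
| "bval (BNot b) s = (\<not> bval b s)"
| "bval (BAnd b c) s = (bval b s \<and> bval c s)"

definition nupdate :: "vname \<Rightarrow> nat \<Rightarrow> nat \<Rightarrow> store \<Rightarrow> store" where
  "nupdate a i v s = s\<lparr>nmem := (nmem s)(a := (nmem s a)(i := v))\<rparr>"

definition rupdate :: "vname \<Rightarrow> nat \<Rightarrow> real \<Rightarrow> store \<Rightarrow> store" where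
  "rupdate a i v s = s\<lparr>rmem := (rmem s)(a := (rmem s a)(i := v))\<rparr>"

text \<open>\<open>exec c s T s'\<close>: started in store \<open>s\<close>, program \<open>c\<close> halts after \<open>T\<close> steps in store \<open>s'\<close>.\<close>

inductive exec :: "com \<Rightarrow> store \<Rightarrow> nat \<Rightarrow> store \<Rightarrow> bool" where
  Skip: "exec Skip s 1 s"
| NAssign: "exec (NAssign a i e) s 1 (nupdate a (nval i s) (nval e s) s)"
| RAssign: "exec (RAssign a i e) s 1 (rupdate a (nval i s) (rval e s) s)"
| Seq: "exec c s T s' \<Longrightarrow> exec d s' T' s'' \<Longrightarrow> exec (Seq c d) s (T + T') s''"
| CondTrue: "bval b s \<Longrightarrow> exec c s T s' \<Longrightarrow> exec (Cond b c d) s (Suc T) s'"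
| CondFalse: "\<not> bval b s \<Longrightarrow> exec d s T s' \<Longrightarrow> exec (Cond b c d) s (Suc T) s'"
| WhileFalse: "\<not> bval b s \<Longrightarrow> exec (While b c) s 1 s"
| WhileTrue: "bval b s \<Longrightarrow> exec c s T s' \<Longrightarrow> exec (While b c) s' T' s'' \<Longrightarrow>
    exec (While b c) s (Suc (T + T')) s''"

definition input_store :: "nat \<Rightarrow> jobs \<Rightarrow> store" where
  "input_store m J =
     \<lparr>nmem = (\<lambda>a i. if a = ''n'' \<and> i = 0 then length J else if a = ''m'' \<and> i = 0 then m else 0),
      rmem = (\<lambda>a i. if a = ''r'' \<and> i < length J then release J i
                    else if a = ''p'' \<and> i < length J then proc J i else 0)\<rparr>"

definition output_schedule :: "store \<Rightarrow> schedule" where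
  "output_schedule s =
     (\<lambda>k. \<lparr>job = nmem s ''job'' k, machine = nmem s ''machine'' k,
           start = rmem s ''start'' k, fin = rmem s ''fin'' k\<rparr>) ` {..<nmem s ''count'' 0}"

text \<open>One program serves all numbers of machines. Running it on a complete instance is no
  restriction for non-anticipating \<open>A\<close>: online, one runs it on the jobs known so far upon each
  arrival and follows the resulting schedule until the next arrival.\<close>

definition polynomial_time :: "(nat \<Rightarrow> jobs \<Rightarrow> schedule) \<Rightarrow> bool" where
  "polynomial_time A \<longleftrightarrow>
     (\<exists>prog c d. \<forall>m J. valid_jobs J \<longrightarrow>
        (\<exists>T s. exec prog (input_store m J) T s \<and> output_schedule s = A m J \<and>
               T \<le> c * (length J + m + 1) ^ d))"

end

theory Submission
  imports Defs
begin

text \<open>Jobs are ordered by processing time. Whenever a machine is idle, it starts the smallest waiting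
  job, but half of the machines accept only small jobs, namely those with \<open>p * K < L\<close>, where
  \<open>N\<close> is the current number of jobs, \<open>L\<close> their total processing time and \<open>K\<close> about
  \<open>sqrt ((N + m) m)\<close>. A running job is killed as soon as more than \<open>K\<close> smaller jobs wait.

  Since each kill consumes \<open>K\<close> arrivals, every machine kills at most \<open>2 sqrt (n / m)\<close> times. If more
  than \<open>K\<close> jobs up to some job \<open>q\<close> wait, then all machines work on jobs up to \<open>q\<close>, so the waiting
  volume of these jobs is at most \<open>D p\<close>, where \<open>p\<close> is the size of \<open>q\<close> and \<open>D\<close> is the number of
  unfinished jobs of the optimum plus \<open>O(sqrt (n m))\<close>. As this holds for all \<open>q\<close> beyond the first
  \<open>K\<close> waiting jobs, the waiting volume grows exponentially with their number, which is therefore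
  \<open>O(D ln n)\<close>. Small jobs wait only during time \<open>O(L ln n / m)\<close>, because the machines reserved for
  them waste little; the at most \<open>K\<close> big ones are charged to the runs on the other machines. This
  gives the ratio \<open>O(sqrt (n / m) ln\<^sup>2 n)\<close>, which is better than required as the exponent of \<open>n\<close>
  in the claim exceeds 1/2.\<close>

section \<open>Order and capacity\<close>

text \<open>The size of \<open>K\<close> balances two costs. A smaller \<open>K\<close> causes more
  kills, about \<open>n / K\<close> per machine; a larger one lets more than
  \<open>sqrt (n m)\<close> jobs wait behind larger running ones. At \<open>K\<close> near
  \<open>sqrt (n m)\<close> each costs a factor \<open>sqrt (n / m)\<close>. The obstacle is that
  \<open>n\<close> and \<open>L\<close> are unknown, so \<open>K\<close> and the limit
  \<open>L / K\<close> for small jobs use current values, and an early killed run on a reserved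
  machine may waste much. But the i-th killed run of a machine starts with \<open>K\<close> at least
  \<open>m (i + 1) / 2\<close>, so the waste on that machine is a harmonic sum,
  \<open>O(L ln n / m)\<close>. The exponential growth also needs a least size to start from. The
  cutoff \<open>L / n^2\<close> supplies it: intervals in which too many jobs up to some job below
  the cutoff wait are so short in total that even \<open>n\<close> waiting jobs are harmless there.
  Any preemptive schedule enters through three facts only: its total flow time is at least
  \<open>L\<close>, it processes at most \<open>m\<close> units of work per unit of time, and its
  number of unfinished jobs integrates to at most its flow time.\<close>

definition prec :: "jobs \<Rightarrow> nat \<Rightarrow> nat \<Rightarrow> bool" where
  "prec J i j \<longleftrightarrow> proc J i < proc J j \<or> (proc J i = proc J j \<and> i < j)"

lemma prec_irrefl: "\<not> prec J i i"
  by (simp add: prec_def)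

lemma prec_trans: "prec J i j \<Longrightarrow> prec J j k \<Longrightarrow> prec J i k"
  by (auto simp: prec_def)

lemma prec_total: "i \<noteq> j \<Longrightarrow> prec J i j \<or> prec J j i"
  by (auto simp: prec_def)

lemma prec_le: "\<not> prec J j i \<Longrightarrow> proc J i \<le> proc J j"
  by (auto simp: prec_def)

lemma ex_prec_min:
  assumes "finite A" "A \<noteq> {}"
  shows "\<exists>q\<in>A. \<forall>i\<in>A. \<not> prec J i q"
  using assms
proof (induction A rule: finite_ne_induct)
  case (singleton x)
  then show ?case by (simp add: prec_irrefl)
next
  case (insert x A)
  then obtain q where q: "q \<in> A" "\<forall>i\<in>A. \<not> prec J i q" by blast
  show ?case
  proof (cases "prec J x q")
    case True
    then have "\<forall>i\<in>insert x A. \<not> prec J i x" using q prec_trans prec_irrefl by blast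
    then show ?thesis by blast
  next
    case False
    then show ?thesis using q by blast
  qed
qed

lemma ex_prec_max:
  assumes "finite A" "A \<noteq> {}"
  shows "\<exists>q\<in>A. \<forall>i\<in>A. \<not> prec J q i"
  using assms
proof (induction A rule: finite_ne_induct)
  case (singleton x)
  then show ?case by (simp add: prec_irrefl)
next
  case (insert x A)
  then obtain q where q: "q \<in> A" "\<forall>i\<in>A. \<not> prec J q i" by blast
  show ?case
  proof (cases "prec J q x")
    case True
    then have "\<forall>i\<in>insert x A. \<not> prec J x i" using q prec_trans prec_irrefl by blast
    then show ?thesis by blast
  next
    case False
    then show ?thesis using q by blast
  qed
qed

text \<open>The square root of \<open>(k + m) * m\<close>, rounded up. One increment per job
  suffices: the value is at least \<open>m\<close>, so an increment raises its square by more than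
  \<open>2 * m\<close>, while the target grows by \<open>m\<close>. The recursive form can be
  maintained by additions alone.\<close>

primrec cap :: "nat \<Rightarrow> nat \<Rightarrow> nat" where
  "cap m 0 = m"
| "cap m (Suc k) =
     (if cap m k * cap m k < (Suc k + m) * m then Suc (cap m k) else cap m k)"

lemma cap_ge: "m \<le> cap m k"
  by (induction k) auto

text \<open>Bounds the loop by which the program multiplies with the capacity.\<close>

lemma cap_le: "cap m k \<le> k + m"
  by (induction k) auto

lemma cap_sq: "(k + m) * m \<le> cap m k * cap m k"
proof (induction k)
  case (Suc k)
  have "m \<le> cap m k" by (rule cap_ge)
  with Suc show ?case by (auto simp: algebra_simps)
qed simp

lemma cap_mono: "k \<le> l \<Longrightarrow> cap m k \<le> cap m l"
  by (induction l) (auto simp: le_Suc_eq)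

text \<open>An increment happens only while the old value is below the new root, so the excess is at
  most one; without an increment only the root grows.\<close>

lemma cap_sq_upper: "real (cap m k) - 1 \<le> sqrt ((real k + real m) * real m)"
proof (induction k)
  case 0
  have "sqrt (real m * real m) = real m" by simp
  then show ?case by simp
next
  case (Suc k)
  show ?case
  proof (cases "cap m k * cap m k < (Suc k + m) * m")
    case True
    then have "real (cap m k * cap m k) \<le> real ((Suc k + m) * m)" by (simp only: of_nat_le_iff)
    then have "(real (cap m k))\<^sup>2 \<le> (real (Suc k) + real m) * real m"
      by (simp add: power2_eq_square algebra_simps)
    then have "real (cap m k) \<le> sqrt ((real (Suc k) + real m) * real m)" by (rule real_le_rsqrt)
    with True show ?thesis by simp
  next
    case False
    have "sqrt ((real k + real m) * real m) \<le> sqrt ((real (Suc k) + real m) * real m)"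
      by (intro real_sqrt_le_mono mult_right_mono) auto
    moreover have "cap m (Suc k) = cap m k" using False by simp
    ultimately show ?thesis using Suc by linarith
  qed
qed

lemma cap_sqrt: "sqrt ((real k + real m) * real m) \<le> real (cap m k)"
proof -
  have "real ((k + m) * m) \<le> real (cap m k * cap m k)" using cap_sq by (simp only: of_nat_le_iff)
  then have "(real k + real m) * real m \<le> (real (cap m k))\<^sup>2" by (simp add: power2_eq_square)
  then show ?thesis by (simp add: real_le_lsqrt)
qed

section \<open>Volume bounds for disjoint segments and preemptive schedules\<close>

lemma ex_latest:
  fixes A :: "segment set"
  assumes "finite A" "A \<noteq> {}"
  shows "\<exists>a\<in>A. \<forall>b\<in>A. fin b \<le> fin a"
proof -
  have "Max (fin ` A) \<in> fin ` A" using assms by (intro Max_in) auto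
  then obtain a where "a \<in> A" "Max (fin ` A) = fin a" by blast
  then show ?thesis using assms(1) by (metis Max_ge finite_imageI imageI)
qed

text \<open>Cut off the latest segment: by disjointness all others end no later than its start,
  which becomes the new \<open>T1\<close> in the induction.\<close>

lemma disjoint_segments_sum:
  fixes A :: "segment set"
  assumes "finite A" "T0 \<le> T1"
    "\<And>a. a \<in> A \<Longrightarrow> T0 \<le> start a \<and> start a < fin a \<and> fin a \<le> T1"
    "\<And>a b. a \<in> A \<Longrightarrow> b \<in> A \<Longrightarrow> a \<noteq> b \<Longrightarrow> fin a \<le> start b \<or> fin b \<le> start a"
  shows "(\<Sum>a\<in>A. fin a - start a) \<le> T1 - T0"
  using assms
proof (induction "card A" arbitrary: A T1)
  case 0
  then show ?case by simp
next
  case (Suc c)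
  then have "A \<noteq> {}" by auto
  then obtain a where a: "a \<in> A" "\<And>b. b \<in> A \<Longrightarrow> fin b \<le> fin a"
    using ex_latest[OF Suc.prems(1)] by blast
  have "(\<Sum>b\<in>A - {a}. fin b - start b) \<le> start a - T0"
  proof (rule Suc.hyps(1))
    show "c = card (A - {a})" using Suc.hyps(2) a(1) Suc.prems(1) by simp
    show "finite (A - {a})" "T0 \<le> start a" using Suc.prems a by auto
    show "T0 \<le> start b \<and> start b < fin b \<and> fin b \<le> start a" if "b \<in> A - {a}" for b
    proof -
      have "fin b \<le> start a \<or> fin a \<le> start b" using Suc.prems(4)[of b a] that a by auto
      moreover have "start b < fin b" "fin b \<le> fin a" "T0 \<le> start b"
        using that a Suc.prems(3)[of b] by auto
      ultimately show ?thesis by auto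
    qed
  qed (use Suc.prems in auto)
  moreover have "(\<Sum>b\<in>A. fin b - start b) = (fin a - start a) + (\<Sum>b\<in>A - {a}. fin b - start b)"
    using a Suc.prems(1) by (simp add: sum.remove)
  moreover have "fin a \<le> T1" using Suc.prems(3) a by auto
  ultimately show ?case by linarith
qed

text \<open>All work on such jobs lies inside the window, and each machine supplies at most the
  length of the window. This limits what the optimum can finish while the algorithm is fully
  busy.\<close>

lemma preemptive_capacity:
  assumes P: "preemptive_schedule m J P" and T: "T0 \<le> T1"
    and A: "A \<subseteq> {..<length J}"
    and rel: "\<And>j. j \<in> A \<Longrightarrow> T0 \<le> release J j \<and> completion P j \<le> T1"
  shows "(\<Sum>j\<in>A. proc J j) \<le> real m * (T1 - T0)"
proof -
  have basic: "basic_schedule m J P" and finP: "finite P"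
    using P unfolding preemptive_schedule_def basic_schedule_def by blast+
  have work: "\<forall>j<length J. (\<Sum>x | x \<in> P \<and> job x = j. fin x - start x) = proc J j"
    using P unfolding preemptive_schedule_def by blast
  have finA: "finite A" using A finite_subset by blast
  have comp: "fin x \<le> completion P (job x)" if "x \<in> P" for x
    unfolding completion_def using that finP by (intro Max_ge) auto
  have "(\<Sum>j\<in>A. proc J j) = (\<Sum>j\<in>A. \<Sum>x | x \<in> P \<and> job x = j. fin x - start x)"
  proof (rule sum.cong)
    fix j assume "j \<in> A"
    then have "j < length J" using A by auto
    then show "proc J j = (\<Sum>x | x \<in> P \<and> job x = j. fin x - start x)"
      using work by simp
  qed simp
  also have "\<dots> = (\<Sum>j\<in>A. \<Sum>x\<in>{x\<in>{x\<in>P. job x \<in> A}. job x = j}. fin x - start x)"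
    by (intro sum.cong) auto
  also have "\<dots> = (\<Sum>x\<in>{x\<in>P. job x \<in> A}. fin x - start x)"
    using finP finA by (intro sum.group) auto
  also have "\<dots> = (\<Sum>h\<in>{..<m}. \<Sum>x\<in>{x\<in>{x\<in>P. job x \<in> A}. machine x = h}. fin x - start x)"
    using finP basic by (intro sum.group[symmetric]) (auto simp: basic_schedule_def)
  also have "\<dots> \<le> (\<Sum>h\<in>{..<m}. T1 - T0)"
  proof (rule sum_mono)
    fix h assume "h \<in> {..<m}"
    show "(\<Sum>x\<in>{x\<in>{x\<in>P. job x \<in> A}. machine x = h}. fin x - start x) \<le> T1 - T0"
    proof (rule disjoint_segments_sum)
      fix x assume "x \<in> {x\<in>{x\<in>P. job x \<in> A}. machine x = h}"
      then have x: "x \<in> P" "job x \<in> A" by auto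
      then show "T0 \<le> start x \<and> start x < fin x \<and> fin x \<le> T1"
        using rel[of "job x"] comp[of x] basic by (fastforce simp: basic_schedule_def)
    qed (use finP T basic in \<open>auto simp: basic_schedule_def\<close>)
  qed
  also have "\<dots> = real m * (T1 - T0)" by simp
  finally show ?thesis .
qed

text \<open>Segments of one job never overlap, so they fit one after another between release and
  completion. Summed over all jobs, this makes the total volume a lower bound for the flow
  time.\<close>

lemma preemptive_flow_ge_proc:
  assumes P: "preemptive_schedule m J P" and j: "j < length J" and v: "valid_jobs J"
  shows "proc J j \<le> completion P j - release J j"
proof -
  have basic: "basic_schedule m J P" and finP: "finite P"
    using P unfolding preemptive_schedule_def basic_schedule_def by blast+
  let ?A = "{x \<in> P. job x = j}"
  have s: "(\<Sum>x\<in>?A. fin x - start x) = proc J j"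
    using P j unfolding preemptive_schedule_def by blast
  have "proc J j > 0" using v j by (auto simp: valid_jobs_def)
  then have "?A \<noteq> {}" using s by (metis (no_types, lifting) less_irrefl sum.empty)
  then obtain y where y: "y \<in> P" "job y = j" by blast
  have comp: "fin x \<le> completion P j" if "x \<in> ?A" for x
    unfolding completion_def using that finP by (intro Max_ge) auto
  have "release J j \<le> completion P j"
    using comp[of y] y basic by (fastforce simp: basic_schedule_def)
  then have "(\<Sum>x\<in>?A. fin x - start x) \<le> completion P j - release J j"
    by (intro disjoint_segments_sum) (use finP comp basic in \<open>auto simp: basic_schedule_def\<close>)
  with s show ?thesis by simp
qed

text \<open>The largest job of \<open>A\<close> carries at least a fraction \<open>1 / D\<close> of
  the total, so removing it multiplies the total by at most \<open>1 - 1 / D\<close>, hence by at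
  most \<open>exp (- 1 / D)\<close>. After \<open>card A - k - 1\<close> removals
  \<open>k + 1\<close> jobs are left, and their total exceeds \<tau>.\<close>

lemma exponential_growth:
  fixes D \<tau> :: real
  assumes "finite A" "D \<ge> 1" "\<tau> > 0" "\<And>i. i \<in> A \<Longrightarrow> 0 < proc J i" "k < card A"
    "\<And>q. q \<in> A \<Longrightarrow> k < card {i \<in> A. \<not> prec J q i} \<Longrightarrow>
      \<tau> < proc J q \<and> (\<Sum>i | i \<in> A \<and> \<not> prec J q i. proc J i) \<le> D * proc J q"
  shows "\<tau> * exp ((real (card A) - real k - 1) / D) \<le> (\<Sum>i\<in>A. proc J i)"
  using assms
proof (induction "card A" arbitrary: A)
  case 0
  then show ?case by simp
next
  case (Suc c)
  then have "A \<noteq> {}" by auto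
  then obtain q where q: "q \<in> A" "\<forall>i\<in>A. \<not> prec J q i" using ex_prec_max Suc.prems(1) by blast
  have eq: "{i \<in> A. \<not> prec J q i} = A" using q by auto
  have big: "\<tau> < proc J q" "(\<Sum>i\<in>A. proc J i) \<le> D * proc J q"
    using Suc.prems(6)[of q] Suc.prems(5) q by (auto simp: eq)
  have split: "(\<Sum>i\<in>A. proc J i) = proc J q + (\<Sum>i\<in>A - {q}. proc J i)"
    using q Suc.prems(1) by (simp add: sum.remove)
  show ?case
  proof (cases "c = k")
    case True
    have "(\<Sum>i\<in>A - {q}. proc J i) \<ge> 0" using Suc.prems(4) by (intro sum_nonneg) (auto intro: less_imp_le)
    moreover have "real (card A) - real k - 1 = 0" using True Suc.hyps(2) by linarith
    ultimately show ?thesis using big split by simp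
  next
    case False
    have IH: "\<tau> * exp ((real (card (A - {q})) - real k - 1) / D) \<le> (\<Sum>i\<in>A - {q}. proc J i)"
    proof (rule Suc.hyps(1))
      show "c = card (A - {q})" "k < card (A - {q})"
        using Suc.hyps(2) q Suc.prems(1,5) False by auto
      fix q' assume q': "q' \<in> A - {q}" "k < card {i \<in> A - {q}. \<not> prec J q' i}"
      \<comment> \<open>As \<open>q\<close> is the maximum, its removal does not change the set of
        jobs up to \<open>q'\<close>, so the hypothesis passes to the smaller set.\<close>
      have "prec J q' q" using q q' prec_total by blast
      then have "{i \<in> A - {q}. \<not> prec J q' i} = {i \<in> A. \<not> prec J q' i}" by auto
      with q' Suc.prems(6)[of q'] show "\<tau> < proc J q' \<and>
         (\<Sum>i | i \<in> A - {q} \<and> \<not> prec J q' i. proc J i) \<le> D * proc J q'" by auto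
    qed (use Suc.prems in auto)
    have card: "real (card A) = real (card (A - {q})) + 1" using q Suc.hyps(2) Suc.prems(1) by auto
    have "(\<Sum>i\<in>A - {q}. proc J i) \<le> (\<Sum>i\<in>A. proc J i) * (1 - 1 / D)"
      using big(2) split Suc.prems(2) by (simp add: field_simps)
    also have "\<dots> \<le> (\<Sum>i\<in>A. proc J i) * exp (- 1 / D)"
    proof (rule mult_left_mono)
      show "1 - 1 / D \<le> exp (- 1 / D)" using exp_ge_add_one_self[of "- 1 / D"] by simp
      show "0 \<le> (\<Sum>i\<in>A. proc J i)" using Suc.prems(4) by (intro sum_nonneg) (auto intro: less_imp_le)
    qed
    finally have "\<tau> * exp ((real (card (A - {q})) - real k - 1) / D) * exp (1 / D)
        \<le> (\<Sum>i\<in>A. proc J i) * exp (- 1 / D) * exp (1 / D)"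
      using IH by (intro mult_right_mono) auto
    then show ?thesis unfolding card
      by (simp add: mult.assoc flip: exp_add add_divide_distrib)
  qed
qed

section \<open>Analysis of a schedule\<close>

definition arrived :: "jobs \<Rightarrow> real \<Rightarrow> nat set" where
  "arrived J t = {j. j < length J \<and> release J j \<le> t}"

definition volume :: "jobs \<Rightarrow> real \<Rightarrow> real" where
  "volume J t = (\<Sum>j\<in>arrived J t. proc J j)"

abbreviation capacity :: "nat \<Rightarrow> jobs \<Rightarrow> real \<Rightarrow> nat" where
  "capacity m J t \<equiv> cap m (card (arrived J t))"

lemma finite_arrived [simp]: "finite (arrived J t)"
  by (simp add: arrived_def)

lemma arrived_mono: "s \<le> t \<Longrightarrow> arrived J s \<subseteq> arrived J t"
  by (auto simp: arrived_def)

lemma card_arrived_le: "card (arrived J t) \<le> length J"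
  using card_mono[of "{..<length J}" "arrived J t"] by (auto simp: arrived_def)

text \<open>One term of the comparison between harmonic sum and logarithm, needed to sum reciprocal
  capacities.\<close>

lemma ln_succ_ge: "1 / (real c + 2) \<le> ln (real c + 2) - ln (real c + 1)"
proof -
  have "ln ((real c + 1) / (real c + 2)) \<le> (real c + 1) / (real c + 2) - 1"
    by (rule ln_le_minus_one) simp
  also have "\<dots> = - 1 / (real c + 2)" by (simp add: field_simps)
  finally show ?thesis by (simp add: ln_div)
qed

text \<open>The analysis sees a run only through its events: from \<open>e l\<close> to
  \<open>e (Suc l)\<close> the jobs in \<open>Q l\<close> wait and the segments in
  \<open>act l\<close> are executed, so time integrals become finite sums weighted by
  \<open>dur l\<close>. The assumptions record the consequences of the launch and kill rules,
  detached from the states of the simulation. For instance, \<open>smaller_later\<close> is the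
  effect of always starting the smallest job: a smaller one that now waits was not there at the
  start.\<close>

locale online_run =
  fixes m :: nat and J :: jobs and S :: schedule
    and M :: nat and e :: "nat \<Rightarrow> real" and Q :: "nat \<Rightarrow> nat set"
  fixes act :: "nat \<Rightarrow> segment set" and killed :: "segment set" and dur :: "nat \<Rightarrow> real"
  defines "act \<equiv> \<lambda>l. {a \<in> S. start a \<le> e l \<and> e (Suc l) \<le> fin a}"
    and "killed \<equiv> {a \<in> S. fin a - start a < proc J (job a)}"
    and "dur \<equiv> \<lambda>l. e (Suc l) - e l"
  assumes two_le_m: "2 \<le> m" and valid: "valid_jobs J"
    and kr: "kill_restart_schedule m J S"
    and e_Suc: "l < M \<Longrightarrow> e l < e (Suc l)"
    and release_event: "j < length J \<Longrightarrow> \<exists>l\<le>M. release J j = e l"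
    and completion_event: "j < length J \<Longrightarrow> \<exists>l\<le>M. completion S j = e l"
    and Q_0: "Q 0 = {}"
    and waiting: "l < M \<Longrightarrow> j \<in> Q l \<Longrightarrow> j < length J \<and> release J j \<le> e l"
    and waiting_unstarted: "l < M \<Longrightarrow> j \<in> Q l \<Longrightarrow> a \<in> S - killed \<Longrightarrow> job a = j \<Longrightarrow> e l < start a"
    and alive: "l < M \<Longrightarrow> j < length J \<Longrightarrow> release J j \<le> e l \<Longrightarrow> e l < completion S j \<Longrightarrow>
       j \<in> Q l \<or> j \<in> job ` act l"
    and few_smaller: "l < M \<Longrightarrow> a \<in> act l \<Longrightarrow> card {q \<in> Q l. prec J q (job a)} \<le> capacity m J (e l)"
    and busy: "l < M \<Longrightarrow> Q l \<noteq> {} \<Longrightarrow> 2 * h < m \<Longrightarrow> h \<in> machine ` act l"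
    and busy_small: "l < M \<Longrightarrow> q \<in> Q l \<Longrightarrow> proc J q * real (capacity m J (e l)) < volume J (e l) \<Longrightarrow>
       h < m \<Longrightarrow> h \<in> machine ` act l"
    and smaller_later: "l < M \<Longrightarrow> a \<in> act l \<Longrightarrow> q \<in> Q l \<Longrightarrow> prec J q (job a) \<Longrightarrow> start a < release J q"
    and kill_arrivals: "a \<in> killed \<Longrightarrow>
       capacity m J (fin a) < card {q. q < length J \<and> start a < release J q \<and> release J q \<le> fin a}"
    and small_started: "a \<in> S \<Longrightarrow> \<not> 2 * machine a < m \<Longrightarrow>
       proc J (job a) * real (capacity m J (start a)) < volume J (start a)"
begin

section \<open>Elementary facts about runs and event intervals\<close>

definition "n = length J"
definition "L = (\<Sum>j<n. proc J j)"
text \<open>The ratio aimed at, up to logarithms. Note that \<open>real m * x\<close> is the square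
  root of \<open>n * m\<close>, the order of magnitude of \<kappa> once \<open>n\<close> exceeds
  \<open>m\<close>.\<close>

definition "x = sqrt (real n / real m)"
definition "\<kappa> = cap m n"

lemma proc_pos: "j < n \<Longrightarrow> 0 < proc J j"
  using valid by (auto simp: valid_jobs_def n_def)

lemma m_pos: "0 < m" "0 < real m" using two_le_m by auto

lemma x_nonneg: "0 \<le> x" by (simp add: x_def)

lemma L_nonneg: "0 \<le> L"
  unfolding L_def by (intro sum_nonneg) (auto intro: less_imp_le proc_pos)

lemma sum_proc_le: "A \<subseteq> {..<n} \<Longrightarrow> sum (proc J) A \<le> L"
  unfolding L_def by (intro sum_mono2) (auto intro: less_imp_le proc_pos)

lemma volume_le: "volume J t \<le> L"
  unfolding volume_def by (intro sum_proc_le) (auto simp: arrived_def n_def)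

lemma capacity_le: "capacity m J t \<le> \<kappa>"
  unfolding \<kappa>_def n_def by (intro cap_mono card_arrived_le)

lemma capacity_pos: "0 < capacity m J t"
  using cap_ge[of m] m_pos(1) by (metis less_le_trans)

lemma basic: "basic_schedule m J S"
  using kr unfolding kill_restart_schedule_def by blast

lemma finS: "finite S"
  using basic unfolding basic_schedule_def by blast

lemma seg: "a \<in> S \<Longrightarrow> job a < n" "a \<in> S \<Longrightarrow> machine a < m"
    "a \<in> S \<Longrightarrow> release J (job a) \<le> start a" "a \<in> S \<Longrightarrow> start a < fin a"
  using basic unfolding basic_schedule_def n_def by blast+

lemma seg_disjoint:
  "a \<in> S \<Longrightarrow> b \<in> S \<Longrightarrow> a \<noteq> b \<Longrightarrow> machine a = machine b \<or> job a = job b \<Longrightarrow>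
     fin a \<le> start b \<or> fin b \<le> start a"
  using basic unfolding basic_schedule_def by blast

lemma last_run:
  assumes "j < n"
  obtains a where "a \<in> S" "job a = j" "fin a - start a = proc J j"
    "\<And>b. b \<in> S \<Longrightarrow> job b = j \<Longrightarrow> b \<noteq> a \<Longrightarrow> fin b - start b < proc J j \<and> fin b \<le> start a"
proof -
  have "\<exists>x\<in>S. job x = j \<and> fin x - start x = proc J j \<and>
        (\<forall>y\<in>S. job y = j \<and> y \<noteq> x \<longrightarrow> fin y - start y < proc J j \<and> fin y \<le> start x)"
    using kr assms unfolding kill_restart_schedule_def n_def by blast
  then obtain y where "y\<in>S" "job y = j" "fin y - start y = proc J j"
     "(\<forall>b\<in>S. job b = j \<and> b \<noteq> y \<longrightarrow> fin b - start b < proc J j \<and> fin b \<le> start y)"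
    by blast
  then show ?thesis by (intro that) blast+
qed

lemma seg_len_le: assumes "a \<in> S" shows "fin a - start a \<le> proc J (job a)"
proof -
  obtain b where "b \<in> S" "job b = job a" "fin b - start b = proc J (job a)"
    "\<And>c. c \<in> S \<Longrightarrow> job c = job a \<Longrightarrow> c \<noteq> b \<Longrightarrow> fin c - start c < proc J (job a) \<and> fin c \<le> start b"
    by (rule last_run[OF seg(1)]) (use assms in auto)
  then show ?thesis using assms by (cases "a = b") (auto intro: less_imp_le)
qed

lemma completed_len: "a \<in> S - killed \<Longrightarrow> fin a - start a = proc J (job a)"
  using seg_len_le[of a] by (auto simp: killed_def)

text \<open>Every run of a job except its last is strictly shorter than the job. Hence sums over
  completed runs become sums over jobs.\<close>

lemma completed_inj: "inj_on job (S - killed)"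
proof (rule inj_onI)
  fix a b assume ab: "a \<in> S - killed" "b \<in> S - killed" "job a = job b"
  obtain c where c: "c \<in> S" "job c = job a" "fin c - start c = proc J (job a)"
    "\<And>d. d \<in> S \<Longrightarrow> job d = job a \<Longrightarrow> d \<noteq> c \<Longrightarrow> fin d - start d < proc J (job a) \<and> fin d \<le> start c"
    by (rule last_run[OF seg(1)]) (use ab in auto)
  have "a = c" using c(4)[of a] ab(1) completed_len[of a] by fastforce
  moreover have "b = c" using c(4)[of b] ab completed_len[of b] by fastforce
  ultimately show "a = b" by simp
qed

lemma completion_eq: assumes "a \<in> S - killed" shows "completion S (job a) = fin a"
proof -
  obtain c where c: "c \<in> S" "job c = job a" "fin c - start c = proc J (job a)"
    "\<And>d. d \<in> S \<Longrightarrow> job d = job a \<Longrightarrow> d \<noteq> c \<Longrightarrow> fin d - start d < proc J (job a) \<and> fin d \<le> start c"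
    by (rule last_run[OF seg(1)]) (use assms in auto)
  have ac: "a = c" using c(4)[of a] assms(1) completed_len[of a] by fastforce
  show ?thesis unfolding completion_def
  proof (rule Max_eqI)
    fix y assume "y \<in> fin ` {x \<in> S. job x = job a}"
    then obtain d where d: "d \<in> S" "job d = job a" "y = fin d" by blast
    show "y \<le> fin a"
    proof (cases "d = a")
      case False
      then have "fin d \<le> start a" using c(4)[of d] d ac by blast
      then show ?thesis using seg(4)[of a] assms d by auto
    qed (use d in simp)
  qed (use finS assms in auto)
qed

lemma completed_exists: assumes "j < n" shows "\<exists>a\<in>S - killed. job a = j"
proof -
  obtain a where "a \<in> S" "job a = j" "fin a - start a = proc J j"
    by (rule last_run[OF assms])
  then show ?thesis by (auto simp: killed_def)
qed

lemma sum_completed_le: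
  fixes f :: "nat \<Rightarrow> real"
  assumes "B \<subseteq> S - killed" "\<And>j. j < n \<Longrightarrow> 0 \<le> f j"
  shows "(\<Sum>a\<in>B. f (job a)) \<le> (\<Sum>j<n. f j)"
proof -
  have "(\<Sum>a\<in>B. f (job a)) = (\<Sum>j\<in>job ` B. f j)"
    using assms completed_inj by (subst sum.reindex) (auto intro: inj_on_subset)
  also have "\<dots> \<le> (\<Sum>j<n. f j)" using assms seg(1) by (intro sum_mono2) auto
  finally show ?thesis .
qed

lemma killed_sub: "killed \<subseteq> S" by (auto simp: killed_def)

lemma fin_killed: "finite killed" using finS killed_sub finite_subset by blast

lemma e_mono: "a \<le> b \<Longrightarrow> b \<le> M \<Longrightarrow> e a \<le> e b"
proof (induction b rule: dec_induct)
  case (step b)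
  then show ?case using e_Suc[of b] by auto
qed simp

lemma e_less: "a < b \<Longrightarrow> b \<le> M \<Longrightarrow> e a < e b"
  using e_Suc[of a] e_mono[of "Suc a" b] by auto

lemma e_less_iff: "a \<le> M \<Longrightarrow> b \<le> M \<Longrightarrow> e a < e b \<longleftrightarrow> a < b"
  by (metis e_less e_mono leD not_le)

lemma dur_nonneg: "l < M \<Longrightarrow> 0 \<le> dur l" using e_Suc[of l] by (simp add: dur_def)

lemma dur_telescope: "a \<le> b \<Longrightarrow> (\<Sum>l\<in>{a..<b}. dur l) = e b - e a"
  unfolding dur_def by (rule sum_Suc_diff') simp

text \<open>Extend the sum to all indices from the least to the greatest one in \<open>X\<close>;
  then it telescopes.\<close>

lemma dur_sum_le:
  assumes X: "X \<subseteq> {..<M}" and uv: "u \<le> v"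
    and in_uv: "\<And>l. l \<in> X \<Longrightarrow> u \<le> e l \<and> e (Suc l) \<le> v"
  shows "sum dur X \<le> v - u"
proof (cases "X = {}")
  case False
  have f: "finite X" using X finite_subset by blast
  define a b where "a = Min X" and "b = Max X"
  have ab: "a \<in> X" "b \<in> X" "X \<subseteq> {a..<Suc b}" using f False by (auto simp: a_def b_def less_Suc_eq_le)
  have "sum dur X \<le> sum dur {a..<Suc b}"
    using ab X by (intro sum_mono2 dur_nonneg) auto
  also have "\<dots> = e (Suc b) - e a" using ab by (intro dur_telescope) auto
  also have "\<dots> \<le> v - u" using in_uv[of a] in_uv[of b] ab by auto
  finally show ?thesis .
qed (use uv in simp)

section \<open>Busy machines and killed runs\<close>

lemma act_sub: "act l \<subseteq> S" by (auto simp: act_def)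

lemma dur_act_le:
  assumes "a \<in> S" "X \<subseteq> {..<M}" "\<And>l. l \<in> X \<Longrightarrow> a \<in> act l"
  shows "sum dur X \<le> fin a - start a"
  by (rule dur_sum_le) (use assms seg(4)[of a] in \<open>auto simp: act_def\<close>)

lemma act_inj: "l < M \<Longrightarrow> inj_on machine (act l)"
proof (rule inj_onI)
  fix a b assume l: "l < M" and ab: "a \<in> act l" "b \<in> act l" "machine a = machine b"
  show "a = b"
  proof (rule ccontr)
    assume "a \<noteq> b"
    then have "fin a \<le> start b \<or> fin b \<le> start a" using seg_disjoint[of a b] ab act_sub by blast
    then show False using ab e_Suc[OF l] by (auto simp: act_def)
  qed
qed

lemma card_act_le: "l < M \<Longrightarrow> card (act l) \<le> m"
proof -
  assume "l < M"
  then have "card (act l) = card (machine ` act l)" using act_inj card_image by metis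
  also have "\<dots> \<le> card {..<m}" using seg(2) act_sub by (intro card_mono) auto
  finally show ?thesis by simp
qed

lemma fin_act: "finite (act l)" using finS act_sub finite_subset by blast

lemma fin_Q: "l < M \<Longrightarrow> finite (Q l)"
  by (rule finite_subset[of _ "{..<n}"]) (use waiting in \<open>auto simp: n_def\<close>)

text \<open>Double counting: in each interval of \<open>X\<close> the machines of \<open>H\<close>
  carry distinct segments of \<open>B\<close>. Exchanging the sums charges the weight
  \<open>g\<close> of an interval to the runs active in it.\<close>

lemma busy_sum:
  assumes X: "X \<subseteq> {..<M}" and B: "B \<subseteq> S" and g: "\<And>l. l \<in> X \<Longrightarrow> 0 \<le> (g l :: real)"
    and b: "\<And>l. l \<in> X \<Longrightarrow> H \<subseteq> machine ` (act l \<inter> B)" and H: "finite H"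
  shows "real (card H) * (\<Sum>l\<in>X. dur l * g l) \<le> (\<Sum>a\<in>B. \<Sum>l | l \<in> X \<and> a \<in> act l. dur l * g l)"
proof -
  have fX: "finite X" and fB: "finite B" using X B finS finite_subset by blast+
  have "real (card H) * (\<Sum>l\<in>X. dur l * g l) = (\<Sum>l\<in>X. real (card H) * (dur l * g l))"
    by (rule sum_distrib_left)
  also have "\<dots> \<le> (\<Sum>l\<in>X. real (card (act l \<inter> B)) * (dur l * g l))"
  proof (intro sum_mono mult_right_mono)
    fix l assume l: "l \<in> X"
    have "card H \<le> card (machine ` (act l \<inter> B))" using b[OF l] fin_act by (intro card_mono) auto
    also have "\<dots> \<le> card (act l \<inter> B)" using fin_act by (intro card_image_le) auto
    finally show "real (card H) \<le> real (card (act l \<inter> B))" by simp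
    show "0 \<le> dur l * g l" using l X g dur_nonneg by auto
  qed
  also have "\<dots> = (\<Sum>l\<in>X. \<Sum>a\<in>B. if a \<in> act l then dur l * g l else 0)"
    by (rule sum.cong[OF refl]) (use fB in \<open>simp add: sum.If_cases Int_commute\<close>)
  also have "\<dots> = (\<Sum>a\<in>B. \<Sum>l\<in>X. if a \<in> act l then dur l * g l else 0)" by (rule sum.swap)
  also have "\<dots> = (\<Sum>a\<in>B. \<Sum>l | l \<in> X \<and> a \<in> act l. dur l * g l)"
    by (rule sum.cong[OF refl]) (use fX in \<open>simp add: sum.If_cases Int_def\<close>)
  finally show ?thesis .
qed

lemma busy_time:
  assumes X: "X \<subseteq> {..<M}" and B: "B \<subseteq> S" and b: "\<And>l. l \<in> X \<Longrightarrow> H \<subseteq> machine ` (act l \<inter> B)"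
    and H: "finite H"
  shows "real (card H) * sum dur X \<le> (\<Sum>a\<in>B. fin a - start a)"
proof -
  have "real (card H) * sum dur X = real (card H) * (\<Sum>l\<in>X. dur l * 1)" by simp
  also have "\<dots> \<le> (\<Sum>a\<in>B. \<Sum>l | l \<in> X \<and> a \<in> act l. dur l * 1)"
    by (rule busy_sum) (use assms in auto)
  also have "\<dots> \<le> (\<Sum>a\<in>B. fin a - start a)"
  proof (rule sum_mono)
    fix a assume "a \<in> B"
    then have "sum dur {l. l \<in> X \<and> a \<in> act l} \<le> fin a - start a"
      using X B by (intro dur_act_le) auto
    then show "(\<Sum>l | l \<in> X \<and> a \<in> act l. dur l * 1) \<le> fin a - start a" by simp
  qed
  finally show ?thesis .
qed

text \<open>A run is killed only if more than \<open>sqrt ((N + m) m)\<close> jobs arrived during it, where \<open>N\<close> is the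
  number of jobs known at that time. Hence consecutive killed runs push \<open>sqrt (N + m)\<close> up by at
  least \<open>sqrt m / 2\<close> each.\<close>

lemma kill_chain:
  assumes "finite A" "A \<subseteq> killed"
    "\<And>a b. a \<in> A \<Longrightarrow> b \<in> A \<Longrightarrow> a \<noteq> b \<Longrightarrow> fin a \<le> start b \<or> fin b \<le> start a"
    "\<And>a. a \<in> A \<Longrightarrow> fin a \<le> T"
  shows "sqrt (real m) * (2 + real (card A)) \<le> 2 * sqrt (real (card (arrived J T)) + real m) \<and>
     (\<Sum>a\<in>A. 1 / real (capacity m J (start a))) \<le> 2 / real m * ln (real (card A) + 1)"
  using assms
proof (induction "card A" arbitrary: A T)
  case 0
  then have "A = {}" by auto
  then show ?case by simp
next
  case (Suc c)
  then have "A \<noteq> {}" by auto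
  then obtain a where a: "a \<in> A" "\<And>b. b \<in> A \<Longrightarrow> fin b \<le> fin a"
    using ex_latest[OF Suc.prems(1)] by blast
  have aS: "a \<in> S" using a Suc.prems(2) killed_sub by auto
  have IH: "sqrt (real m) * (2 + real (card (A - {a}))) \<le> 2 * sqrt (real (card (arrived J (start a))) + real m) \<and>
     (\<Sum>a\<in>A - {a}. 1 / real (capacity m J (start a))) \<le> 2 / real m * ln (real (card (A - {a})) + 1)"
  proof (rule Suc.hyps(1))
    show "c = card (A - {a})" using Suc.hyps(2) a(1) Suc.prems(1) by simp
    show "fin b \<le> start a" if "b \<in> A - {a}" for b
    proof -
      have "fin b \<le> start a \<or> fin a \<le> start b" using Suc.prems(3)[of b a] that a by auto
      moreover have "start b < fin b" using that Suc.prems(2) killed_sub seg(4) by auto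
      moreover have "fin b \<le> fin a" using that a by auto
      ultimately show ?thesis by auto
    qed
  qed (use Suc.prems in auto)
  have c: "card (A - {a}) = c" "card A = Suc c" using Suc.hyps(2) a(1) Suc.prems(1) by simp_all
  define N0 N1 where "N0 = card (arrived J (start a))" and "N1 = card (arrived J (fin a))"
  define s0 s1 where "s0 = sqrt (real N0 + real m)" and "s1 = sqrt (real N1 + real m)"
  let ?N = "{q. q < length J \<and> start a < release J q \<and> release J q \<le> fin a}"
  have "arrived J (fin a) = arrived J (start a) \<union> ?N" using seg(4)[OF aS] by (auto simp: arrived_def)
  moreover have "card (arrived J (start a) \<union> ?N) = card (arrived J (start a)) + card ?N"
    by (rule card_Un_disjoint) (auto simp: arrived_def)
  ultimately have N1: "N1 = N0 + card ?N" unfolding N0_def N1_def by simp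
  \<comment> \<open>The kill rule uses the capacity at the end of the run, so \<open>N1 - N0\<close>
    exceeds \<open>s1 * sqrt (real m)\<close>. Division by \<open>s1 + s0\<close>, which is at most
    \<open>2 * s1\<close>, gives the rise by half of \<open>sqrt (real m)\<close>.\<close>
  have "real N1 - real N0 > real (cap m N1)"
    using kill_arrivals[of a] a(1) Suc.prems(2) N1 unfolding N1_def[symmetric] by auto
  moreover have "real (cap m N1) \<ge> s1 * sqrt (real m)"
    using cap_sqrt[of N1 m] by (simp add: s1_def real_sqrt_mult)
  ultimately have "s1\<^sup>2 - s0\<^sup>2 > s1 * sqrt (real m)" by (simp add: s0_def s1_def)
  then have *: "(s1 - s0) * (s1 + s0) > s1 * sqrt (real m)" by (simp add: power2_eq_square algebra_simps)
  have s01: "s0 \<le> s1" "0 < s1" "0 \<le> s0"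
    using N1 m_pos by (auto simp: s0_def s1_def add_nonneg_pos)
  have "(s1 - s0) * (s1 + s0) \<le> (s1 - s0) * (2 * s1)" using s01 by (intro mult_left_mono) auto
  with * have "s1 * sqrt (real m) < s1 * (2 * (s1 - s0))" by (simp add: algebra_simps)
  then have s: "sqrt (real m) < 2 * (s1 - s0)" using s01 by simp
  have "s1 \<le> sqrt (real (card (arrived J T)) + real m)"
    unfolding s1_def N1_def using Suc.prems(4)[OF a(1)] by (intro real_sqrt_le_mono) (simp add: card_mono arrived_mono)
  moreover have IH1: "sqrt (real m) * (2 + real c) \<le> 2 * s0" using IH c by (simp add: s0_def N0_def)
  ultimately have 1: "sqrt (real m) * (2 + real (card A)) \<le> 2 * sqrt (real (card (arrived J T)) + real m)"
    using s c by (simp add: algebra_simps)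
  \<comment> \<open>By the first claim, the capacity after \<open>c\<close> earlier kills is at
    least \<open>m * (2 + c) / 2\<close>; so the reciprocals are dominated by a harmonic sum with
    factor \<open>2 / m\<close>.\<close>
  have "real m * (2 + real c) / 2 = sqrt (real m) * (sqrt (real m) * (2 + real c)) / 2" by simp
  also have "\<dots> \<le> sqrt (real m) * s0"
    using mult_left_mono[OF IH1, of "sqrt (real m)"] by simp
  also have "\<dots> \<le> real (cap m N0)" using cap_sqrt[of N0 m] by (simp add: s0_def real_sqrt_mult mult.commute)
  finally have cc: "real m * (2 + real c) / 2 \<le> real (cap m N0)" .
  have "1 / real (cap m N0) \<le> 1 / (real m * (2 + real c) / 2)"
    using cc m_pos capacity_pos[of "start a"]
    by (intro divide_left_mono) (auto simp: N0_def intro!: mult_pos_pos)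
  also have "\<dots> = 2 / real m * (1 / (real c + 2))" by (simp add: field_simps)
  also have "\<dots> \<le> 2 / real m * (ln (real c + 2) - ln (real c + 1))"
    using ln_succ_ge[of c] m_pos by (intro mult_left_mono) auto
  finally have "1 / real (cap m N0) \<le> 2 / real m * (ln (real c + 2) - ln (real c + 1))" .
  moreover have "(\<Sum>a\<in>A. 1 / real (capacity m J (start a)))
     = 1 / real (cap m N0) + (\<Sum>a\<in>A - {a}. 1 / real (capacity m J (start a)))"
    using a Suc.prems(1) by (simp add: sum.remove N0_def)
  ultimately have "(\<Sum>a\<in>A. 1 / real (capacity m J (start a))) \<le> 2 / real m * ln (real (card A) + 1)"
    using IH c by (simp add: algebra_simps)
  with 1 show ?case by blast
qed

text \<open>The root of \<open>N + m\<close> starts at \<open>sqrt m\<close> and ends at most at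
  \<open>sqrt n + sqrt m\<close>, which leaves room for \<open>2 * x\<close> kills. The hypothesis
  asks for disjoint runs, so it covers the killed runs on one machine as well as those of one
  job.\<close>

lemma kill_chain_card:
  assumes "A \<subseteq> killed"
    "\<And>a b. a \<in> A \<Longrightarrow> b \<in> A \<Longrightarrow> a \<noteq> b \<Longrightarrow> fin a \<le> start b \<or> fin b \<le> start a"
  shows "real (card A) \<le> 2 * x"
    and "(\<Sum>a\<in>A. 1 / real (capacity m J (start a))) \<le> 2 / real m * ln (2 * x + 1)"
proof -
  have finA: "finite A" using assms(1) fin_killed finite_subset by blast
  \<comment> \<open>The element 0 keeps \<open>Max\<close> defined when \<open>A\<close> is
    empty.\<close>
  define T where "T = Max (insert 0 (fin ` A))"
  have T: "fin a \<le> T" if "a \<in> A" for a unfolding T_def using finA that by (intro Max_ge) auto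
  note kc = kill_chain[OF finA assms T]
  have "sqrt (real m) * (2 + real (card A)) \<le> 2 * sqrt (real (card (arrived J T)) + real m)"
    using kc by blast
  also have "\<dots> \<le> 2 * sqrt (real n + real m)"
    using card_arrived_le[of J T] by (simp add: n_def)
  also have "\<dots> \<le> 2 * (sqrt (real n) + sqrt (real m))"
    by (intro mult_left_mono sqrt_add_le_add_sqrt) auto
  finally have "sqrt (real m) * real (card A) \<le> 2 * sqrt (real n)" by (simp add: algebra_simps)
  then show c: "real (card A) \<le> 2 * x" using m_pos
    by (simp add: x_def real_sqrt_divide field_simps)
  have "2 / real m * ln (real (card A) + 1) \<le> 2 / real m * ln (2 * x + 1)"
    using c m_pos by (intro mult_left_mono) auto
  with kc show "(\<Sum>a\<in>A. 1 / real (capacity m J (start a))) \<le> 2 / real m * ln (2 * x + 1)" by linarith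
qed

lemma killed_on_machine: "real (card {a \<in> killed. machine a = h}) \<le> 2 * x"
  by (rule kill_chain_card) (use seg_disjoint killed_sub in auto)

lemma killed_of_job: "real (card {a \<in> killed. job a = j}) \<le> 2 * x"
  by (rule kill_chain_card) (use seg_disjoint killed_sub in auto)

lemma killed_on_machines:
  assumes "finite H" shows "real (card {a \<in> killed. machine a \<in> H}) \<le> real (card H) * (2 * x)"
proof -
  have "{a \<in> killed. machine a \<in> H} = (\<Union>h\<in>H. {a \<in> killed. machine a = h})" by auto
  then have "card {a \<in> killed. machine a \<in> H} \<le> (\<Sum>h\<in>H. card {a \<in> killed. machine a = h})"
    using card_UN_le[OF assms] by auto
  then have "real (card {a \<in> killed. machine a \<in> H}) \<le> (\<Sum>h\<in>H. real (card {a \<in> killed. machine a = h}))"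
    by (simp only: of_nat_sum[symmetric] of_nat_le_iff)
  also have "\<dots> \<le> (\<Sum>h\<in>H. 2 * x)" by (intro sum_mono killed_on_machine)
  finally show ?thesis by simp
qed

lemma card_killed: "real (card killed) \<le> real m * (2 * x)"
proof -
  have "killed = {a \<in> killed. machine a \<in> {..<m}}" using killed_sub seg(2) by auto
  then show ?thesis using killed_on_machines[of "{..<m}"] by simp
qed

text \<open>Kills are counted per job here: each job wastes at most \<open>2 * x\<close> runs, none
  longer than its processing time.\<close>

lemma total_run_time: "(\<Sum>a\<in>S. fin a - start a) \<le> (1 + 2 * x) * L"
proof -
  have "(\<Sum>a\<in>S. fin a - start a) = (\<Sum>a\<in>killed. fin a - start a) + (\<Sum>a\<in>S - killed. fin a - start a)"
    using sum.subset_diff[OF killed_sub finS] by (metis add.commute)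
  also have "(\<Sum>a\<in>S - killed. fin a - start a) = (\<Sum>a\<in>S - killed. proc J (job a))"
    by (intro sum.cong refl completed_len)
  also have "\<dots> \<le> L" unfolding L_def by (rule sum_completed_le) (auto intro: less_imp_le proc_pos)
  also have "(\<Sum>a\<in>killed. fin a - start a) \<le> (\<Sum>a\<in>killed. proc J (job a))"
    using killed_sub by (intro sum_mono seg_len_le) auto
  also have "\<dots> = (\<Sum>j<n. \<Sum>a\<in>{a\<in>killed. job a = j}. proc J (job a))"
    using fin_killed killed_sub seg(1) by (intro sum.group[symmetric]) auto
  also have "\<dots> = (\<Sum>j<n. real (card {a\<in>killed. job a = j}) * proc J j)" by simp
  also have "\<dots> \<le> (\<Sum>j<n. 2 * x * proc J j)"
    by (intro sum_mono mult_right_mono killed_of_job) (auto intro: less_imp_le proc_pos)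
  also have "\<dots> = 2 * x * L" by (simp add: L_def sum_distrib_left)
  finally show ?thesis by (simp add: algebra_simps)
qed

text \<open>Each of these jobs makes up at least a fraction \<open>1 / capacity\<close> of the
  volume, and together they do not exceed it.\<close>

lemma big_few:
  assumes "A \<subseteq> arrived J t" "\<And>q. q \<in> A \<Longrightarrow> volume J t \<le> proc J q * real (capacity m J t)"
  shows "card A \<le> capacity m J t"
proof (cases "A = {}")
  case False
  have fA: "finite A" using finite_subset[OF assms(1)] by simp
  have sub: "arrived J t \<subseteq> {..<n}" by (auto simp: arrived_def n_def)
  have pos: "0 < volume J t"
  proof -
    obtain q where "q \<in> A" using False by auto
    then have "0 < proc J q" "q \<in> arrived J t" using assms sub proc_pos by auto
    then show ?thesis unfolding volume_def
      using sub by (intro sum_pos2[of _ q]) (auto intro: less_imp_le proc_pos)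
  qed
  have "real (card A) * volume J t = (\<Sum>q\<in>A. volume J t)" by simp
  also have "\<dots> \<le> (\<Sum>q\<in>A. proc J q * real (capacity m J t))" using assms(2) by (rule sum_mono)
  also have "\<dots> = (\<Sum>q\<in>A. proc J q) * real (capacity m J t)" by (simp add: sum_distrib_right)
  also have "\<dots> \<le> volume J t * real (capacity m J t)"
    unfolding volume_def using assms(1) sub
    by (intro mult_right_mono sum_mono2) (auto intro: less_imp_le proc_pos)
  finally have "real (card A) \<le> real (capacity m J t)" using pos by (simp add: mult.commute)
  then show ?thesis by simp
qed simp

section \<open>Overflow of the queue and comparison with the optimum\<close>

lemma Q_arrived: "l < M \<Longrightarrow> Q l \<subseteq> arrived J (e l)"
  using waiting by (auto simp: arrived_def)

text \<open>More than \<kappa> waiting jobs cannot all be big, so a small one waits and even the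
  reserved machines are busy. For a machine working on a job beyond \<open>q\<close> all waiting
  jobs up to \<open>q\<close> would be smaller, too many for its run to have survived.\<close>

lemma overflow_busy:
  assumes l: "l < M" and q: "\<kappa> < card {i \<in> Q l. \<not> prec J q i}"
  shows "{..<m} \<subseteq> machine ` (act l \<inter> {a. \<not> prec J q (job a)})"
proof
  fix h assume h: "h \<in> {..<m}"
  have "\<exists>i \<in> Q l. proc J i * real (capacity m J (e l)) < volume J (e l)"
  proof (rule ccontr)
    assume "\<not> ?thesis"
    then have "card (Q l) \<le> capacity m J (e l)"
      by (intro big_few Q_arrived l) (auto simp: not_less)
    moreover have "card {i \<in> Q l. \<not> prec J q i} \<le> card (Q l)" using fin_Q[OF l] by (intro card_mono) auto
    ultimately show False using q capacity_le[of "e l"] by linarith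
  qed
  then obtain a where a: "a \<in> act l" "machine a = h" using busy_small[OF l] h by blast
  have "\<not> prec J q (job a)"
  proof
    assume qa: "prec J q (job a)"
    have "prec J i (job a)" if "\<not> prec J q i" for i
      using qa that prec_total[of i q J] prec_trans[of J i q "job a"] by (cases "i = q") auto
    then have "{i \<in> Q l. \<not> prec J q i} \<subseteq> {i \<in> Q l. prec J i (job a)}" by auto
    then have "card {i \<in> Q l. \<not> prec J q i} \<le> card {i \<in> Q l. prec J i (job a)}"
      using fin_Q[OF l] by (intro card_mono) auto
    also have "\<dots> \<le> capacity m J (e l)" using few_smaller[OF l a(1)] .
    finally show False using q capacity_le[of "e l"] by linarith
  qed
  then show "h \<in> machine ` (act l \<inter> {a. \<not> prec J q (job a)})" using a by blast
qed

lemma sum_proc_le_card: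
  assumes "finite A" "\<And>i. i \<in> A \<Longrightarrow> \<not> prec J q i" "real (card A) \<le> c" "q < n"
  shows "(\<Sum>i\<in>A. proc J i) \<le> c * proc J q"
proof -
  have "(\<Sum>i\<in>A. proc J i) \<le> real (card A) * proc J q"
    using assms(2) prec_le by (intro sum_bounded_above) blast
  also have "\<dots> \<le> c * proc J q" using assms proc_pos[of q] by (intro mult_right_mono) auto
  finally show ?thesis .
qed

text \<open>Releases are events, so none lies strictly between two consecutive event times.\<close>

lemma release_after: "j < n \<Longrightarrow> k < M \<Longrightarrow> e k < release J j \<Longrightarrow> e (Suc k) \<le> release J j"
  using release_event[of j] e_less_iff[of k] e_mono[of "Suc k"] unfolding n_def
  by (metis Suc_leI less_imp_le)

definition opt_alive :: "schedule \<Rightarrow> nat \<Rightarrow> nat set" where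
  "opt_alive P l = {j. j < n \<and> release J j \<le> e l \<and> e (Suc l) \<le> completion P j}"

lemma fin_opt_alive: "finite (opt_alive P l)" by (simp add: opt_alive_def)

text \<open>Since the last time when at most \<open>\<kappa>\<close> jobs up to \<open>q\<close> were waiting, all machines have been
  working on such jobs only. So, except for the work wasted on killed runs, the optimum cannot have
  finished more of the volume released since then.\<close>

lemma waiting_volume:
  assumes P: "preemptive_schedule m J P" and k: "k < M" and q: "q < n"
    and over: "\<kappa> < card {i \<in> Q k. \<not> prec J q i}"
  shows "(\<Sum>i | i \<in> Q k \<and> \<not> prec J q i. proc J i)
     \<le> (real (card (opt_alive P k)) + real \<kappa> + real m + real m * (2 * x)) * proc J q"
proof -
  \<comment> \<open>\<open>k2\<close> is the last index without overflow; it exists because nothing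
    waits at index 0. The comparison starts at \<open>e (Suc k2)\<close>, from which on all machines
    work on jobs up to \<open>q\<close>.\<close>
  define K2 where "K2 = {l. l \<le> k \<and> card {i \<in> Q l. \<not> prec J q i} \<le> \<kappa>}"
  define k2 where "k2 = Max K2"
  have "0 \<in> K2" "finite K2" using Q_0 by (auto simp: K2_def)
  then have k2: "k2 \<in> K2" "\<And>l. l \<in> K2 \<Longrightarrow> l \<le> k2"
    unfolding k2_def using Max_in[of K2] Max_ge[of K2] by blast+
  have "k2 \<le> k" "card {i \<in> Q k2. \<not> prec J q i} \<le> \<kappa>" using k2(1) by (simp_all add: K2_def)
  then have k2k: "k2 < k" using over by (cases "k2 = k") auto
  define X where "X = {Suc k2..<Suc k}"
  have X: "X \<subseteq> {..<M}" using k by (auto simp: X_def)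
  have overX: "\<kappa> < card {i \<in> Q l. \<not> prec J q i}" if "l \<in> X" for l
    using k2(2)[of l] that by (force simp: X_def K2_def)
  define B where "B = {a \<in> S. \<not> prec J q (job a) \<and> (\<exists>l\<in>X. a \<in> act l)}"
  define T where "T = e (Suc k) - e (Suc k2)"
  have T: "sum dur X = T" unfolding X_def T_def using k2k by (intro dur_telescope) auto
  have T0: "e (Suc k2) \<le> e (Suc k)" using k2k k by (intro e_mono) auto
  have finB: "finite B" using finS by (simp add: B_def)
  have "real (card {..<m}) * sum dur X \<le> (\<Sum>a\<in>B. fin a - start a)"
  proof (rule busy_time[OF X])
    fix l assume l: "l \<in> X"
    then have "{..<m} \<subseteq> machine ` (act l \<inter> {a. \<not> prec J q (job a)})"
      using X by (intro overflow_busy overX) auto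
    moreover have "act l \<inter> {a. \<not> prec J q (job a)} \<subseteq> act l \<inter> B"
      using l act_sub by (auto simp: B_def)
    ultimately show "{..<m} \<subseteq> machine ` (act l \<inter> B)" by blast
  qed (auto simp: B_def)
  then have mT: "real m * T \<le> (\<Sum>a\<in>B. fin a - start a)" using T by simp
  define Cs where "Cs = job ` (B - killed)"
  define W where "W = {i \<in> Q k. \<not> prec J q i}"
  have finW: "finite W" using fin_Q[OF k] by (simp add: W_def)
  have finC: "finite Cs" using finB by (simp add: Cs_def)
  have "(\<Sum>a\<in>B. fin a - start a) = (\<Sum>a\<in>B \<inter> killed. fin a - start a) + (\<Sum>a\<in>B - killed. fin a - start a)"
    by (rule sum.Int_Diff[OF finB])
  also have "(\<Sum>a\<in>B - killed. fin a - start a) = (\<Sum>a\<in>B - killed. proc J (job a))"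
    by (intro sum.cong refl completed_len) (auto simp: B_def)
  also have "\<dots> = sum (proc J) Cs"
    unfolding Cs_def by (rule sum.reindex_cong[symmetric, of job])
      (use completed_inj in \<open>auto simp: B_def intro: inj_on_subset\<close>)
  also have "(\<Sum>a\<in>B \<inter> killed. fin a - start a) \<le> real (card (B \<inter> killed)) * proc J q"
  proof (rule sum_bounded_above)
    fix a assume "a \<in> B \<inter> killed"
    then show "fin a - start a \<le> proc J q"
      using seg_len_le[of a] prec_le[of J q "job a"] by (auto simp: B_def)
  qed
  also have "\<dots> \<le> real m * (2 * x) * proc J q"
  proof (rule mult_right_mono)
    have "card (B \<inter> killed) \<le> card killed" using fin_killed by (intro card_mono) auto
    then show "real (card (B \<inter> killed)) \<le> real m * (2 * x)" using card_killed by linarith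
  qed (use proc_pos[OF q] in simp)
  finally have work: "real m * T \<le> real m * (2 * x) * proc J q + sum (proc J) Cs" using mT by simp
  \<comment> \<open>A job in \<open>Cs\<close> or \<open>W\<close> is finished by the algorithm only
    after \<open>e k2\<close>. So it was either released later, which puts it into \<open>R\<close>,
    or already waiting or running then, which puts it into \<open>Al\<close>. The set
    \<open>Al\<close> has at most \<kappa> waiting and \<open>m\<close> running jobs, none larger
    than \<open>q\<close>.\<close>
  define R where "R = {i. i < n \<and> e k2 < release J i \<and> release J i \<le> e k \<and> \<not> prec J q i}"
  define Al where "Al = {i \<in> Q k2. \<not> prec J q i} \<union> {i \<in> job ` act k2. \<not> prec J q i}"
  have finR: "finite R" by (simp add: R_def)
  have k2M: "k2 < M" using k2k k by simp
  have finAl: "finite Al" using fin_Q[OF k2M] fin_act by (simp add: Al_def)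
  have "card {i \<in> job ` act k2. \<not> prec J q i} \<le> card (job ` act k2)"
    using fin_act by (intro card_mono) auto
  also have "\<dots> \<le> m" using card_image_le[OF fin_act] card_act_le[OF k2M] by (metis le_trans)
  finally have "card Al \<le> \<kappa> + m"
    using card_Un_le[of "{i \<in> Q k2. \<not> prec J q i}" "{i \<in> job ` act k2. \<not> prec J q i}"] k2(1)
    by (simp add: Al_def K2_def)
  then have cardAl: "real (card Al) \<le> real \<kappa> + real m" by (metis of_nat_add of_nat_le_iff)
  have disj: "Cs \<inter> W = {}"
  proof -
    have False if a: "a \<in> B - killed" and i: "job a \<in> Q k" for a
    proof -
      obtain l where l: "l \<in> X" "a \<in> act l" using a by (auto simp: B_def)
      have "start a \<le> e k"
        using l e_mono[of l k] k by (auto simp: X_def act_def)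
      moreover have "e k < start a" using waiting_unstarted[OF k i] a by (auto simp: B_def)
      ultimately show False by simp
    qed
    then show ?thesis by (auto simp: Cs_def W_def)
  qed
  have sub: "Cs \<union> W \<subseteq> R \<union> Al"
  proof
    fix i assume i: "i \<in> Cs \<union> W"
    have "i < n \<and> release J i \<le> e k \<and> e k2 < completion S i \<and> \<not> prec J q i"
    proof (cases "i \<in> W")
      case True
      then have iQ: "i \<in> Q k" "\<not> prec J q i" by (auto simp: W_def)
      then have n: "i < n" "release J i \<le> e k" using waiting[OF k] by (auto simp: n_def)
      obtain a where a: "a \<in> S - killed" "job a = i" using completed_exists[OF n(1)] by blast
      then have "e k < fin a" using waiting_unstarted[OF k iQ(1), of a] seg(4)[of a] by auto
      moreover have "e k2 \<le> e k" using k2k k by (intro e_mono) auto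
      ultimately show ?thesis using iQ n completion_eq[OF a(1)] a(2) by auto
    next
      case False
      then obtain a l where a: "a \<in> B" "a \<notin> killed" "job a = i" "l \<in> X" "a \<in> act l"
        using i by (auto simp: Cs_def B_def)
      have aS: "a \<in> S - killed" "\<not> prec J q i" using a by (auto simp: B_def)
      have l: "k2 < l" "l \<le> k" using a(4) by (auto simp: X_def)
      have "release J i \<le> e k"
        using seg(3)[of a] aS a(3,5) l e_mono[of l k] k by (auto simp: act_def)
      moreover have "e k2 < fin a"
        using e_less[of k2 "Suc l"] l k a(5) by (auto simp: act_def)
      ultimately show ?thesis using aS a(3) completion_eq[OF aS(1)] seg(1)[of a] by auto
    qed
    then show "i \<in> R \<union> Al" using alive[OF k2M, of i] by (auto simp: R_def Al_def n_def not_less)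
  qed
  have "sum (proc J) Cs + sum (proc J) W = sum (proc J) (Cs \<union> W)"
    using disj finC finW by (simp add: sum.union_disjoint)
  also have "\<dots> \<le> sum (proc J) (R \<union> Al)"
  proof (rule sum_mono2[OF _ sub])
    show "finite (R \<union> Al)" using finR finAl by simp
    fix i assume "i \<in> R \<union> Al - (Cs \<union> W)"
    then have "i < n" using waiting[OF k2M] seg(1) act_sub by (auto simp: R_def Al_def n_def)
    then show "0 \<le> proc J i" using proc_pos[of i] by simp
  qed
  also have "\<dots> \<le> sum (proc J) R + sum (proc J) Al"
  proof -
    have "0 \<le> sum (proc J) (R \<inter> Al)"
      by (intro sum_nonneg) (auto simp: R_def intro: less_imp_le proc_pos)
    then show ?thesis using sum.union_inter[OF finR finAl, of "proc J"] by linarith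
  qed
  also have "sum (proc J) Al \<le> (real \<kappa> + real m) * proc J q"
    using finAl cardAl q by (intro sum_proc_le_card) (auto simp: Al_def)
  \<comment> \<open>Jobs of \<open>R\<close> are released at \<open>e (Suc k2)\<close> or later.
    Those that \<open>P\<close> finishes before \<open>e (Suc k)\<close> have volume at most
    \<open>m * T\<close>, which \<open>work\<close> bounds by the completed volume up to the waste
    of kills; the others are alive in \<open>P\<close>.\<close>
  also have "sum (proc J) R = sum (proc J) {i \<in> R. completion P i < e (Suc k)}
      + sum (proc J) {i \<in> R. \<not> completion P i < e (Suc k)}"
    using sum.Int_Diff[OF finR, of "proc J" "{i. completion P i < e (Suc k)}"]
    by (simp add: Int_def set_diff_eq)
  also have "sum (proc J) {i \<in> R. completion P i < e (Suc k)} \<le> real m * T"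
    unfolding T_def
  proof (rule preemptive_capacity[OF P T0])
    fix j assume "j \<in> {i \<in> R. completion P i < e (Suc k)}"
    then show "e (Suc k2) \<le> release J j \<and> completion P j \<le> e (Suc k)"
      using release_after[of j k2] k2M by (auto simp: R_def)
  qed (auto simp: R_def n_def)
  also have "sum (proc J) {i \<in> R. \<not> completion P i < e (Suc k)} \<le> real (card (opt_alive P k)) * proc J q"
  proof (rule sum_proc_le_card)
    have "card {i \<in> R. \<not> completion P i < e (Suc k)} \<le> card (opt_alive P k)"
      by (intro card_mono fin_opt_alive) (auto simp: R_def opt_alive_def)
    then show "real (card {i \<in> R. \<not> completion P i < e (Suc k)}) \<le> real (card (opt_alive P k))" by simp
  qed (use finR q in \<open>auto simp: R_def\<close>)
  finally have "sum (proc J) W \<le> real m * (2 * x) * proc J q + real (card (opt_alive P k)) * proc J q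
     + (real \<kappa> + real m) * proc J q"
    using work by linarith
  then show ?thesis by (simp add: W_def algebra_simps)
qed

text \<open>Exchange of sums: each job is counted for at most its flow time in
  \<open>P\<close>.\<close>

lemma opt_alive_time:
  assumes P: "preemptive_schedule m J P"
  shows "(\<Sum>l<M. dur l * real (card (opt_alive P l))) \<le> total_flow J P"
proof -
  have "(\<Sum>l<M. dur l * real (card (opt_alive P l)))
      = (\<Sum>l<M. \<Sum>j<n. if j \<in> opt_alive P l then dur l else 0)"
  proof (rule sum.cong[OF refl])
    fix l
    have "{..<n} \<inter> {j. j \<in> opt_alive P l} = opt_alive P l" by (auto simp: opt_alive_def)
    then show "dur l * real (card (opt_alive P l)) = (\<Sum>j<n. if j \<in> opt_alive P l then dur l else 0)"
      by (simp add: sum.If_cases)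
  qed
  also have "\<dots> = (\<Sum>j<n. \<Sum>l<M. if j \<in> opt_alive P l then dur l else 0)" by (rule sum.swap)
  also have "\<dots> = (\<Sum>j<n. sum dur {l. l < M \<and> j \<in> opt_alive P l})"
    by (rule sum.cong[OF refl]) (simp add: sum.If_cases Int_def)
  also have "\<dots> \<le> (\<Sum>j<n. completion P j - release J j)"
  proof (rule sum_mono)
    fix j assume "j \<in> {..<n}"
    then have j: "j < length J" by (simp add: n_def)
    have "proc J j > 0" using proc_pos j by (simp add: n_def)
    then have "release J j \<le> completion P j" using preemptive_flow_ge_proc[OF P j valid] by simp
    then show "sum dur {l. l < M \<and> j \<in> opt_alive P l} \<le> completion P j - release J j"
      by (intro dur_sum_le) (auto simp: opt_alive_def)
  qed
  finally show ?thesis by (simp add: total_flow_def n_def)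
qed

lemma L_le_flow:
  assumes P: "preemptive_schedule m J P"
  shows "L \<le> total_flow J P"
  unfolding L_def total_flow_def n_def
  using preemptive_flow_ge_proc[OF P _ valid] by (intro sum_mono) auto

text \<open>By \<open>waiting_volume\<close> the hypothesis of \<open>exponential_growth\<close>
  holds with this \<open>D\<close>; as the waiting volume is at most \<open>L\<close>, the number of
  jobs is logarithmic in \<open>L / \<tau>\<close>, times \<open>D\<close>. The condition
  \<open>no_tiny\<close> supplies the least size from which the growth starts.\<close>

lemma waiting_card:
  assumes P: "preemptive_schedule m J P" and k: "k < M" and \<tau>: "0 < \<tau>"
    and no_tiny: "\<And>q. q \<in> Q k \<Longrightarrow> \<kappa> < card {i \<in> Q k. \<not> prec J q i} \<Longrightarrow> \<tau> < proc J q"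
    and L\<tau>: "\<tau> \<le> L"
  shows "real (card (Q k)) \<le> real \<kappa> + 1 +
     (real (card (opt_alive P k)) + real \<kappa> + real m + real m * (2 * x)) * ln (L / \<tau>)"
proof (cases "\<kappa> < card (Q k)")
  case True
  define D where "D = real (card (opt_alive P k)) + real \<kappa> + real m + real m * (2 * x)"
  have "0 \<le> real m * (2 * x)" using x_nonneg by simp
  then have D: "1 \<le> D" unfolding D_def using two_le_m by linarith
  have Qn: "Q k \<subseteq> {..<n}" using waiting[OF k] by (auto simp: n_def)
  have "\<tau> * exp ((real (card (Q k)) - real \<kappa> - 1) / D) \<le> (\<Sum>i\<in>Q k. proc J i)"
  proof (rule exponential_growth[OF fin_Q[OF k] D \<tau> _ True])
    show "0 < proc J i" if "i \<in> Q k" for i using that Qn proc_pos by auto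
    show "\<tau> < proc J q \<and> (\<Sum>i | i \<in> Q k \<and> \<not> prec J q i. proc J i) \<le> D * proc J q"
      if "q \<in> Q k" "\<kappa> < card {i \<in> Q k. \<not> prec J q i}" for q
      using no_tiny[OF that] waiting_volume[OF P k _ that(2)] that Qn by (auto simp: D_def)
  qed
  also have "\<dots> \<le> L" using Qn by (rule sum_proc_le)
  finally have "exp ((real (card (Q k)) - real \<kappa> - 1) / D) \<le> L / \<tau>"
    using \<tau> by (simp add: field_simps)
  moreover have "0 < L / \<tau>" using \<tau> L\<tau> by simp
  ultimately have "(real (card (Q k)) - real \<kappa> - 1) / D \<le> ln (L / \<tau>)"
    by (simp add: ln_ge_iff)
  then have "real (card (Q k)) - real \<kappa> - 1 \<le> D * ln (L / \<tau>)"
    using D by (simp add: field_simps)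
  then show ?thesis by (simp add: D_def)
next
  case False
  have "0 \<le> ln (L / \<tau>)" using \<tau> L\<tau> by simp
  then have "0 \<le> (real (card (opt_alive P k)) + real \<kappa> + real m + real m * (2 * x)) * ln (L / \<tau>)"
    using x_nonneg by (intro mult_nonneg_nonneg add_nonneg_nonneg) auto
  then show ?thesis using False by linarith
qed

text \<open>The intervals in which \<open>no_tiny\<close> of \<open>waiting_card\<close> fails;
  their short duration is what makes them harmless.\<close>

definition "tiny_overflow \<tau> =
  {l. l < M \<and> (\<exists>q\<in>Q l. \<kappa> < card {i \<in> Q l. \<not> prec J q i} \<and> proc J q \<le> \<tau>)}"

text \<open>In these intervals all machines execute jobs of size at most \<tau>, and there are at
  most \<open>n + m * (2 * x)\<close> runs altogether, completed or killed.\<close>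

lemma tiny_overflow_time:
  assumes "0 \<le> \<tau>"
  shows "real m * sum dur (tiny_overflow \<tau>) \<le> (real n + real m * (2 * x)) * \<tau>"
proof -
  define B where "B = {a \<in> S. proc J (job a) \<le> \<tau>}"
  have finB: "finite B" using finS by (simp add: B_def)
  have "real (card {..<m}) * sum dur (tiny_overflow \<tau>) \<le> (\<Sum>a\<in>B. fin a - start a)"
  proof (rule busy_time)
    fix l assume "l \<in> tiny_overflow \<tau>"
    then obtain q where q: "l < M" "q \<in> Q l" "\<kappa> < card {i \<in> Q l. \<not> prec J q i}" "proc J q \<le> \<tau>"
      by (auto simp: tiny_overflow_def)
    have "act l \<inter> {a. \<not> prec J q (job a)} \<subseteq> act l \<inter> B"
      using q(4) act_sub prec_le unfolding B_def by fastforce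
    then show "{..<m} \<subseteq> machine ` (act l \<inter> B)" using overflow_busy[OF q(1,3)] by blast
  qed (auto simp: tiny_overflow_def B_def)
  also have "\<dots> \<le> real (card B) * \<tau>"
    using seg_len_le by (intro sum_bounded_above) (force simp: B_def)
  also have "\<dots> \<le> (real n + real m * (2 * x)) * \<tau>"
  proof (rule mult_right_mono[OF _ assms])
    have "card B \<le> card S" using finS by (intro card_mono) (auto simp: B_def)
    also have "\<dots> = card (S - killed) + card killed"
      using card_Diff_subset[OF fin_killed killed_sub] card_mono[OF finS killed_sub] by simp
    also have "card (S - killed) = card (job ` (S - killed))" using completed_inj by (simp add: card_image)
    also have "\<dots> \<le> card {..<n}" using seg(1) by (intro card_mono) auto
    finally have "real (card B) \<le> real n + real (card killed)" by simp
    then show "real (card B) \<le> real n + real m * (2 * x)" using card_killed by linarith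
  qed
  finally show ?thesis by simp
qed

section \<open>Time with and without small waiting jobs\<close>

definition "T1 = {l. l < M \<and>
  (\<exists>q\<in>Q l. proc J q * real (capacity m J (e l)) < volume J (e l))}"

definition "T2 = {l. l < M \<and> Q l \<noteq> {} \<and> l \<notin> T1}"

text \<open>Only the reserved machines are counted. They are busy throughout \<open>T1\<close> and
  complete at most \<open>L\<close>; a job killed there was smaller than
  \<open>volume / capacity\<close> at its start, so the reciprocal capacities sum the waste of each
  machine to a logarithm.\<close>

lemma T1_time: "real m * sum dur T1 \<le> (3 + 2 * ln (2 * x + 1)) * L"
proof -
  define H where "H = {h. h < m \<and> \<not> 2 * h < m}"
  have H: "finite H" "card H = m div 2"
  proof -
    have "H = {(m + 1) div 2..<m}" by (auto simp: H_def)
    then show "finite H" "card H = m div 2" by auto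
  qed
  \<comment> \<open>\<open>m div 2\<close> machines are reserved; the factor 3 is the worst case
    \<open>m = 3\<close>, and \<open>m \<ge> 2\<close> makes the number positive.\<close>
  have "m \<le> 3 * card H" "0 < card H" using two_le_m H(2) by linarith+
  then have H3: "real m \<le> 3 * real (card H)" "0 < card H" by (metis of_nat_le_iff of_nat_mult of_nat_numeral, simp)
  define B where "B = {a \<in> S. machine a \<in> H}"
  have finB: "finite B" using finS by (simp add: B_def)
  have l0: "0 \<le> ln (2 * x + 1)" using x_nonneg by simp
  have "real (card H) * sum dur T1 \<le> (\<Sum>a\<in>B. fin a - start a)"
  proof (rule busy_time)
    fix l assume "l \<in> T1"
    then have "H \<subseteq> machine ` act l" using busy_small by (auto simp: T1_def H_def)
    then show "H \<subseteq> machine ` (act l \<inter> B)" using act_sub[of l] by (force simp: B_def)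
  qed (auto simp: T1_def B_def H)
  also have "\<dots> = (\<Sum>a\<in>B \<inter> killed. fin a - start a) + (\<Sum>a\<in>B - killed. fin a - start a)"
    by (rule sum.Int_Diff[OF finB])
  also have "(\<Sum>a\<in>B - killed. fin a - start a) = (\<Sum>a\<in>B - killed. proc J (job a))"
    by (intro sum.cong refl completed_len) (auto simp: B_def)
  also have "\<dots> \<le> L" unfolding L_def
    by (rule sum_completed_le) (auto simp: B_def intro: less_imp_le proc_pos)
  also have "(\<Sum>a\<in>B \<inter> killed. fin a - start a) \<le> (\<Sum>a\<in>B \<inter> killed. L / real (capacity m J (start a)))"
  proof (rule sum_mono)
    fix a assume a: "a \<in> B \<inter> killed"
    then have aS: "a \<in> S" "\<not> 2 * machine a < m" by (auto simp: B_def H_def)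
    have "proc J (job a) * real (capacity m J (start a)) \<le> L"
      using small_started[OF aS] volume_le[of "start a"] by linarith
    then have "proc J (job a) \<le> L / real (capacity m J (start a))"
      using capacity_pos[of "start a"] by (simp add: field_simps)
    then show "fin a - start a \<le> L / real (capacity m J (start a))" using seg_len_le[OF aS(1)] by linarith
  qed
  also have "\<dots> = (\<Sum>h\<in>H. \<Sum>a\<in>{a\<in>B \<inter> killed. machine a = h}. L / real (capacity m J (start a)))"
    using H finB by (intro sum.group[symmetric]) (auto simp: B_def)
  also have "\<dots> \<le> (\<Sum>h\<in>H. L * (2 / real m * ln (2 * x + 1)))"
  proof (rule sum_mono)
    fix h
    have "(\<Sum>a\<in>{a\<in>B \<inter> killed. machine a = h}. 1 / real (capacity m J (start a))) \<le> 2 / real m * ln (2 * x + 1)"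
      by (rule kill_chain_card) (use seg_disjoint killed_sub in auto)
    then have "L * (\<Sum>a\<in>{a\<in>B \<inter> killed. machine a = h}. 1 / real (capacity m J (start a)))
       \<le> L * (2 / real m * ln (2 * x + 1))" using L_nonneg by (rule mult_left_mono)
    then show "(\<Sum>a\<in>{a\<in>B \<inter> killed. machine a = h}. L / real (capacity m J (start a)))
       \<le> L * (2 / real m * ln (2 * x + 1))" by (simp add: sum_distrib_left)
  qed
  finally have "real (card H) * sum dur T1 \<le> real (card H) * (L * (2 / real m * ln (2 * x + 1))) + L"
    by simp
  \<comment> \<open>The volume \<open>L\<close> is spread over the reserved machines so that
    \<open>card H\<close> cancels.\<close>
  also have "\<dots> \<le> real (card H) * (L * (2 / real m * ln (2 * x + 1))) + real (card H) * (3 * L / real m)"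
  proof -
    have "1 * L \<le> real (card H) * 3 / real m * L"
      using H3(1) m_pos by (intro mult_right_mono[OF _ L_nonneg]) (simp add: field_simps)
    then show ?thesis by simp
  qed
  also have "\<dots> = real (card H) * ((3 + 2 * ln (2 * x + 1)) * L / real m)"
    using m_pos by (simp add: field_simps)
  finally have "sum dur T1 \<le> (3 + 2 * ln (2 * x + 1)) * L / real m"
    by (rule mult_left_le_imp_le) (use H3 in simp)
  then show ?thesis using m_pos by (simp add: field_simps)
qed

lemma dur_card_swap:
  assumes "X \<subseteq> {..<M}" "\<And>l. l \<in> X \<Longrightarrow> A l \<subseteq> I" "finite I"
  shows "(\<Sum>l\<in>X. dur l * real (card (A l))) = (\<Sum>j\<in>I. sum dur {l \<in> X. j \<in> A l})"
proof -
  have fX: "finite X" using assms(1) finite_subset by blast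
  have "(\<Sum>l\<in>X. dur l * real (card (A l))) = (\<Sum>l\<in>X. \<Sum>j\<in>I. if j \<in> A l then dur l else 0)"
  proof (rule sum.cong[OF refl])
    fix l assume "l \<in> X"
    then have "I \<inter> {j. j \<in> A l} = A l" using assms(2) by auto
    then show "dur l * real (card (A l)) = (\<Sum>j\<in>I. if j \<in> A l then dur l else 0)"
      using assms(3) by (simp add: sum.If_cases)
  qed
  also have "\<dots> = (\<Sum>j\<in>I. \<Sum>l\<in>X. if j \<in> A l then dur l else 0)" by (rule sum.swap)
  also have "\<dots> = (\<Sum>j\<in>I. sum dur {l \<in> X. j \<in> A l})"
    by (rule sum.cong[OF refl]) (use fX in \<open>simp add: sum.If_cases Int_def\<close>)
  finally show ?thesis .
qed

lemma Q_sub: "l < M \<Longrightarrow> Q l \<subseteq> {..<n}"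
  using waiting by (auto simp: n_def)

lemma T2_card: "l \<in> T2 \<Longrightarrow> card (Q l) \<le> \<kappa>"
proof -
  assume l: "l \<in> T2"
  then have "card (Q l) \<le> capacity m J (e l)"
    by (intro big_few Q_arrived) (auto simp: T2_def T1_def not_less)
  then show ?thesis using capacity_le le_trans by blast
qed

text \<open>While only big jobs wait, the machines open to every job are busy, so it suffices to bound the
  number of waiting jobs integrated over the runs on these machines. For a killed run, waiting jobs
  larger than the running one are paid by the small number of kills; smaller ones arrived during
  the run, and each of them meets at most one such run per machine.\<close>

lemma T2_wait: "(\<Sum>l\<in>T2. dur l * real (card (Q l))) \<le> 2 / real m * (2 * real \<kappa> * L) + 2 * x * L"
proof -
  define H where "H = {h. 2 * h < m}"
  have "H = {..<(m + 1) div 2}" by (auto simp: H_def)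
  then have H: "finite H" "card H = (m + 1) div 2" by auto
  have "m \<le> 2 * card H" using H(2) by linarith
  then have H2: "real m \<le> 2 * real (card H)" by (metis of_nat_le_iff of_nat_mult of_nat_numeral)
  then have H0: "0 < real (card H)" using m_pos by simp
  define B where "B = {a \<in> S. machine a \<in> H}"
  have B: "B \<subseteq> S" "finite B" using finS by (auto simp: B_def)
  have T2: "T2 \<subseteq> {..<M}" by (auto simp: T2_def)
  define K where "K = B \<inter> killed"
  have K: "finite K" "K \<subseteq> S" "K \<subseteq> killed" using B by (auto simp: K_def)
  define X where "X a = {l. l \<in> T2 \<and> a \<in> act l}" for a
  have X: "X a \<subseteq> {..<M}" "finite (X a)" for a
    using T2 finite_subset[of "X a" "{..<M}"] by (auto simp: X_def)
  have dX: "sum dur Y \<le> fin a - start a" if "Y \<subseteq> X a" "a \<in> S" for a Y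
    using that X[of a] by (intro dur_act_le) (auto simp: X_def)
  have nonneg: "0 \<le> dur l" if "l \<in> X a" for l a using that X dur_nonneg by blast
  \<comment> \<open>During a completed run at most \<kappa> jobs wait, for the processing time of
    the job that runs.\<close>
  have completed: "(\<Sum>a\<in>B - killed. \<Sum>l\<in>X a. dur l * real (card (Q l))) \<le> real \<kappa> * L"
  proof -
    have "(\<Sum>a\<in>B - killed. \<Sum>l\<in>X a. dur l * real (card (Q l))) \<le> (\<Sum>a\<in>B - killed. real \<kappa> * proc J (job a))"
    proof (rule sum_mono)
      fix a assume a: "a \<in> B - killed"
      have "(\<Sum>l\<in>X a. dur l * real (card (Q l))) \<le> (\<Sum>l\<in>X a. dur l * real \<kappa>)"
        using T2_card nonneg by (intro sum_mono mult_left_mono) (auto simp: X_def)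
      also have "\<dots> = real \<kappa> * sum dur (X a)" by (simp add: mult.commute flip: sum_distrib_right)
      also have "\<dots> \<le> real \<kappa> * proc J (job a)"
        using dX[of "X a" a] a B(1) completed_len[of a] by (intro mult_left_mono) auto
      finally show "(\<Sum>l\<in>X a. dur l * real (card (Q l))) \<le> real \<kappa> * proc J (job a)" .
    qed
    also have "\<dots> \<le> (\<Sum>j<n. real \<kappa> * proc J j)"
      using B(1) by (intro sum_completed_le[where f = "\<lambda>j. real \<kappa> * proc J j"])
        (auto intro!: mult_nonneg_nonneg intro: less_imp_le proc_pos)
    finally show ?thesis by (simp add: L_def sum_distrib_left)
  qed
  \<comment> \<open>A job \<open>j\<close> not smaller than the running one waits during the run for
    at most \<open>proc J j\<close>. So one killed run costs at most \<open>L\<close>, and each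
    machine of \<open>H\<close> has at most \<open>2 * x\<close> of them.\<close>
  have larger: "(\<Sum>a\<in>K. \<Sum>l\<in>X a. dur l * real (card {j \<in> Q l. \<not> prec J j (job a)}))
      \<le> real (card H) * (2 * x) * L"
  proof -
    have "(\<Sum>l\<in>X a. dur l * real (card {j \<in> Q l. \<not> prec J j (job a)})) \<le> L" if a: "a \<in> K" for a
    proof -
      have "(\<Sum>l\<in>X a. dur l * real (card {j \<in> Q l. \<not> prec J j (job a)}))
          = (\<Sum>j<n. sum dur {l \<in> X a. j \<in> {j \<in> Q l. \<not> prec J j (job a)}})"
        using X[of a] Q_sub by (intro dur_card_swap) auto
      also have "\<dots> \<le> L" unfolding L_def
      proof (rule sum_mono)
        fix j assume "j \<in> {..<n}"
        then have j: "0 < proc J j" by (simp add: proc_pos)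
        show "sum dur {l \<in> X a. j \<in> {j \<in> Q l. \<not> prec J j (job a)}} \<le> proc J j"
        proof (cases "prec J j (job a)")
          case True
          then show ?thesis using j by simp
        next
          case False
          then have "proc J (job a) \<le> proc J j" by (rule prec_le)
          moreover have "sum dur {l \<in> X a. j \<in> {j \<in> Q l. \<not> prec J j (job a)}} \<le> fin a - start a"
            using a K by (intro dX) auto
          ultimately show ?thesis using seg_len_le[of a] a K by auto
        qed
      qed
      finally show ?thesis .
    qed
    then have "(\<Sum>a\<in>K. \<Sum>l\<in>X a. dur l * real (card {j \<in> Q l. \<not> prec J j (job a)})) \<le> real (card K) * L"
      by (rule sum_bounded_above)
    also have "\<dots> \<le> real (card H) * (2 * x) * L"
    proof (rule mult_right_mono[OF _ L_nonneg])
      have "K = {a \<in> killed. machine a \<in> H}" using killed_sub by (auto simp: K_def B_def)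
      then show "real (card K) \<le> real (card H) * (2 * x)" using killed_on_machines[OF H(1)] by simp
    qed
    finally show ?thesis .
  qed
  have smaller: "(\<Sum>a\<in>K. \<Sum>l\<in>X a. dur l * real (card {j \<in> Q l. prec J j (job a)})) \<le> real \<kappa> * L"
  proof -
    define Y where "Y j a = {l \<in> X a. j \<in> Q l \<and> prec J j (job a)}" for j a
    have "(\<Sum>l\<in>X a. dur l * real (card {j \<in> Q l. prec J j (job a)})) = (\<Sum>j<n. sum dur (Y j a))" for a
    proof -
      have "(\<Sum>l\<in>X a. dur l * real (card {j \<in> Q l. prec J j (job a)}))
          = (\<Sum>j<n. sum dur {l \<in> X a. j \<in> {j \<in> Q l. prec J j (job a)}})"
        using X[of a] Q_sub by (intro dur_card_swap) auto
      then show ?thesis by (simp add: Y_def)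
    qed
    then have "(\<Sum>a\<in>K. \<Sum>l\<in>X a. dur l * real (card {j \<in> Q l. prec J j (job a)}))
        = (\<Sum>a\<in>K. \<Sum>j<n. sum dur (Y j a))" by simp
    also have "\<dots> = (\<Sum>j<n. \<Sum>a\<in>K. sum dur (Y j a))" by (rule sum.swap)
    also have "\<dots> \<le> (\<Sum>j<n. real \<kappa> * proc J j)"
    proof (rule sum_mono)
      fix j assume "j \<in> {..<n}"
      then have j: "0 < proc J j" by (simp add: proc_pos)
      \<comment> \<open>The killed runs during which the smaller job \<open>j\<close> waits. By
        \<open>smaller_later\<close>, each of them contains the release of \<open>j\<close>.\<close>
      define Kj where "Kj = {a \<in> K. Y j a \<noteq> {}}"
      have Kj: "finite Kj" "Kj \<subseteq> K" using K(1) by (auto simp: Kj_def)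
      have inside: "start a < release J j \<and> release J j < fin a \<and> (\<exists>l\<in>T2. j \<in> Q l)" if "a \<in> Kj" for a
      proof -
        obtain l where l: "l \<in> T2" "a \<in> act l" "j \<in> Q l" "prec J j (job a)"
          using \<open>a \<in> Kj\<close> by (auto simp: Kj_def Y_def X_def)
        then have lM: "l < M" using T2 by auto
        have "start a < release J j" "release J j \<le> e l" "e l < e (Suc l)" "e (Suc l) \<le> fin a"
          using smaller_later[OF lM l(2,3,4)] waiting[OF lM l(3)] e_Suc[OF lM] l(2) by (auto simp: act_def)
        then show ?thesis using l by auto
      qed
      have "(\<Sum>a\<in>K. sum dur (Y j a)) = (\<Sum>a\<in>Kj. sum dur (Y j a))"
        using K(1) Kj by (intro sum.mono_neutral_right) (auto simp: Kj_def)
      also have "\<dots> \<le> (\<Sum>a\<in>Kj. proc J (job a))"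
      proof (rule sum_mono)
        fix a assume "a \<in> Kj"
        then have "a \<in> S" using Kj K by auto
        then show "sum dur (Y j a) \<le> proc J (job a)"
          using dX[of "Y j a" a] seg_len_le[of a] by (auto simp: Y_def)
      qed
      also have "\<dots> \<le> real \<kappa> * proc J j"
      proof (cases "Kj = {}")
        case False
        \<comment> \<open>Two runs of one job are disjoint in time, whereas all runs in
          \<open>Kj\<close> contain \<open>release J j\<close>. So they belong to distinct jobs, all
          of them known at \<open>e l\<close>.\<close>
        have inj: "inj_on job Kj"
        proof (rule inj_onI)
          fix a b assume ab: "a \<in> Kj" "b \<in> Kj" "job a = job b"
          show "a = b"
            using seg_disjoint[of a b] inside[OF ab(1)] inside[OF ab(2)] ab Kj K by fastforce
        qed
        obtain l where l: "l \<in> T2" "j \<in> Q l" using False inside by blast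
        then have lM: "l < M" using T2 by auto
        have "(\<Sum>a\<in>Kj. proc J (job a)) = sum (proc J) (job ` Kj)" using inj by (simp add: sum.reindex)
        also have "\<dots> \<le> sum (proc J) (arrived J (e l))"
        proof (rule sum_mono2)
          show "job ` Kj \<subseteq> arrived J (e l)"
          proof
            fix i assume "i \<in> job ` Kj"
            then obtain a where a: "a \<in> Kj" "i = job a" by blast
            then have "a \<in> S" using Kj K by auto
            then show "i \<in> arrived J (e l)"
              using seg(1,3)[of a] a inside[OF a(1)] waiting[OF lM l(2)] by (auto simp: arrived_def n_def)
          qed
          show "0 \<le> proc J i" if "i \<in> arrived J (e l) - job ` Kj" for i
            using that proc_pos[of i] by (auto simp: arrived_def n_def)
        qed simp
        \<comment> \<open>In \<open>T2\<close> every waiting job is big, and \<open>j\<close> is one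
          of them.\<close>
        also have "\<dots> \<le> proc J j * real (capacity m J (e l))"
          using l by (auto simp: T2_def T1_def volume_def not_less)
        also have "\<dots> \<le> proc J j * real \<kappa>" using j capacity_le by (intro mult_left_mono) auto
        finally show ?thesis by (simp add: mult.commute)
      qed (use j in simp)
      finally show "(\<Sum>a\<in>K. sum dur (Y j a)) \<le> real \<kappa> * proc J j" .
    qed
    finally show ?thesis by (simp add: L_def sum_distrib_left)
  qed
  have split: "real (card (Q l)) = real (card {j \<in> Q l. \<not> prec J j (job a)}) + real (card {j \<in> Q l. prec J j (job a)})"
    if "l \<in> X a" for a l
  proof -
    have "finite (Q l)" using that X fin_Q by blast
    then have "card {j \<in> Q l. \<not> prec J j (job a)} + card {j \<in> Q l. prec J j (job a)}
      = card ({j \<in> Q l. \<not> prec J j (job a)} \<union> {j \<in> Q l. prec J j (job a)})"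
      by (intro card_Un_disjoint[symmetric]) auto
    also have "{j \<in> Q l. \<not> prec J j (job a)} \<union> {j \<in> Q l. prec J j (job a)} = Q l" by auto
    finally show ?thesis by linarith
  qed
  have "(\<Sum>a\<in>K. \<Sum>l\<in>X a. dur l * real (card (Q l)))
     = (\<Sum>a\<in>K. \<Sum>l\<in>X a. dur l * real (card {j \<in> Q l. \<not> prec J j (job a)})
          + dur l * real (card {j \<in> Q l. prec J j (job a)}))"
    by (intro sum.cong refl) (simp add: split distrib_left)
  also have "\<dots> \<le> real (card H) * (2 * x) * L + real \<kappa> * L"
    using larger smaller by (simp add: sum.distrib)
  finally have kills: "(\<Sum>a\<in>K. \<Sum>l\<in>X a. dur l * real (card (Q l))) \<le> real (card H) * (2 * x) * L + real \<kappa> * L" .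
  have "real (card H) * (\<Sum>l\<in>T2. dur l * real (card (Q l)))
      \<le> (\<Sum>a\<in>B. \<Sum>l | l \<in> T2 \<and> a \<in> act l. dur l * real (card (Q l)))"
  proof (rule busy_sum[OF T2 B(1) _ _ H(1)])
    fix l assume "l \<in> T2"
    then have "H \<subseteq> machine ` act l" using busy by (auto simp: T2_def H_def)
    then show "H \<subseteq> machine ` (act l \<inter> B)" using act_sub[of l] by (force simp: B_def)
  qed simp
  also have "\<dots> = (\<Sum>a\<in>K. \<Sum>l\<in>X a. dur l * real (card (Q l))) + (\<Sum>a\<in>B - killed. \<Sum>l\<in>X a. dur l * real (card (Q l)))"
    unfolding K_def X_def by (rule sum.Int_Diff[OF B(2)])
  also have "\<dots> \<le> real (card H) * (2 * x) * L + 2 * real \<kappa> * L" using kills completed by simp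
  also have "\<dots> \<le> real (card H) * (2 * x) * L + (2 / real m * real (card H)) * (2 * real \<kappa> * L)"
  proof -
    have "1 \<le> 2 / real m * real (card H)" using H2 m_pos by (simp add: field_simps)
    then show ?thesis
      using mult_right_mono[of 1 "2 / real m * real (card H)" "2 * real \<kappa> * L"] L_nonneg by simp
  qed
  also have "\<dots> = real (card H) * (2 / real m * (2 * real \<kappa> * L) + 2 * x * L)"
    by (simp add: algebra_simps)
  finally show ?thesis using H0 by (simp only: mult_le_cancel_left_pos)
qed

text \<open>Flow time is the integral of the number of unfinished jobs. Each of them is waiting or
  running, and the running ones integrate to at most the total run time.\<close>

lemma flow_le_waiting:
  "total_flow J S \<le> (1 + 2 * x) * L + (\<Sum>l\<in>T1. dur l * real (card (Q l))) + (\<Sum>l\<in>T2. dur l * real (card (Q l)))"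
proof -
  have "total_flow J S \<le> (\<Sum>j<n. sum dur {l \<in> {..<M}. j \<in> Q l \<union> job ` act l})"
    unfolding total_flow_def n_def
  proof (rule sum_mono)
    fix j assume "j \<in> {..<length J}"
    then have j: "j < length J" by simp
    obtain a where a: "a \<le> M" "release J j = e a" using release_event[OF j] by blast
    obtain b where b: "b \<le> M" "completion S j = e b" using completion_event[OF j] by blast
    obtain s where s: "s \<in> S - killed" "job s = j" using completed_exists j by (auto simp: n_def)
    have "e a \<le> e b" using seg(3,4)[of s] completion_eq[OF s(1)] s a b by auto
    then have ab: "a \<le> b" using e_less_iff[of b a] a b by auto
    have "completion S j - release J j = sum dur {a..<b}" using dur_telescope[OF ab] a b by simp
    also have "\<dots> \<le> sum dur {l \<in> {..<M}. j \<in> Q l \<union> job ` act l}"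
    proof (intro sum_mono2)
      show "{a..<b} \<subseteq> {l \<in> {..<M}. j \<in> Q l \<union> job ` act l}"
      proof
        fix l assume l: "l \<in> {a..<b}"
        then have "l < M" "e a \<le> e l" "e l < e b" using e_mono[of a l] e_less[of l b] b by auto
        then show "l \<in> {l \<in> {..<M}. j \<in> Q l \<union> job ` act l}" using alive[of l j] j a b by auto
      qed
    qed (auto intro: dur_nonneg)
    finally show "completion S j - release J j \<le> sum dur {l \<in> {..<M}. j \<in> Q l \<union> job ` act l}" .
  qed
  also have "\<dots> = (\<Sum>l<M. dur l * real (card (Q l \<union> job ` act l)))"
    using Q_sub seg(1) act_sub by (intro dur_card_swap[symmetric]) blast+
  also have "\<dots> \<le> (\<Sum>l<M. dur l * real (card (Q l)) + dur l * real (card (act l)))"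
  proof (rule sum_mono)
    fix l assume l: "l \<in> {..<M}"
    have "card (Q l \<union> job ` act l) \<le> card (Q l) + card (job ` act l)" by (rule card_Un_le)
    also have "card (job ` act l) \<le> card (act l)" by (rule card_image_le[OF fin_act])
    finally have "real (card (Q l \<union> job ` act l)) \<le> real (card (Q l)) + real (card (act l))" by linarith
    then show "dur l * real (card (Q l \<union> job ` act l)) \<le> dur l * real (card (Q l)) + dur l * real (card (act l))"
      using dur_nonneg[of l] l by (simp flip: distrib_left add: mult_left_mono)
  qed
  also have "\<dots> = (\<Sum>l<M. dur l * real (card (Q l))) + (\<Sum>l<M. dur l * real (card (act l)))"
    by (rule sum.distrib)
  also have "(\<Sum>l<M. dur l * real (card (act l))) \<le> (1 + 2 * x) * L"
  proof -
    have "(\<Sum>l<M. dur l * real (card (act l))) = (\<Sum>l<M. \<Sum>a\<in>S. if a \<in> act l then dur l else 0)"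
    proof (rule sum.cong[OF refl])
      fix l
      have "S \<inter> {a. a \<in> act l} = act l" using act_sub by auto
      then show "dur l * real (card (act l)) = (\<Sum>a\<in>S. if a \<in> act l then dur l else 0)"
        using finS by (simp add: sum.If_cases)
    qed
    also have "\<dots> = (\<Sum>a\<in>S. \<Sum>l<M. if a \<in> act l then dur l else 0)" by (rule sum.swap)
    also have "\<dots> = (\<Sum>a\<in>S. sum dur {l \<in> {..<M}. a \<in> act l})"
      by (rule sum.cong[OF refl]) (simp add: sum.If_cases Int_def)
    also have "\<dots> \<le> (\<Sum>a\<in>S. fin a - start a)"
      by (intro sum_mono dur_act_le) auto
    finally show ?thesis using total_run_time by linarith
  qed
  also have "(\<Sum>l<M. dur l * real (card (Q l)))
      = (\<Sum>l\<in>T1. dur l * real (card (Q l))) + (\<Sum>l\<in>T2. dur l * real (card (Q l)))"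
  proof -
    have "(\<Sum>l<M. dur l * real (card (Q l))) = (\<Sum>l\<in>T1 \<union> T2. dur l * real (card (Q l)))"
      by (rule sum.mono_neutral_right) (auto simp: T1_def T2_def)
    also have "\<dots> = (\<Sum>l\<in>T1. dur l * real (card (Q l))) + (\<Sum>l\<in>T2. dur l * real (card (Q l)))"
      by (rule sum.union_disjoint) (auto simp: T1_def T2_def)
    finally show ?thesis .
  qed
  finally show ?thesis by linarith
qed

section \<open>The flow bound with explicit constants\<close>

lemma \<kappa>_upper: "real \<kappa> \<le> sqrt ((real n + real m) * real m) + 1"
  using cap_sq_upper[of m n] by (simp add: \<kappa>_def)

text \<open>Here \<open>x\<close> is at most 1 and at most \<open>m\<close> jobs wait, so everything
  is a multiple of \<open>L\<close>: 3 for the runs, 7 for \<open>T1\<close> and 14 for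
  \<open>T2\<close>.\<close>

lemma flow_few_jobs:
  assumes "n \<le> m"
  shows "total_flow J S \<le> 24 * L"
proof -
  have x1: "x \<le> 1" using assms m_pos by (simp add: x_def)
  have T1: "(\<Sum>l\<in>T1. dur l * real (card (Q l))) \<le> 7 * L"
  proof -
    have "(\<Sum>l\<in>T1. dur l * real (card (Q l))) \<le> (\<Sum>l\<in>T1. dur l * real m)"
    proof (intro sum_mono mult_left_mono)
      fix l assume "l \<in> T1"
      then have l: "l < M" by (auto simp: T1_def)
      have "card (Q l) \<le> card {..<n}" using Q_sub[OF l] by (intro card_mono) auto
      then show "real (card (Q l)) \<le> real m" using assms by simp
      show "0 \<le> dur l" using dur_nonneg[OF l] .
    qed
    also have "\<dots> = real m * sum dur T1"
      using sum_distrib_right[of dur T1 "real m"] by (simp add: mult.commute)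
    also have "\<dots> \<le> (3 + 2 * ln (2 * x + 1)) * L" by (rule T1_time)
    also have "\<dots> \<le> 7 * L"
    proof (rule mult_right_mono[OF _ L_nonneg])
      have "ln (2 * x + 1) \<le> 2 * x" using x_nonneg ln_le_minus_one[of "2 * x + 1"] by simp
      then show "3 + 2 * ln (2 * x + 1) \<le> 7" using x1 by simp
    qed
    finally show ?thesis .
  qed
  have "sqrt ((real n + real m) * real m) \<le> sqrt ((2 * real m)\<^sup>2)"
  proof (rule real_sqrt_le_mono)
    have "(real n + real m) * real m \<le> (4 * real m) * real m"
      using assms by (intro mult_right_mono) auto
    then show "(real n + real m) * real m \<le> (2 * real m)\<^sup>2" by (simp add: power2_eq_square)
  qed
  also have "\<dots> = 2 * real m" by (subst real_sqrt_abs) simp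
  finally have "real \<kappa> \<le> 3 * real m" using \<kappa>_upper m_pos by linarith
  then have "2 / real m * (2 * real \<kappa> * L) \<le> 2 / real m * (2 * (3 * real m) * L)"
    using L_nonneg by (intro mult_left_mono mult_right_mono) auto
  also have "\<dots> = 12 * L" using m_pos by simp
  finally have "2 / real m * (2 * real \<kappa> * L) \<le> 12 * L" .
  moreover have "x * L \<le> L" using x1 L_nonneg mult_right_mono by fastforce
  ultimately show ?thesis using T1 T2_wait flow_le_waiting by (simp add: algebra_simps)
qed

lemma flow_many_jobs:
  assumes P: "preemptive_schedule m J P" and mn: "m < n"
  shows "total_flow J S \<le> 100 * x * (1 + ln (real n))\<^sup>2 * total_flow J P"
proof -
  define l where "l = ln (real n)"
  define F where "F = total_flow J P"
  define y where "y = real m * x"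
  have n2: "2 \<le> real n" using mn two_le_m by simp
  have l0: "0 \<le> l" using n2 by (simp add: l_def)
  have LF: "L \<le> F" unfolding F_def by (rule L_le_flow[OF P])
  have L0: "0 < L" unfolding L_def using n2 proc_pos by (intro sum_pos) (auto simp: lessThan_empty_iff)
  have x1: "1 \<le> x" using mn m_pos by (simp add: x_def)
  have xsq: "x * x = real n / real m" by (simp add: x_def)
  have yy: "y * y = real n * real m" using xsq m_pos by (simp add: y_def field_simps)
  have xn: "x \<le> real n"
  proof -
    have "x * 1 \<le> x * x" using x1 by (intro mult_left_mono) auto
    also have "\<dots> \<le> real n / 1" unfolding xsq using two_le_m by (intro divide_left_mono) auto
    finally show ?thesis by simp
  qed
  have my: "real m \<le> y" using x1 m_pos by (simp add: y_def)
  have y2: "2 \<le> y" using my two_le_m by linarith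
  have yn: "y \<le> real n"
  proof (rule ccontr)
    assume "\<not> y \<le> real n"
    then have "real n * real n < y * y" using n2 by (intro mult_strict_mono) auto
    moreover have "real n * real m \<le> real n * real n" using mn by (intro mult_left_mono) auto
    ultimately show False using yy by simp
  qed
  \<comment> \<open>As \<open>n + m\<close> is below \<open>2 * n\<close>, the root is at most
    \<open>sqrt 2 * y\<close>, hence at most \<open>3 / 2 * y\<close>; rounding up costs 1, which is
    at most \<open>y / 2\<close>.\<close>
  have \<kappa>2: "real \<kappa> \<le> 2 * y"
  proof -
    have "(real n + real m) * real m \<le> 2 * (real n * real m)"
      using mn m_pos by (simp add: algebra_simps)
    also have "\<dots> \<le> (3 / 2 * y)\<^sup>2" using yy by (simp add: power2_eq_square)
    finally have "sqrt ((real n + real m) * real m) \<le> 3 / 2 * y"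
      using y2 by (intro real_le_lsqrt) auto
    then show ?thesis using \<kappa>_upper y2 by linarith
  qed
  define \<theta> where "\<theta> = 3 + 2 * ln (2 * x + 1)"
  have \<theta>: "\<theta> \<le> 7 + 2 * l" "0 \<le> \<theta>"
  proof -
    have "ln (2 * x + 1) \<le> ln (3 * real n)" using x1 xn by (intro ln_mono) auto
    also have "\<dots> = ln 3 + l" using n2 by (simp add: ln_mult l_def)
    also have "ln 3 \<le> (2::real)" using ln_le_minus_one[of "3::real"] by simp
    finally show "\<theta> \<le> 7 + 2 * l" by (simp add: \<theta>_def)
    show "0 \<le> \<theta>" using x1 by (simp add: \<theta>_def)
  qed
  have T1_len: "sum dur T1 \<le> \<theta> * L / real m"
    using T1_time m_pos by (simp add: \<theta>_def field_simps)
  \<comment> \<open>The square makes the tiny intervals negligible even with all \<open>n\<close>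
    jobs waiting, since their total length is at most \<open>3 * n * \<tau> / m\<close>. It costs
    only the factor 2 in the logarithm.\<close>
  define \<tau> where "\<tau> = L / (real n)\<^sup>2"
  have \<tau>: "0 < \<tau>" "\<tau> \<le> L" "ln (L / \<tau>) = 2 * l"
  proof -
    show "0 < \<tau>" using L0 n2 by (simp add: \<tau>_def)
    have "1 \<le> (real n)\<^sup>2" using n2 by simp
    then have "L / (real n)\<^sup>2 \<le> L / 1" using L0 n2 by (intro divide_left_mono) auto
    then show "\<tau> \<le> L" by (simp add: \<tau>_def)
    have "L / \<tau> = (real n)\<^sup>2" using L0 n2 by (simp add: \<tau>_def)
    then show "ln (L / \<tau>) = 2 * l" using n2 by (simp add: l_def ln_realpow)
  qed
  define Y where "Y = tiny_overflow \<tau>"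
  have Y: "Y \<subseteq> {..<M}" by (auto simp: Y_def tiny_overflow_def)
  have finT: "finite T1" "finite Y" using finite_subset[OF Y] by (auto simp: T1_def)
  have tiny: "(\<Sum>k\<in>T1 \<inter> Y. dur k * real (card (Q k))) \<le> 2 * L"
  proof -
    have "(\<Sum>k\<in>T1 \<inter> Y. dur k * real (card (Q k))) \<le> (\<Sum>k\<in>T1 \<inter> Y. dur k * real n)"
    proof (intro sum_mono mult_left_mono)
      fix k assume "k \<in> T1 \<inter> Y"
      then have k: "k < M" using Y by auto
      have "card (Q k) \<le> card {..<n}" using Q_sub[OF k] by (intro card_mono) auto
      then show "real (card (Q k)) \<le> real n" by simp
      show "0 \<le> dur k" using dur_nonneg[OF k] .
    qed
    also have "\<dots> \<le> (\<Sum>k\<in>Y. dur k * real n)"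
      using Y finT dur_nonneg by (intro sum_mono2) auto
    also have "\<dots> = real n * sum dur Y" by (simp add: mult.commute flip: sum_distrib_right)
    also have "\<dots> \<le> real n * ((real n + 2 * y) * \<tau> / real m)"
      using tiny_overflow_time[of \<tau>] \<tau>(1) m_pos
      by (intro mult_left_mono) (auto simp: Y_def y_def field_simps)
    also have "\<dots> \<le> real n * (3 * real n * \<tau> / real m)"
      using yn \<tau>(1) m_pos by (intro mult_left_mono divide_right_mono mult_right_mono) auto
    also have "\<dots> = 3 * L / real m" using n2 by (simp add: \<tau>_def power2_eq_square)
    also have "\<dots> \<le> 2 * L" using L0 two_le_m m_pos by (simp add: field_simps)
    finally show ?thesis .
  qed
  \<comment> \<open>The bound of \<open>waiting_card\<close> is split: \<open>c\<close> is
    multiplied with the length of \<open>T1\<close>, while the part proportional to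
    \<open>opt_alive\<close> integrates to the flow time of \<open>P\<close>.\<close>
  have rest: "(\<Sum>k\<in>T1 - Y. dur k * real (card (Q k))) \<le> x * (3 + 10 * l) * \<theta> * L + 2 * l * F"
  proof -
    define c where "c = y * (3 + 10 * l)"
    have "(\<Sum>k\<in>T1 - Y. dur k * real (card (Q k)))
        \<le> (\<Sum>k\<in>T1 - Y. dur k * c + 2 * l * (dur k * real (card (opt_alive P k))))"
    proof (rule sum_mono)
      fix k assume k: "k \<in> T1 - Y"
      then have kM: "k < M" by (auto simp: T1_def)
      have "real (card (Q k)) \<le> real \<kappa> + 1 +
         (real (card (opt_alive P k)) + real \<kappa> + real m + real m * (2 * x)) * ln (L / \<tau>)"
        using k kM by (intro waiting_card[OF P kM \<tau>(1) _ \<tau>(2)]) (force simp: Y_def tiny_overflow_def)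
      also have "\<dots> \<le> 3 * y + (real (card (opt_alive P k)) + 5 * y) * (2 * l)"
      proof -
        have "real (card (opt_alive P k)) + real \<kappa> + real m + real m * (2 * x) \<le> real (card (opt_alive P k)) + 5 * y"
          using \<kappa>2 my by (simp add: y_def)
        then have "(real (card (opt_alive P k)) + real \<kappa> + real m + real m * (2 * x)) * (2 * l)
            \<le> (real (card (opt_alive P k)) + 5 * y) * (2 * l)" using l0 by (intro mult_right_mono) auto
        then show ?thesis unfolding \<tau>(3) using \<kappa>2 y2 by linarith
      qed
      also have "\<dots> = c + 2 * l * real (card (opt_alive P k))" by (simp add: c_def algebra_simps)
      finally have "dur k * real (card (Q k)) \<le> dur k * (c + 2 * l * real (card (opt_alive P k)))"
        using dur_nonneg[OF kM] by (rule mult_left_mono)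
      then show "dur k * real (card (Q k)) \<le> dur k * c + 2 * l * (dur k * real (card (opt_alive P k)))"
        by (simp add: algebra_simps)
    qed
    also have "\<dots> = c * sum dur (T1 - Y) + 2 * l * (\<Sum>k\<in>T1 - Y. dur k * real (card (opt_alive P k)))"
      by (simp add: sum.distrib sum_distrib_left mult.commute)
    also have "\<dots> \<le> c * (\<theta> * L / real m) + 2 * l * F"
    proof (intro add_mono mult_left_mono)
      have "sum dur (T1 - Y) \<le> sum dur T1"
        using finT dur_nonneg by (intro sum_mono2) (auto simp: T1_def)
      then show "sum dur (T1 - Y) \<le> \<theta> * L / real m" using T1_len by linarith
      have "(\<Sum>k\<in>T1 - Y. dur k * real (card (opt_alive P k))) \<le> (\<Sum>k<M. dur k * real (card (opt_alive P k)))"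
        using dur_nonneg by (intro sum_mono2) (auto simp: T1_def)
      then show "(\<Sum>k\<in>T1 - Y. dur k * real (card (opt_alive P k))) \<le> F"
        using opt_alive_time[OF P] by (simp add: F_def)
    qed (use y2 l0 in \<open>auto simp: c_def\<close>)
    also have "c * (\<theta> * L / real m) = x * (3 + 10 * l) * \<theta> * L"
      using m_pos by (simp add: c_def y_def)
    finally show ?thesis .
  qed
  have T1: "(\<Sum>k\<in>T1. dur k * real (card (Q k))) \<le> 2 * L + x * (3 + 10 * l) * \<theta> * L + 2 * l * F"
    using tiny rest sum.Int_Diff[OF finT(1), of "\<lambda>k. dur k * real (card (Q k))" Y] by linarith
  have T2: "(\<Sum>k\<in>T2. dur k * real (card (Q k))) \<le> 10 * x * L"
  proof -
    have "2 / real m * (2 * real \<kappa> * L) \<le> 2 / real m * (2 * (2 * y) * L)"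
      using L0 \<kappa>2 by (intro mult_left_mono mult_right_mono) auto
    also have "\<dots> = 8 * x * L" using m_pos by (simp add: y_def)
    finally show ?thesis using T2_wait by (simp add: algebra_simps)
  qed
  have F0: "0 < F" using L0 LF by simp
  have *: "total_flow J S \<le> (1 + 2 * x) * L + 2 * L + x * (3 + 10 * l) * \<theta> * L + 2 * l * F + 10 * x * L"
    using flow_le_waiting T1 T2 by linarith
  have "(1 + 2 * x) * L + 2 * L + x * (3 + 10 * l) * \<theta> * L + 10 * x * L
      = (3 + 12 * x + x * (3 + 10 * l) * \<theta>) * L" by (simp add: algebra_simps)
  also have "\<dots> \<le> (3 + 12 * x + x * (3 + 10 * l) * \<theta>) * F"
    using LF x1 l0 \<theta> by (intro mult_left_mono) (auto intro!: add_nonneg_nonneg mult_nonneg_nonneg)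
  finally have "total_flow J S \<le> (3 + 12 * x + x * (3 + 10 * l) * \<theta> + 2 * l) * F"
    using * by (simp add: algebra_simps)
  also have "\<dots> \<le> (x * (100 * (1 + l)\<^sup>2)) * F"
  proof (rule mult_right_mono)
    have "x * (3 + 10 * l) * \<theta> \<le> x * (3 + 10 * l) * (7 + 2 * l)"
      using \<theta> x1 l0 by (intro mult_left_mono) auto
    moreover have "3 \<le> x * 3" "2 * l \<le> x * (2 * l)"
      using x1 l0 mult_right_mono[of 1 x "2 * l"] by auto
    ultimately have "3 + 12 * x + x * (3 + 10 * l) * \<theta> + 2 * l
       \<le> x * (3 + 12 + (3 + 10 * l) * (7 + 2 * l) + 2 * l)" by (simp add: algebra_simps)
    \<comment> \<open>The bracket equals \<open>36 + 78 * l + 20 * l\<^sup>2\<close>.\<close>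
    also have "\<dots> \<le> x * (100 * (1 + l)\<^sup>2)"
      using x1 l0 by (intro mult_left_mono) (auto simp: power2_eq_square algebra_simps)
    finally show "3 + 12 * x + x * (3 + 10 * l) * \<theta> + 2 * l \<le> x * (100 * (1 + l)\<^sup>2)" .
  qed (use F0 in simp)
  finally show ?thesis by (simp add: l_def F_def algebra_simps)
qed

lemma flow_bound:
  assumes P: "preemptive_schedule m J P"
  shows "total_flow J S \<le>
    40000 * max 1 (real (length J) powr ((sqrt 5 - 1) / 2) / sqrt (real m)) * total_flow J P"
proof -
  define F where "F = total_flow J P"
  have LF: "L \<le> F" unfolding F_def by (rule L_le_flow[OF P])
  show ?thesis
  proof (cases "n \<le> m")
    case True
    have "total_flow J S \<le> 24 * F" using flow_few_jobs[OF True] LF by linarith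
    also have "\<dots> \<le> 40000 * max 1 (real (length J) powr ((sqrt 5 - 1) / 2) / sqrt (real m)) * F"
      using LF L_nonneg by (intro mult_right_mono) auto
    finally show ?thesis by (simp add: F_def)
  next
    case False
    then have mn: "m < n" by simp
    then have n1: "1 \<le> real n" using m_pos by simp
    \<comment> \<open>From \<open>ln r \<le> r - 1\<close> follows
      \<open>1 + ln n \<le> 20 * r\<close>. The square is \<open>400 * n powr (1 / 10)\<close>,
      which together with the factor 100 gives the constant 40000.\<close>
    define r where "r = real n powr (1 / 20)"
    have "ln r \<le> r - 1" using n1 by (intro ln_le_minus_one) (simp add: r_def)
    then have "1 + ln (real n) \<le> 20 * r" using n1 by (simp add: r_def ln_powr)
    then have "(1 + ln (real n))\<^sup>2 \<le> (20 * r)\<^sup>2" using n1 by (intro power_mono) auto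
    also have "\<dots> = 400 * real n powr (1 / 10)"
      by (simp add: r_def power_mult_distrib power2_eq_square flip: powr_add)
    finally have "100 * x * (1 + ln (real n))\<^sup>2 \<le> 100 * x * (400 * real n powr (1 / 10))"
      using x_nonneg by (intro mult_left_mono) auto
    also have "\<dots> = 40000 * (real n powr (1 / 2 + 1 / 10) / sqrt (real m))"
      using n1 unfolding powr_add by (simp add: x_def real_sqrt_divide powr_half_sqrt)
    also have "\<dots> \<le> 40000 * (real n powr ((sqrt 5 - 1) / 2) / sqrt (real m))"
    proof -
      \<comment> \<open>So the exponent \<open>(sqrt 5 - 1) / 2\<close> is at least
        \<open>3 / 5\<close>, and the excess over \<open>1 / 2\<close> leaves the
        \<open>1 / 10\<close> that absorbs the logarithms.\<close>
      have "11 / 5 \<le> sqrt 5" by (rule real_le_rsqrt) (simp add: power2_eq_square)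
      then have "real n powr (1 / 2 + 1 / 10) \<le> real n powr ((sqrt 5 - 1) / 2)"
        using n1 by (intro powr_mono) auto
      then show ?thesis by (simp add: divide_right_mono)
    qed
    also have "\<dots> \<le> 40000 * max 1 (real (length J) powr ((sqrt 5 - 1) / 2) / sqrt (real m))"
      by (simp add: n_def)
    finally have "100 * x * (1 + ln (real n))\<^sup>2 * F
       \<le> 40000 * max 1 (real (length J) powr ((sqrt 5 - 1) / 2) / sqrt (real m)) * F"
      using LF L_nonneg by (intro mult_right_mono) auto
    then show ?thesis using flow_many_jobs[OF P mn] unfolding F_def by (rule order_trans[rotated])
  qed
qed

end

section \<open>The algorithm\<close>

text \<open>\<open>run x h\<close> holds the job on machine \<open>h\<close> and its starting time.
  A run enters \<open>segs\<close> only when it ends, as its length is not known before.\<close>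

record state =
  now :: real
  waits :: "nat set"
  run :: "nat \<Rightarrow> (nat \<times> real) option"
  segs :: schedule

definition seg_of :: "nat \<Rightarrow> nat \<Rightarrow> real \<Rightarrow> real \<Rightarrow> segment" where
  "seg_of h j s t = \<lparr>job = j, machine = h, start = s, fin = t\<rparr>"

lemma seg_of_simps [simp]:
  "job (seg_of h j s t) = j" "machine (seg_of h j s t) = h"
  "start (seg_of h j s t) = s" "fin (seg_of h j s t) = t"
  by (simp_all add: seg_of_def)

text \<open>Completions and kills are the same operation on the record; the length of the segment
  tells them apart.\<close>

definition stop :: "(nat \<Rightarrow> bool) \<Rightarrow> real \<Rightarrow> state \<Rightarrow> state" where
  "stop P t x = x\<lparr>run := (\<lambda>h. if P h then None else run x h),
     segs := segs x \<union> {seg_of h j s t | h j s. P h \<and> run x h = Some (j, s)}\<rparr>"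

definition arrive :: "jobs \<Rightarrow> real \<Rightarrow> state \<Rightarrow> state" where
  "arrive J t x = x\<lparr>now := t, waits := waits x \<union> (arrived J t - arrived J (now x))\<rparr>"

definition finishes :: "jobs \<Rightarrow> real \<Rightarrow> state \<Rightarrow> nat \<Rightarrow> bool" where
  "finishes J t x h \<longleftrightarrow> (\<exists>j s. run x h = Some (j, s) \<and> s + proc J j \<le> t)"

text \<open>The bound \<open>H\<close> serves loop invariants, because the program treats the
  machines one by one; a full step takes \<open>H = m\<close>.\<close>

definition finish :: "jobs \<Rightarrow> real \<Rightarrow> nat \<Rightarrow> state \<Rightarrow> state" where
  "finish J t H x = stop (\<lambda>h. h < H \<and> finishes J t x h) t x"

definition hit :: "nat \<Rightarrow> jobs \<Rightarrow> real \<Rightarrow> state \<Rightarrow> nat \<Rightarrow> bool" where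
  "hit m J t x h \<longleftrightarrow>
     (\<exists>j s. run x h = Some (j, s) \<and> capacity m J t < card {q \<in> waits x. prec J q j})"

text \<open>All kills are decided on the queue as it is before any killed job returns to it, so the
  order of the machines is irrelevant.\<close>

definition kill :: "nat \<Rightarrow> jobs \<Rightarrow> real \<Rightarrow> nat \<Rightarrow> state \<Rightarrow> state" where
  "kill m J t H x = (stop (\<lambda>h. h < H \<and> hit m J t x h) t x)
     \<lparr>waits := waits x \<union> {j. \<exists>h s. h < H \<and> hit m J t x h \<and> run x h = Some (j, s)}\<rparr>"

definition smallest :: "jobs \<Rightarrow> nat set \<Rightarrow> nat" where
  "smallest J A = (THE q. q \<in> A \<and> (\<forall>i\<in>A. \<not> prec J i q))"

text \<open>The comparison with \<open>volume / capacity\<close>, multiplied out to avoid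
  division.\<close>

definition small :: "nat \<Rightarrow> jobs \<Rightarrow> real \<Rightarrow> nat \<Rightarrow> bool" where
  "small m J t j \<longleftrightarrow> proc J j * real (capacity m J t) < volume J t"

text \<open>Testing the smallest waiting job suffices: if it is not small, no waiting job
  is.\<close>

definition launch :: "nat \<Rightarrow> jobs \<Rightarrow> real \<Rightarrow> nat \<Rightarrow> state \<Rightarrow> state" where
  "launch m J t h x =
     (if run x h = None \<and> waits x \<noteq> {} \<and> (2 * h < m \<or> small m J t (smallest J (waits x)))
      then x\<lparr>run := (run x)(h := Some (smallest J (waits x), t)),
             waits := waits x - {smallest J (waits x)}\<rparr>
      else x)"

primrec launch_all :: "nat \<Rightarrow> jobs \<Rightarrow> real \<Rightarrow> nat \<Rightarrow> state \<Rightarrow> state" where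
  "launch_all m J t 0 x = x"
| "launch_all m J t (Suc h) x = launch m J t h (launch_all m J t h x)"

text \<open>Between these times nothing arrives or ends, so no decision has to be revised.\<close>

definition events :: "nat \<Rightarrow> jobs \<Rightarrow> state \<Rightarrow> real set" where
  "events m J x = {release J j | j. j < length J \<and> now x < release J j}
     \<union> {s + proc J j | h j s. h < m \<and> run x h = Some (j, s)}"

definition advance :: "nat \<Rightarrow> jobs \<Rightarrow> real \<Rightarrow> state \<Rightarrow> state" where
  "advance m J t x = launch_all m J t m (kill m J t m (finish J t m (arrive J t x)))"

definition step :: "nat \<Rightarrow> jobs \<Rightarrow> state \<Rightarrow> state" where
  "step m J x = (if events m J x = {} then x else advance m J (Min (events m J x)) x)"

text \<open>Time \<open>-1\<close> precedes all releases, so jobs released at time 0 arrive through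
  an ordinary event.\<close>

definition init :: state where
  "init = \<lparr>now = -1, waits = {}, run = (\<lambda>_. None), segs = {}\<rparr>"

section \<open>Invariants of the simulated run\<close>

lemma smallest:
  assumes "finite A" "A \<noteq> {}"
  shows "smallest J A \<in> A" "i \<in> A \<Longrightarrow> \<not> prec J i (smallest J A)"
proof -
  obtain q where q: "q \<in> A" "\<forall>i\<in>A. \<not> prec J i q" using ex_prec_min[OF assms] by blast
  have "smallest J A = q" unfolding smallest_def
  proof (rule the_equality)
    fix y assume "y \<in> A \<and> (\<forall>i\<in>A. \<not> prec J i y)"
    then show "y = q" using q prec_total by blast
  qed (use q in blast)
  then show "smallest J A \<in> A" "i \<in> A \<Longrightarrow> \<not> prec J i (smallest J A)" using q by auto
qed

lemma finite_stopped:
  assumes "\<And>h. P h \<Longrightarrow> h < m"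
  shows "finite {seg_of h j s t | h j s. P h \<and> run x h = Some (j, s)}"
proof (rule finite_subset)
  show "{seg_of h j s t | h j s. P h \<and> run x h = Some (j, s)}
     \<subseteq> (\<lambda>h. seg_of h (fst (the (run x h))) (snd (the (run x h))) t) ` {..<m}"
  proof clarify
    fix h j s assume "P h" "run x h = Some (j, s)"
    then show "seg_of h j s t \<in> (\<lambda>h. seg_of h (fst (the (run x h))) (snd (the (run x h))) t) ` {..<m}"
      using assms by (intro image_eqI[of _ _ h]) auto
  qed
qed simp

text \<open>The invariant holds after every phase of a step. Therefore a run may be due but not yet
  recorded (\<open>now x \<le> s + proc J j\<close>), and it may just have started
  (\<open>s \<le> now x\<close>). Each arrived job is waiting, running or completed, and
  \<open>later\<close> is what turns the kill rule into \<open>kill_arr\<close>.\<close>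

locale core =
  fixes m :: nat and J :: jobs and x :: state
  assumes waits: "q \<in> waits x \<Longrightarrow> q \<in> arrived J (now x)"
    and runs: "run x h = Some (j, s) \<Longrightarrow> h < m \<and> j \<in> arrived J (now x) \<and> j \<notin> waits x \<and>
       release J j \<le> s \<and> s \<le> now x \<and> now x \<le> s + proc J j"
    and run_inj: "run x h = Some (j, s) \<Longrightarrow> run x h' = Some (j, s') \<Longrightarrow> h = h'"
    and fin_segs: "finite (segs x)"
    and segs: "a \<in> segs x \<Longrightarrow> job a \<in> arrived J (now x) \<and> machine a < m \<and>
       release J (job a) \<le> start a \<and> start a < fin a \<and> fin a \<le> now x \<and>
       fin a - start a \<le> proc J (job a)"
    and seg_run: "a \<in> segs x \<Longrightarrow> run x h = Some (j, s) \<Longrightarrow> machine a = h \<or> job a = j \<Longrightarrow> fin a \<le> s"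
    and seg_disj: "a \<in> segs x \<Longrightarrow> b \<in> segs x \<Longrightarrow> a \<noteq> b \<Longrightarrow> machine a = machine b \<or> job a = job b \<Longrightarrow>
       fin a \<le> start b \<or> fin b \<le> start a"
    and accounted: "j \<in> arrived J (now x) \<Longrightarrow> j \<notin> waits x \<Longrightarrow> (\<And>h s. run x h \<noteq> Some (j, s)) \<Longrightarrow>
       \<exists>a\<in>segs x. job a = j \<and> fin a - start a = proc J j"
    and done_gone: "a \<in> segs x \<Longrightarrow> fin a - start a = proc J (job a) \<Longrightarrow>
       job a \<notin> waits x \<and> run x h \<noteq> Some (job a, s)"
    and done_last: "a \<in> segs x \<Longrightarrow> fin a - start a = proc J (job a) \<Longrightarrow> b \<in> segs x \<Longrightarrow> b \<noteq> a \<Longrightarrow>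
       job b = job a \<Longrightarrow> fin b \<le> start a \<and> fin b - start b < proc J (job b)"
    and kill_arr: "a \<in> segs x \<Longrightarrow> fin a - start a < proc J (job a) \<Longrightarrow>
       capacity m J (fin a) < card {q. q < length J \<and> start a < release J q \<and> release J q \<le> fin a}"
    and seg_small: "a \<in> segs x \<Longrightarrow> \<not> 2 * machine a < m \<Longrightarrow> small m J (start a) (job a)"
    and run_small: "run x h = Some (j, s) \<Longrightarrow> \<not> 2 * h < m \<Longrightarrow> small m J s j"
    and later: "run x h = Some (i, s) \<Longrightarrow> q \<in> waits x \<Longrightarrow> prec J q i \<Longrightarrow> s < release J q"

lemma arrived_init:
  assumes "valid_jobs J" shows "arrived J (now init) = {}"
  using assms by (fastforce simp: init_def arrived_def valid_jobs_def)

lemma core_init: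
  assumes "valid_jobs J" shows "core m J init"
  using arrived_init[OF assms] by unfold_locales (auto simp: init_def)

text \<open>Advancing to the earliest event guarantees \<open>next_t\<close>, so no run overshoots.
  A job that newly enters the queue was released after \<open>now x\<close>, hence after the start
  of every current run.\<close>

lemma core_arrive:
  assumes c: "core m J x" and t: "now x < t"
    and next_t: "\<And>h j s. run x h = Some (j, s) \<Longrightarrow> t \<le> s + proc J j"
  shows "core m J (arrive J t x)"
proof -
  interpret core m J x by (rule c)
  have mono: "arrived J (now x) \<subseteq> arrived J t" using t by (intro arrived_mono) simp
  let ?y = "arrive J t x"
  have y: "now ?y = t" "run ?y = run x" "segs ?y = segs x"
     "waits ?y = waits x \<union> (arrived J t - arrived J (now x))" by (simp_all add: arrive_def)
  show ?thesis
  proof (unfold_locales, unfold y, goal_cases)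
    case (1 q) then show ?case using waits mono by blast
  next
    case (2 h j s) then show ?case using runs[OF 2] next_t[OF 2] mono t by auto
  next
    case (3 h j s h' s') then show ?case by (rule run_inj)
  next
    case 4 show ?case by (rule fin_segs)
  next
    case (5 a) then show ?case using segs[OF 5] mono t by auto
  next
    case (6 a h j s) then show ?case by (rule seg_run)
  next
    case (7 a b) then show ?case by (rule seg_disj)
  next
    case (8 j) then show ?case using accounted by blast
  next
    case (9 a h s) then show ?case using done_gone segs by blast
  next
    case (10 a b) then show ?case using done_last by blast
  next
    case (11 a) then show ?case by (rule kill_arr)
  next
    case (12 a) then show ?case by (rule seg_small)
  next
    case (13 h j s) then show ?case by (rule run_small)
  next
    case (14 h i s q)
    show ?case
    proof (cases "q \<in> waits x")
      case True then show ?thesis using later 14 by blast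
    next
      case False
      then have "now x < release J q" using 14 by (auto simp: arrived_def)
      then show ?thesis using runs[OF 14(1)] by auto
    qed
  qed
qed

text \<open>\<open>fresh\<close> excludes segments of length zero.\<close>

lemma core_finish:
  assumes c: "core m J x" and fresh: "\<And>h j s. run x h = Some (j, s) \<Longrightarrow> s < now x"
  shows "core m J (finish J (now x) m x)"
proof -
  interpret core m J x by (rule c)
  let ?y = "finish J (now x) m x"
  let ?t = "now x"
  have y: "now ?y = now x" "waits ?y = waits x" by (simp_all add: finish_def stop_def)
  have run: "run ?y h = Some (j, s) \<longleftrightarrow> run x h = Some (j, s) \<and> ?t < s + proc J j" for h j s
    using runs[of h j s] by (auto simp: finish_def stop_def finishes_def)
  have seg: "a \<in> segs ?y \<longleftrightarrow> a \<in> segs x \<or>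
     (run x (machine a) = Some (job a, start a) \<and> fin a = ?t \<and> fin a - start a = proc J (job a))" for a
    using runs[of "machine a" "job a" "start a"]
    by (cases a) (auto simp: finish_def stop_def finishes_def seg_of_def)
  show ?thesis
  proof (unfold_locales, unfold y, goal_cases)
    case (1 q) then show ?case using waits by blast
  next
    case (2 h j s) then show ?case using runs run by blast
  next
    case (3 h j s h' s') then show ?case using run_inj run by blast
  next
    case 4
    show ?case using fin_segs finite_stopped[of "\<lambda>h. h < m \<and> finishes J ?t x h" m]
      by (simp add: finish_def stop_def)
  next
    case (5 a) then show ?case using segs[of a] runs[of "machine a" "job a" "start a"]
      fresh[of "machine a" "job a" "start a"] seg[of a] by auto
  next
    case (6 a h j s)
    then show ?case using seg[of a] run[of h j s] seg_run[of a h j s] run_inj[of h j s] by fastforce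
  next
    case (7 a b)
    show ?case
    proof (cases "a \<in> segs x \<or> b \<in> segs x")
      case True
      then show ?thesis using 7 seg[of a] seg[of b] seg_disj[of a b]
         seg_run[of a "machine b" "job b" "start b"] seg_run[of b "machine a" "job a" "start a"] by auto
    next
      case False
      then have "run x (machine a) = Some (job a, start a)" "run x (machine b) = Some (job b, start b)"
        "fin a = fin b" using 7 seg by auto
      then have "a = b" using 7(4) run_inj[of "machine a" "job a" "start a" "machine b" "start b"]
        by (cases a; cases b) auto
      then show ?thesis using 7 by simp
    qed
  next
    case (8 j)
    show ?case
    proof (cases "\<exists>h s. run x h = Some (j, s)")
      case True
      then obtain h s where hs: "run x h = Some (j, s)" by blast
      then have "\<not> ?t < s + proc J j" using 8(3) run by blast
      then have "seg_of h j s ?t \<in> segs ?y" using runs[OF hs] hs seg[of "seg_of h j s ?t"] by auto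
      then show ?thesis using runs[OF hs] \<open>\<not> ?t < s + proc J j\<close> by (intro bexI[of _ "seg_of h j s ?t"]) auto
    next
      case False
      then show ?thesis using accounted[of j] 8 seg by blast
    qed
  next
    case (9 a h s)
    show ?case
    proof (cases "a \<in> segs x")
      case True then show ?thesis using done_gone 9 run by blast
    next
      case False
      then have a: "run x (machine a) = Some (job a, start a)" "fin a = ?t" using 9 seg by auto
      have "run ?y h \<noteq> Some (job a, s)"
      proof
        assume "run ?y h = Some (job a, s)"
        then have h: "run x h = Some (job a, s)" "?t < s + proc J (job a)" using run by auto
        then have "h = machine a" using run_inj a by blast
        then show False using h a 9 by auto
      qed
      then show ?thesis using runs[OF a(1)] by auto
    qed
  next
    case (10 a b)
    show ?case
    proof (cases "a \<in> segs x")
      case True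
      then have "b \<in> segs x" using done_gone[OF True 10(2)] 10 seg[of b] by auto
      then show ?thesis using done_last True 10 by blast
    next
      case False
      then have a: "run x (machine a) = Some (job a, start a)" "fin a = ?t" using 10 seg by auto
      have b: "b \<in> segs x"
      proof (rule ccontr)
        assume "b \<notin> segs x"
        then have b: "run x (machine b) = Some (job a, start b)" "fin b = ?t" using 10 seg[of b] by auto
        then have "machine a = machine b" using run_inj a by blast
        then have "a = b" using a b 10(5) by (cases a; cases b) auto
        then show False using 10 by simp
      qed
      have "fin b \<le> start a" using seg_run[OF b a(1)] 10 by auto
      moreover have "fin b - start b < proc J (job b)"
        using done_gone[OF b, of "machine a" "start a"] segs[OF b] a 10(5) by fastforce
      ultimately show ?thesis by simp
    qed
  next
    case (11 a) then show ?case using kill_arr[of a] seg[of a] by auto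
  next
    case (12 a) then show ?case using seg_small[of a] run_small[of "machine a" "job a" "start a"] seg[of a] by auto
  next
    case (13 h j s) then show ?case using run_small run by blast
  next
    case (14 h i s q) then show ?case using later run by blast
  qed
qed

definition few_smaller_waiting :: "nat \<Rightarrow> jobs \<Rightarrow> state \<Rightarrow> bool" where
  "few_smaller_waiting m J x \<longleftrightarrow> (\<forall>h j s. run x h = Some (j, s) \<longrightarrow>
     card {q \<in> waits x. prec J q j} \<le> capacity m J (now x))"

definition unfinished :: "jobs \<Rightarrow> state \<Rightarrow> bool" where
  "unfinished J x \<longleftrightarrow> (\<forall>h j s. run x h = Some (j, s) \<longrightarrow> now x < s + proc J j)"

lemma unfinished_finish: "core m J x \<Longrightarrow> unfinished J (finish J (now x) m x)"
  using core.runs[of m J x] by (fastforce simp: unfinished_def finish_def stop_def finishes_def split: if_splits)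

lemma core_finite_waits: "core m J x \<Longrightarrow> finite (waits x)"
  using core.waits[of m J x] finite_subset[OF _ finite_arrived] by blast

text \<open>Hence no kill puts a job into the queue that is smaller than a surviving running job.\<close>

lemma hit_larger:
  assumes "finite (waits x)" "hit m J t x h" "run x h = Some (i, r)" "run x h' = Some (j, s)" "prec J i j"
  shows "hit m J t x h'"
proof -
  have "{q \<in> waits x. prec J q i} \<subseteq> {q \<in> waits x. prec J q j}" using assms(5) prec_trans by blast
  then have "card {q \<in> waits x. prec J q i} \<le> card {q \<in> waits x. prec J q j}"
    using assms(1) by (intro card_mono) auto
  then show ?thesis using assms by (auto simp: hit_def)
qed

text \<open>\<open>unfinished\<close> makes each killed segment shorter than its job, so a killed
  run is never mistaken for a completed one.\<close>

lemma core_kill: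
  assumes c: "core m J x" and fresh: "\<And>h j s. run x h = Some (j, s) \<Longrightarrow> s < now x"
    and unf: "unfinished J x"
  shows "core m J (kill m J (now x) m x)" "few_smaller_waiting m J (kill m J (now x) m x)"
    "unfinished J (kill m J (now x) m x)"
proof -
  interpret core m J x by (rule c)
  have finw: "finite (waits x)" using c by (rule core_finite_waits)
  let ?y = "kill m J (now x) m x"
  let ?t = "now x"
  let ?hit = "hit m J ?t x"
  have now: "now ?y = now x" by (simp add: kill_def stop_def)
  have waits': "q \<in> waits ?y \<longleftrightarrow> q \<in> waits x \<or> (\<exists>h s. ?hit h \<and> run x h = Some (q, s))" for q
    using runs by (fastforce simp: kill_def)
  have run: "run ?y h = Some (j, s) \<longleftrightarrow> run x h = Some (j, s) \<and> \<not> ?hit h" for h j s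
    using runs[of h j s] by (auto simp: kill_def stop_def)
  have seg: "a \<in> segs ?y \<longleftrightarrow> a \<in> segs x \<or>
     (run x (machine a) = Some (job a, start a) \<and> ?hit (machine a) \<and> fin a = ?t)" for a
    using runs[of "machine a" "job a" "start a"]
    by (cases a) (auto simp: kill_def stop_def seg_of_def)
  have short: "fin a - start a < proc J (job a)" if "run x (machine a) = Some (job a, start a)" "fin a = ?t" for a
    using unf that by (force simp: unfinished_def)
  have smaller_eq: "{q \<in> waits ?y. prec J q j} = {q \<in> waits x. prec J q j}"
    if "run x h = Some (j, s)" "\<not> ?hit h" for h j s
    using that hit_larger[OF finw] waits' by blast
  show "few_smaller_waiting m J ?y"
    unfolding few_smaller_waiting_def now
  proof (intro allI impI)
    fix h j s assume "run ?y h = Some (j, s)"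
    then have h: "run x h = Some (j, s)" "\<not> ?hit h" using run by auto
    then show "card {q \<in> waits ?y. prec J q j} \<le> capacity m J ?t"
      unfolding smaller_eq[OF h] by (auto simp: hit_def not_less)
  qed
  show "unfinished J ?y" using unf unfolding unfinished_def now run by blast
  show "core m J ?y"
  proof (unfold_locales, unfold now, goal_cases)
    case (1 q) then show ?case using waits' waits runs by blast
  next
    case (2 h j s)
    then have h: "run x h = Some (j, s)" "\<not> ?hit h" using run by auto
    have "j \<notin> waits ?y" using waits' runs[OF h(1)] run_inj[OF h(1)] h(2) by blast
    then show ?case using runs[OF h(1)] by blast
  next
    case (3 h j s h' s') then show ?case using run_inj run by blast
  next
    case 4
    show ?case using fin_segs finite_stopped[of "\<lambda>h. h < m \<and> ?hit h" m]
      by (simp add: kill_def stop_def)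
  next
    case (5 a) then show ?case using segs[of a] runs[of "machine a" "job a" "start a"]
      fresh[of "machine a" "job a" "start a"] seg[of a] by auto
  next
    case (6 a h j s)
    then show ?case using seg[of a] run[of h j s] seg_run[of a h j s] run_inj[of h j s] by fastforce
  next
    case (7 a b)
    show ?case
    proof (cases "a \<in> segs x \<or> b \<in> segs x")
      case True
      then show ?thesis using 7 seg[of a] seg[of b] seg_disj[of a b]
         seg_run[of a "machine b" "job b" "start b"] seg_run[of b "machine a" "job a" "start a"] by auto
    next
      case False
      then have "run x (machine a) = Some (job a, start a)" "run x (machine b) = Some (job b, start b)"
        "fin a = fin b" using 7 seg by auto
      then have "a = b" using 7(4) run_inj[of "machine a" "job a" "start a" "machine b" "start b"]
        by (cases a; cases b) auto
      then show ?thesis using 7 by simp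
    qed
  next
    case (8 j)
    then have "j \<notin> waits x" "\<And>h s. run x h \<noteq> Some (j, s)" using waits' run by blast+
    then show ?case using accounted[OF 8(1)] seg by blast
  next
    case (9 a h s)
    have a: "a \<in> segs x" using 9 seg[of a] short[of a] by auto
    then show ?case using done_gone[OF a 9(2)] run waits' by blast
  next
    case (10 a b)
    have a: "a \<in> segs x" using 10 seg[of a] short[of a] by auto
    have "b \<in> segs x" using done_gone[OF a 10(2)] 10 seg[of b] by auto
    then show ?case using done_last a 10 by blast
  next
    case (11 a)
    show ?case
    proof (cases "a \<in> segs x")
      case True then show ?thesis using kill_arr 11 by blast
    next
      case False
      then have a: "run x (machine a) = Some (job a, start a)" "?hit (machine a)" "fin a = ?t"
        using 11 seg by auto
      \<comment> \<open>By \<open>later\<close>, the smaller waiting jobs that cause the kill all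
        arrived during the run.\<close>
      have "{q \<in> waits x. prec J q (job a)} \<subseteq> {q. q < length J \<and> start a < release J q \<and> release J q \<le> fin a}"
        using later[OF a(1)] waits a(3) by (auto simp: arrived_def)
      then have "card {q \<in> waits x. prec J q (job a)}
         \<le> card {q. q < length J \<and> start a < release J q \<and> release J q \<le> fin a}" by (intro card_mono) auto
      then show ?thesis using a by (auto simp: hit_def)
    qed
  next
    case (12 a) then show ?case using seg_small[of a] run_small[of "machine a" "job a" "start a"] seg[of a] by auto
  next
    case (13 h j s) then show ?case using run_small run by blast
  next
    case (14 h i s q)
    then have h: "run x h = Some (i, s)" "\<not> ?hit h" using run by auto
    have "q \<in> waits x" using smaller_eq[OF h] 14 by blast
    then show ?case using later h 14 by blast
  qed
qed

definition covered :: "nat \<Rightarrow> jobs \<Rightarrow> nat \<Rightarrow> state \<Rightarrow> bool" where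
  "covered m J H x \<longleftrightarrow> (\<forall>h<H. run x h = None \<longrightarrow>
     waits x = {} \<or> (\<not> 2 * h < m \<and> (\<forall>q\<in>waits x. \<not> small m J (now x) q)))"

text \<open>The launched job is the smallest in the queue, so no waiting job is smaller; this
  preserves \<open>later\<close> and \<open>few_smaller_waiting\<close>. The queue only shrinks,
  which keeps the earlier machines covered.\<close>

lemma launch_keeps:
  assumes c: "core m J x" and few: "few_smaller_waiting m J x" and unf: "unfinished J x"
    and cov: "covered m J h x" and h: "h < m" and v: "valid_jobs J"
  shows "core m J (launch m J (now x) h x) \<and> few_smaller_waiting m J (launch m J (now x) h x) \<and>
    unfinished J (launch m J (now x) h x) \<and> covered m J (Suc h) (launch m J (now x) h x) \<and>
    now (launch m J (now x) h x) = now x"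
proof -
  interpret core m J x by (rule c)
  have finw: "finite (waits x)" using c by (rule core_finite_waits)
  have small_mono: "small m J t i" if "small m J t j" "\<not> prec J j i" for t i j
    using that prec_le[of J j i] mult_right_mono[of "proc J i" "proc J j" "real (capacity m J t)"]
    by (auto simp: small_def)
  let ?q = "smallest J (waits x)"
  show ?thesis
  proof (cases "run x h = None \<and> waits x \<noteq> {} \<and> (2 * h < m \<or> small m J (now x) ?q)")
    case False
    then have eq: "launch m J (now x) h x = x" by (auto simp: launch_def)
    have "covered m J (Suc h) x" unfolding covered_def
    proof (intro allI impI)
      fix i assume i: "i < Suc h" "run x i = None"
      show "waits x = {} \<or> \<not> 2 * i < m \<and> (\<forall>q\<in>waits x. \<not> small m J (now x) q)"
      proof (cases "i = h")
        case True
        have "\<not> small m J (now x) q" if "q \<in> waits x" "\<not> small m J (now x) ?q" for q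
          using small_mono[of "now x" q ?q] smallest(2)[OF finw _ that(1)] that by blast
        then show ?thesis using False i True by blast
      next
        case False
        then show ?thesis using cov i by (simp add: covered_def less_Suc_eq)
      qed
    qed
    then show ?thesis using eq c few unf by simp
  next
    case True
    let ?y = "launch m J (now x) h x"
    have y: "now ?y = now x" "segs ?y = segs x" "waits ?y = waits x - {?q}"
       "run ?y = (run x)(h := Some (?q, now x))"
      using True by (auto simp: launch_def)
    have run: "run ?y i = Some (j, s) \<longleftrightarrow> (if i = h then j = ?q \<and> s = now x else run x i = Some (j, s))" for i j s
      using y by auto
    have q: "?q \<in> waits x" "\<And>i. i \<in> waits x \<Longrightarrow> \<not> prec J i ?q" using smallest[OF finw] True by auto
    have qa: "?q \<in> arrived J (now x)" using waits q by blast
    then have p: "0 < proc J ?q" "release J ?q \<le> now x" using v by (auto simp: arrived_def valid_jobs_def)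
    have nr: "run x i \<noteq> Some (?q, s)" for i s using runs[of i ?q s] q by blast
    have "few_smaller_waiting m J ?y"
      unfolding few_smaller_waiting_def y(1)
    proof (intro allI impI)
      fix i j s assume i: "run ?y i = Some (j, s)"
      show "card {q \<in> waits ?y. prec J q j} \<le> capacity m J (now x)"
      proof (cases "i = h")
        case True
        then have "{q \<in> waits ?y. prec J q j} = {}" using i run q y(3) by auto
        then show ?thesis by (metis card.empty le0)
      next
        case False
        have "card {q \<in> waits ?y. prec J q j} \<le> card {q \<in> waits x. prec J q j}"
          using finw y(3) by (intro card_mono) auto
        then show ?thesis using few i run False unfolding few_smaller_waiting_def by (meson le_trans)
      qed
    qed
    moreover have "unfinished J ?y"
      using unf p run unfolding unfinished_def y(1) by (auto split: if_splits)
    moreover have "covered m J (Suc h) ?y"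
      using cov unfolding covered_def y by (auto simp: less_Suc_eq)
    moreover have "core m J ?y"
    proof (unfold_locales, unfold y(1,2), goal_cases)
      case (1 q) then show ?case using waits y by blast
    next
      case (2 i j s)
      then show ?case using runs[of i j s] run[of i j s] h p qa y(3) by (auto split: if_splits)
    next
      case (3 i j s h' s')
      then show ?case using run_inj[of i j s h' s'] run nr by (auto split: if_splits)
    next
      case 4 show ?case by (rule fin_segs)
    next
      case (5 a) then show ?case by (rule segs)
    next
      case (6 a i j s)
      then show ?case using run[of i j s] seg_run[of a i j s] segs[of a] by (auto split: if_splits)
    next
      case (7 a b) then show ?case by (rule seg_disj)
    next
      case (8 j)
      have "j \<noteq> ?q" using 8(3)[of h "now x"] run[of h j "now x"] by auto
      moreover have "run x i \<noteq> Some (j, s)" for i s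
        using 8(3)[of i s] run[of i j s] True by (cases "i = h") auto
      ultimately show ?case using accounted[of j] 8 y(3) by blast
    next
      case (9 a i s)
      then have "job a \<notin> waits x" "run x i \<noteq> Some (job a, s)" using done_gone by blast+
      moreover have "job a \<noteq> ?q" using calculation(1) q(1) by metis
      ultimately show ?case unfolding y(3) run by simp
    next
      case (10 a b) then show ?case using done_last by blast
    next
      case (11 a) then show ?case by (rule kill_arr)
    next
      case (12 a) then show ?case by (rule seg_small)
    next
      case (13 i j s)
      then show ?case using run[of i j s] run_small[of i j s] True by (auto split: if_splits)
    next
      case (14 i j s q')
      show ?case
      proof (cases "i = h")
        case True
        then show ?thesis using 14 run q y(3) by auto
      next
        case False
        then show ?thesis using 14 run later[of i j s q'] y(3) by auto
      qed
    qed
    ultimately show ?thesis using y(1) by blast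
  qed
qed

lemma launch_all_keeps:
  assumes "core m J x" "few_smaller_waiting m J x" "unfinished J x" "h \<le> m" "valid_jobs J"
  shows "core m J (launch_all m J (now x) h x) \<and> few_smaller_waiting m J (launch_all m J (now x) h x) \<and>
    unfinished J (launch_all m J (now x) h x) \<and> covered m J h (launch_all m J (now x) h x) \<and>
    now (launch_all m J (now x) h x) = now x"
  using assms(4)
proof (induction h)
  case 0
  then show ?case using assms by (simp add: covered_def)
next
  case (Suc h)
  then show ?case using launch_keeps[of m J "launch_all m J (now x) h x" h] assms by simp
qed

section \<open>A whole step of the simulation\<close>

definition good :: "nat \<Rightarrow> jobs \<Rightarrow> state \<Rightarrow> bool" where
  "good m J x \<longleftrightarrow> core m J x \<and> few_smaller_waiting m J x \<and> unfinished J x \<and> covered m J m x"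

lemma good_init: "valid_jobs J \<Longrightarrow> good m J init"
  using core_init[of J m]
  by (auto simp: good_def few_smaller_waiting_def unfinished_def covered_def init_def)

lemma finite_events: "finite (events m J x)"
proof -
  have "events m J x \<subseteq> release J ` {..<length J} \<union>
     (\<lambda>h. snd (the (run x h)) + proc J (fst (the (run x h)))) ` {..<m}"
    by (force simp: events_def)
  then show ?thesis using finite_subset by blast
qed

text \<open>Releases count as events only if they lie in the future, and pending completions do so
  by \<open>unfinished\<close>.\<close>

lemma Min_events_greater:
  assumes "good m J x" "events m J x \<noteq> {}"
  shows "now x < Min (events m J x)"
  using assms finite_events[of m J x]
  by (auto simp: good_def unfinished_def events_def)

lemma good_advance:
  assumes g: "good m J x" and t: "now x < t" and v: "valid_jobs J"
    and next_t: "\<And>h j s. run x h = Some (j, s) \<Longrightarrow> t \<le> s + proc J j"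
  shows "good m J (advance m J t x) \<and> now (advance m J t x) = t"
proof -
  have c: "core m J x" using g by (simp add: good_def)
  define y where "y = arrive J t x"
  have y: "core m J y" "now y = t" "run y = run x"
    using core_arrive[OF c t next_t] by (auto simp: y_def arrive_def)
  have fresh: "s < now y" if "run y h = Some (j, s)" for h j s
    using that core.runs[OF c, of h j s] t y by auto
  define z where "z = finish J t m y"
  have z: "core m J z" "now z = t" "unfinished J z"
    using core_finish[OF y(1) fresh] unfinished_finish[OF y(1)] y(2)
    by (auto simp: z_def finish_def stop_def)
  have fresh_z: "s < now z" if "run z h = Some (j, s)" for h j s
    using that fresh[of h j s] y z by (auto simp: z_def finish_def stop_def split: if_splits)
  define w where "w = kill m J t m z"
  have w: "core m J w" "few_smaller_waiting m J w" "unfinished J w" "now w = t"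
    using core_kill[OF z(1) fresh_z z(3)] z(2) by (auto simp: w_def kill_def stop_def)
  have "advance m J t x = launch_all m J (now w) m w"
    unfolding w(4) by (simp add: advance_def w_def z_def y_def)
  then show ?thesis using launch_all_keeps[OF w(1,2,3) _ v, of m] w(4) by (simp add: good_def)
qed

lemma good_step:
  assumes "good m J x" "valid_jobs J"
  shows "good m J (step m J x)"
    "events m J x \<noteq> {} \<Longrightarrow> now (step m J x) = Min (events m J x)"
proof -
  have "good m J (advance m J (Min (events m J x)) x) \<and> now (advance m J (Min (events m J x)) x) = Min (events m J x)"
    if e: "events m J x \<noteq> {}"
  proof (rule good_advance[OF assms(1) Min_events_greater[OF assms(1) e] assms(2)])
    fix h j s assume r: "run x h = Some (j, s)"
    then have "h < m" using assms(1) core.runs by (auto simp: good_def)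
    then show "Min (events m J x) \<le> s + proc J j"
      using r by (intro Min_le finite_events) (auto simp: events_def)
  qed
  then show "good m J (step m J x)" "events m J x \<noteq> {} \<Longrightarrow> now (step m J x) = Min (events m J x)"
    using assms by (auto simp: step_def)
qed

lemma launch_all_trace:
  "segs (launch_all m J t h x) = segs x"
  "run x i = Some (j, s) \<Longrightarrow> run (launch_all m J t h x) i = Some (j, s)"
  "run (launch_all m J t h x) i = Some (j, s) \<Longrightarrow> run x i = Some (j, s) \<or> s = t"
  by (induction h) (auto simp: launch_def split: if_splits)

text \<open>These transitions suffice later both for locating segments of the final schedule in
  intermediate states and for cutting the history at a given time.\<close>

lemma advance_trace:
  "segs x \<subseteq> segs (advance m J t x)"
  "a \<in> segs (advance m J t x) \<Longrightarrow> a \<in> segs x \<or> (fin a = t \<and> run x (machine a) = Some (job a, start a))"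
  "run x h = Some (j, s) \<Longrightarrow> run (advance m J t x) h = Some (j, s) \<or> seg_of h j s t \<in> segs (advance m J t x)"
  "run (advance m J t x) h = Some (j, s) \<Longrightarrow> run x h = Some (j, s) \<or> s = t"
  "run x h = Some (j, s) \<Longrightarrow> h < m \<Longrightarrow> s + proc J j \<le> t \<Longrightarrow> seg_of h j s t \<in> segs (advance m J t x)"
proof -
  define z where "z = finish J t m (arrive J t x)"
  define w where "w = kill m J t m z"
  have a: "advance m J t x = launch_all m J t m w" by (simp add: advance_def w_def z_def)
  have "segs z = segs x \<union> {seg_of h j s t | h j s. (h < m \<and> finishes J t x h) \<and> run x h = Some (j, s)}"
    by (simp add: z_def finish_def stop_def arrive_def finishes_def)
  moreover have "((h < m \<and> finishes J t x h) \<and> run x h = Some (j, s)) \<longleftrightarrow>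
     (h < m \<and> s + proc J j \<le> t \<and> run x h = Some (j, s))" for h j s
    by (auto simp: finishes_def)
  ultimately have z1: "segs z = segs x \<union> {seg_of h j s t | h j s. h < m \<and> s + proc J j \<le> t \<and> run x h = Some (j, s)}"
    by (simp only:)
  have z2: "run z h = (if h < m \<and> (\<exists>j s. run x h = Some (j, s) \<and> s + proc J j \<le> t) then None else run x h)" for h
    by (auto simp: z_def finish_def stop_def arrive_def finishes_def)
  have w: "segs w = segs z \<union> {seg_of h j s t | h j s. h < m \<and> hit m J t z h \<and> run z h = Some (j, s)}"
    "run w h = (if h < m \<and> hit m J t z h then None else run z h)" for h
    by (auto simp: w_def kill_def stop_def)
  show "segs x \<subseteq> segs (advance m J t x)" unfolding a launch_all_trace(1) w z1 by blast
  show "a \<in> segs (advance m J t x) \<Longrightarrow> a \<in> segs x \<or> (fin a = t \<and> run x (machine a) = Some (job a, start a))"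
    unfolding a launch_all_trace(1) w z1 by (auto simp: z2 split: if_splits)
  show "run x h = Some (j, s) \<Longrightarrow> run (advance m J t x) h = Some (j, s) \<or> seg_of h j s t \<in> segs (advance m J t x)"
  proof -
    assume r: "run x h = Some (j, s)"
    show ?thesis
    proof (cases "run w h = Some (j, s)")
      case True
      then show ?thesis unfolding a using launch_all_trace(2) by blast
    next
      case False
      have "seg_of h j s t \<in> segs w"
      proof (cases "run z h = Some (j, s)")
        case True
        then have "h < m" "hit m J t z h" using False by (auto simp: w(2) split: if_splits)
        then show ?thesis unfolding w(1) using True by blast
      next
        case False
        then have "h < m" "s + proc J j \<le> t" using r by (auto simp: z2 split: if_splits)
        then show ?thesis unfolding w(1) z1 using r by blast
      qed
      then show ?thesis unfolding a launch_all_trace(1) by blast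
    qed
  qed
  show "run (advance m J t x) h = Some (j, s) \<Longrightarrow> run x h = Some (j, s) \<or> s = t"
    unfolding a using launch_all_trace(3)[of m J t m w h j s] by (auto simp: w z2 split: if_splits)
  show "run x h = Some (j, s) \<Longrightarrow> h < m \<Longrightarrow> s + proc J j \<le> t \<Longrightarrow> seg_of h j s t \<in> segs (advance m J t x)"
    unfolding a launch_all_trace(1) w z1 by blast
qed

section \<open>Competitiveness\<close>

abbreviation states :: "nat \<Rightarrow> jobs \<Rightarrow> nat \<Rightarrow> state" where
  "states m J l \<equiv> (step m J ^^ l) init"

text \<open>Each effective step handles the release or the completion of some job, so
  \<open>2 * length J\<close> steps are enough.\<close>

definition simulate :: "nat \<Rightarrow> jobs \<Rightarrow> schedule" where
  "simulate m J = segs (states m J (2 * length J))"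

lemma good_states: "valid_jobs J \<Longrightarrow> good m J (states m J l)"
  by (induction l) (auto intro: good_init good_step)

lemma step_trace:
  assumes "events m J x \<noteq> {}" and "valid_jobs J" and "good m J x"
  shows "segs x \<subseteq> segs (step m J x)"
  "a \<in> segs (step m J x) \<Longrightarrow>
     a \<in> segs x \<or> (fin a = now (step m J x) \<and> run x (machine a) = Some (job a, start a))"
  "run x h = Some (j, s) \<Longrightarrow>
     run (step m J x) h = Some (j, s) \<or> seg_of h j s (now (step m J x)) \<in> segs (step m J x)"
  "run (step m J x) h = Some (j, s) \<Longrightarrow> run x h = Some (j, s) \<or> s = now (step m J x)"
  "run x h = Some (j, s) \<Longrightarrow> s + proc J j \<le> now (step m J x) \<Longrightarrow>
     seg_of h j s (now (step m J x)) \<in> segs (step m J x)"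
proof -
  have s: "step m J x = advance m J (Min (events m J x)) x" using assms by (simp add: step_def)
  have n: "now (step m J x) = Min (events m J x)" using good_step assms by blast
  have h: "run x h = Some (j, s) \<Longrightarrow> h < m" for h j s
    using assms(3) core.runs by (auto simp: good_def)
  show "segs x \<subseteq> segs (step m J x)"
    "a \<in> segs (step m J x) \<Longrightarrow>
     a \<in> segs x \<or> (fin a = now (step m J x) \<and> run x (machine a) = Some (job a, start a))"
    "run x h = Some (j, s) \<Longrightarrow>
     run (step m J x) h = Some (j, s) \<or> seg_of h j s (now (step m J x)) \<in> segs (step m J x)"
    "run (step m J x) h = Some (j, s) \<Longrightarrow> run x h = Some (j, s) \<or> s = now (step m J x)"
    "run x h = Some (j, s) \<Longrightarrow> s + proc J j \<le> now (step m J x) \<Longrightarrow>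
     seg_of h j s (now (step m J x)) \<in> segs (step m J x)"
    unfolding n unfolding s using advance_trace[where x = x and m = m and J = J] h by blast+
qed

section \<open>Termination of the simulation\<close>

definition completed_jobs :: "jobs \<Rightarrow> state \<Rightarrow> nat set" where
  "completed_jobs J x = {j. \<exists>a\<in>segs x. job a = j \<and> fin a - start a = proc J j}"

lemma completed_jobs_sub: "good m J x \<Longrightarrow> completed_jobs J x \<subseteq> arrived J (now x)"
  using core.segs[of m J x] by (auto simp: good_def completed_jobs_def)

text \<open>A potential raised by every effective step: the event is a release, which enlarges the
  arrived jobs, or the end of a run, which enlarges the completed ones. Kills do not lower
  it.\<close>

definition progress :: "jobs \<Rightarrow> state \<Rightarrow> nat" where
  "progress J x = card (arrived J (now x)) + card (completed_jobs J x)"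

lemma progress_le: "good m J x \<Longrightarrow> progress J x \<le> 2 * length J"
proof -
  assume "good m J x"
  then have "card (completed_jobs J x) \<le> card (arrived J (now x))"
    using completed_jobs_sub by (intro card_mono) auto
  then show ?thesis using card_arrived_le[of J "now x"] by (simp add: progress_def)
qed

lemma progress_step:
  assumes g: "good m J x" and v: "valid_jobs J" and e: "events m J x \<noteq> {}"
  shows "progress J x < progress J (step m J x)"
proof -
  let ?y = "step m J x"
  have gy: "good m J ?y" using good_step(1)[OF g v] .
  have n: "now ?y = Min (events m J x)" using good_step(2)[OF g v e] .
  have "now x < now ?y" using Min_events_greater[OF g e] n by simp
  then have A: "arrived J (now x) \<subseteq> arrived J (now ?y)" by (intro arrived_mono) simp
  have C: "completed_jobs J x \<subseteq> completed_jobs J ?y"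
    using step_trace(1)[OF e v g] by (auto simp: completed_jobs_def)
  have finC: "finite (completed_jobs J ?y)"
    using completed_jobs_sub[OF gy] finite_subset finite_arrived by blast
  have "now ?y \<in> events m J x" unfolding n using finite_events e by (rule Min_in)
  then consider (rel) j where "j < length J" "now x < release J j" "now ?y = release J j"
    | (fin) h j s where "run x h = Some (j, s)" "now ?y = s + proc J j"
    by (auto simp: events_def)
  then show ?thesis
  proof cases
    case rel
    then have "j \<in> arrived J (now ?y) - arrived J (now x)" by (auto simp: arrived_def)
    then have "card (arrived J (now x)) < card (arrived J (now ?y))" using A by (intro psubset_card_mono) auto
    then show ?thesis using card_mono[OF finC C] by (simp add: progress_def)
  next
    case fin
    have "seg_of h j s (now ?y) \<in> segs ?y" using step_trace(5)[OF e v g fin(1)] fin(2) by simp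
    then have "j \<in> completed_jobs J ?y" using fin(2)
      by (auto simp: completed_jobs_def intro!: bexI[of _ "seg_of h j s (now ?y)"])
    moreover have "j \<notin> completed_jobs J x"
      using g fin(1) core.done_gone[of m J x] by (fastforce simp: completed_jobs_def good_def)
    ultimately have "card (completed_jobs J x) < card (completed_jobs J ?y)"
      using C finC by (intro psubset_card_mono) auto
    then show ?thesis using card_mono[OF finite_arrived A] by (simp add: progress_def)
  qed
qed

lemma step_idle: "events m J x = {} \<Longrightarrow> step m J x = x"
  by (simp add: step_def)

lemma states_stable:
  assumes "events m J (states m J l) = {}" "l \<le> k"
  shows "states m J k = states m J l"
  using assms(2)
proof (induction k rule: dec_induct)
  case (step k)
  then show ?case using assms(1) by (simp add: step_idle)
qed simp

text \<open>Otherwise every step so far, and the next one, would have raised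
  \<open>progress\<close>, beyond its maximum.\<close>

lemma simulation_ends:
  assumes v: "valid_jobs J"
  shows "events m J (states m J (2 * length J)) = {}"
proof (rule ccontr)
  assume e: "events m J (states m J (2 * length J)) \<noteq> {}"
  have "l \<le> progress J (states m J l)" if "l \<le> Suc (2 * length J)" for l
    using that
  proof (induction l)
    case (Suc l)
    have "events m J (states m J l) \<noteq> {}"
      using states_stable[of m J l "2 * length J"] e Suc.prems by auto
    then have "progress J (states m J l) < progress J (states m J (Suc l))"
      using progress_step[OF good_states[OF v] v] by simp
    then show ?case using Suc by simp
  qed simp
  from this[of "Suc (2 * length J)"] show False
    using progress_le[OF good_states[OF v, of m "Suc (2 * length J)"]] by simp
qed

lemma no_events:
  assumes g: "good m J x" and e: "events m J x = {}" and m: "0 < m"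
  shows "arrived J (now x) = {..<length J}" "run x h = None" "waits x = {}"
proof -
  show "arrived J (now x) = {..<length J}"
    using e unfolding events_def arrived_def by (auto simp: not_less) (meson not_le)
  show r: "run x h = None" for h
    using e g core.runs[of m J x h] by (cases "run x h") (auto simp: events_def good_def)
  show "waits x = {}" using g r[of 0] m by (auto simp: good_def covered_def)
qed

lemma final_completed:
  assumes v: "valid_jobs J" and m: "0 < m" and j: "j < length J"
  shows "\<exists>a\<in>simulate m J. job a = j \<and> fin a - start a = proc J j"
proof -
  let ?x = "states m J (2 * length J)"
  have g: "good m J ?x" by (rule good_states[OF v])
  note n = no_events[OF g simulation_ends[OF v] m]
  show ?thesis unfolding simulate_def
    using core.accounted[of m J ?x j] g n j by (auto simp: good_def)
qed

section \<open>Feasible schedules and transfer of the flow bound\<close>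

lemma kill_restart_simulate:
  assumes v: "valid_jobs J" and m: "0 < m"
  shows "kill_restart_schedule m J (simulate m J)"
proof -
  let ?x = "states m J (2 * length J)"
  interpret core m J ?x using good_states[OF v] by (auto simp: good_def)
  show ?thesis
    unfolding kill_restart_schedule_def
  proof (intro conjI allI impI)
    show "basic_schedule m J (simulate m J)"
      unfolding basic_schedule_def simulate_def
      using fin_segs segs seg_disj by (auto simp: arrived_def)
  next
    fix j assume "j < length J"
    then obtain a where a: "a \<in> segs ?x" "job a = j" "fin a - start a = proc J j"
      using final_completed[OF v m, of j] by (auto simp: simulate_def)
    then show "\<exists>x\<in>simulate m J. job x = j \<and> fin x - start x = proc J j \<and>
        (\<forall>y\<in>simulate m J. job y = j \<and> y \<noteq> x \<longrightarrow> fin y - start y < proc J j \<and> fin y \<le> start x)"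
      unfolding simulate_def using done_last[of a] by (intro bexI[of _ a]) auto
  qed
qed

text \<open>The completed runs alone form such a schedule, with one segment per job. This makes the
  set in the definition of \<open>OPT\<close> nonempty.\<close>

lemma preemptive_exists:
  assumes v: "valid_jobs J" and m: "0 < m"
  shows "\<exists>P. preemptive_schedule m J P"
proof -
  let ?x = "states m J (2 * length J)"
  interpret core m J ?x using good_states[OF v] by (auto simp: good_def)
  define P where "P = {a \<in> segs ?x. fin a - start a = proc J (job a)}"
  have inj: "a = b" if "a \<in> P" "b \<in> P" "job a = job b" for a b
  proof (rule ccontr)
    assume "a \<noteq> b"
    then have "fin b - start b < proc J (job b)"
      using done_last[of a b] that unfolding P_def by (metis (mono_tags, lifting) mem_Collect_eq)
    then show False using that unfolding P_def by simp
  qed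
  have "preemptive_schedule m J P"
    unfolding preemptive_schedule_def
  proof (intro conjI ballI allI impI)
    have "basic_schedule m J (segs ?x)" "P \<subseteq> segs ?x"
      using kill_restart_simulate[OF v m] by (auto simp: kill_restart_schedule_def simulate_def P_def)
    then show "basic_schedule m J P"
      unfolding basic_schedule_def by (meson finite_subset subsetD)
    show "machine a = machine b" if "a \<in> P" "b \<in> P" "job a = job b" for a b
      using inj that by blast
    fix j assume "j < length J"
    then obtain a where a: "a \<in> P" "job a = j" "fin a - start a = proc J j"
      using final_completed[OF v m, of j] by (auto simp: simulate_def P_def)
    then have "{x \<in> P. job x = j} = {a}" using inj by blast
    then show "(\<Sum>x | x \<in> P \<and> job x = j. fin x - start x) = proc J j" using a by simp
  qed
  then show ?thesis by blast
qed

text \<open>Event times and queues of the simulated states instantiate \<open>online_run\<close>.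
  The work lies in matching the segments of the final schedule with the running entries of
  intermediate states.\<close>

lemma simulate_flow:
  assumes m: "2 \<le> m" and v: "valid_jobs J" and P: "preemptive_schedule m J P"
  shows "total_flow J (simulate m J) \<le>
    40000 * max 1 (real (length J) powr ((sqrt 5 - 1) / 2) / sqrt (real m)) * total_flow J P"
proof -
  have m0: "0 < m" using m by simp
  define X where "X = states m J"
  define S where "S = simulate m J"
  define M where "M = (LEAST l. events m J (X l) = {})"
  define e where "e l = now (X l)" for l
  have M: "events m J (X M) = {}"
    unfolding M_def X_def by (rule LeastI) (rule simulation_ends[OF v])
  have M_le: "M \<le> 2 * length J"
    unfolding M_def X_def by (rule Least_le) (rule simulation_ends[OF v])
  have before: "events m J (X l) \<noteq> {}" if "l < M" for l
    using that not_less_Least unfolding M_def by blast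
  have S: "S = segs (X M)"
    using states_stable[of m J M "2 * length J"] M M_le by (simp add: S_def simulate_def X_def)
  have g: "good m J (X l)" for l unfolding X_def by (rule good_states[OF v])
  have c: "core m J (X l)" for l using g by (simp add: good_def)
  have X_Suc: "X (Suc l) = step m J (X l)" for l by (simp add: X_def)
  note final = no_events[OF g M m0]
  have e_Suc: "e l < e (Suc l)" if "l < M" for l
    using Min_events_greater[OF g before[OF that]] good_step(2)[OF g v before[OF that]]
    by (simp add: e_def X_Suc)
  have e_mono: "e a \<le> e b" if "a \<le> b" "b \<le> M" for a b
    using that
  proof (induction b rule: dec_induct)
    case (step b)
    then show ?case using e_Suc[of b] by simp
  qed simp
  have trace: "segs (X l) \<subseteq> segs (X (Suc l))"
    "a \<in> segs (X (Suc l)) \<Longrightarrow> a \<in> segs (X l) \<or> (fin a = e (Suc l) \<and> run (X l) (machine a) = Some (job a, start a))"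
    "run (X l) h = Some (j, s) \<Longrightarrow> run (X (Suc l)) h = Some (j, s) \<or> seg_of h j s (e (Suc l)) \<in> segs (X (Suc l))"
    "run (X (Suc l)) h = Some (j, s) \<Longrightarrow> run (X l) h = Some (j, s) \<or> s = e (Suc l)"
    if "l < M" for l a h j s
    using step_trace[OF before[OF that] v g] by (simp_all only: X_Suc e_def)
  have segs_mono: "segs (X a) \<subseteq> segs (X b)" if "a \<le> b" "b \<le> M" for a b
    using that
  proof (induction b rule: dec_induct)
    case (step b)
    then show ?case using trace(1)[of b] by auto
  qed simp
  have fin_event: "\<exists>k\<le>l. fin a = e k" if "a \<in> segs (X l)" "l \<le> M" for a l
    using that
  proof (induction l)
    case 0
    then show ?case by (simp add: X_def init_def)
  next
    case (Suc l)
    then show ?case using trace(2)[of l a] by (meson Suc_le_lessD le_SucI le_refl less_imp_le)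
  qed
  \<comment> \<open>Induction backwards from \<open>M\<close>, where no machine runs: in each step
    the run continues or is recorded.\<close>
  have run_seg: "\<exists>a\<in>S. machine a = h \<and> job a = j \<and> start a = s \<and> e (Suc l) \<le> fin a"
    if "run (X l) h = Some (j, s)" "l < M" for l h j s
    using less_imp_le[OF that(2)] that
  proof (induction l rule: inc_induct)
    case (step l)
    show ?case
    proof (cases "run (X (Suc l)) h = Some (j, s)")
      case True
      then have "Suc l \<noteq> M" using final(2) by auto
      then have l: "Suc l < M" using step.prems by simp
      from step.IH[OF True l] e_Suc[OF l] show ?thesis by fastforce
    next
      case False
      then have "seg_of h j s (e (Suc l)) \<in> segs (X (Suc l))" using trace(3) step.prems by blast
      then have "seg_of h j s (e (Suc l)) \<in> S" using segs_mono[of "Suc l" M] step.prems S by auto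
      then show ?thesis by (intro bexI[of _ "seg_of h j s (e (Suc l))"]) auto
    qed
  qed simp
  \<comment> \<open>Going back from \<open>M\<close> to \<open>l\<close>, the segment is recorded or
    still running in every state. At \<open>l\<close> it cannot be recorded, since recorded segments
    have ended.\<close>
  have seg_run: "run (X l) (machine a) = Some (job a, start a)"
    if a: "a \<in> S" "start a \<le> e l" "e l < fin a" and l: "l < M" for a l
  proof -
    have "a \<in> segs (X k) \<or> run (X k) (machine a) = Some (job a, start a)" if "l \<le> k" "k \<le> M" for k
      using that(2,1)
    proof (induction k rule: inc_induct)
      case base
      then show ?case using a S by simp
    next
      case (step k)
      have k: "k < M" using step by simp
      have "start a \<noteq> e (Suc k)"
        using a(2) e_mono[of l k] e_Suc[OF k] step k by auto
      then show ?case using step trace(2,4)[OF k] by fastforce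
    qed
    from this[of l] have "a \<in> segs (X l) \<or> run (X l) (machine a) = Some (job a, start a)" using l by simp
    then show ?thesis using core.segs[OF c, of a l] a by (auto simp: e_def)
  qed
  define act where "act l = {a \<in> S. start a \<le> e l \<and> e (Suc l) \<le> fin a}" for l
  have act_run: "run (X l) (machine a) = Some (job a, start a)" if "a \<in> act l" "l < M" for a l
    using that seg_run[of a l] e_Suc[of l] by (auto simp: act_def)
  have run_act: "\<exists>a\<in>act l. machine a = h \<and> job a = j" if r: "run (X l) h = Some (j, s)" and l: "l < M" for l h j s
    using run_seg[OF r l] core.runs[OF c r] by (fastforce simp: act_def e_def)
  have kr: "kill_restart_schedule m J S" unfolding S_def by (rule kill_restart_simulate[OF v m0])
  interpret online_run m J S M e "\<lambda>l. waits (X l)" "\<lambda>l. {a \<in> S. start a \<le> e l \<and> e (Suc l) \<le> fin a}"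
    "{a \<in> S. fin a - start a < proc J (job a)}" "\<lambda>l. e (Suc l) - e l"
  proof (unfold_locales, goal_cases)
    case 1 show ?case by (rule m)
  next
    case 2 show ?case by (rule v)
  next
    case 3 show ?case by (rule kr)
  next
    case (4 l) then show ?case by (rule e_Suc)
  next
    case (5 j)
    \<comment> \<open>A step moves to the earliest event, so it cannot skip a release.\<close>
    have "\<exists>k\<le>l. release J j = e k" if "j \<in> arrived J (e l)" "l \<le> M" for l
      using that
    proof (induction l)
      case 0
      then show ?case using arrived_init[OF v] by (simp add: e_def X_def)
    next
      case (Suc l)
      have l: "l < M" using Suc by simp
      show ?case
      proof (cases "j \<in> arrived J (e l)")
        case True
        then show ?thesis using Suc l by (meson le_SucI less_imp_le)
      next
        case False
        then have "release J j \<in> events m J (X l)" using 5 by (auto simp: events_def arrived_def e_def)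
        then have "e (Suc l) \<le> release J j"
          using good_step(2)[OF g v before[OF l]] finite_events by (simp add: e_def X_Suc)
        then have "release J j = e (Suc l)" using Suc.prems by (auto simp: arrived_def)
        then show ?thesis by blast
      qed
    qed
    from this[of M] show ?case using final(1) 5 by (simp add: e_def)
  next
    case (6 j)
    have "completion S j \<in> fin ` {x \<in> S. job x = j}"
      unfolding completion_def
      using final_completed[OF v m0 6] kr
      by (intro Max_in) (auto simp: S_def kill_restart_schedule_def basic_schedule_def)
    then show ?case using fin_event[of _ M] S by auto
  next
    case 7 show ?case by (simp add: X_def init_def)
  next
    case (8 l j) then show ?case using core.waits[OF c] by (auto simp: arrived_def e_def)
  next
    case (9 l j a)
    show ?case
    proof (rule ccontr)
      assume "\<not> e l < start a"
      then have st: "start a \<le> e l" by simp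
      have aS: "a \<in> S" using 9 by blast
      have full: "fin a - start a = proc J (job a)"
        using 9 core.segs[OF c, of a M] S by fastforce
      \<comment> \<open>A run of full length that started by \<open>e l\<close> is either in
        progress or already recorded in state \<open>l\<close>; both keep its job out of the
        queue.\<close>
      show False
      proof (cases "e l < fin a")
        case True
        then show False using seg_run[OF aS st True 9(1)] core.runs[OF c] 9 by blast
      next
        case False
        have "a \<in> segs (X l)"
        proof -
          have "a \<in> segs (X k)" if "l \<le> k" "k \<le> M" for k
            using that(2,1)
          proof (induction k rule: inc_induct)
            case base
            then show ?case using aS S by simp
          next
            case (step k)
            have k: "k < M" using step by simp
            have "fin a \<noteq> e (Suc k)" using False e_mono[of l k] e_Suc[OF k] step k by auto
            then show ?case using step trace(2)[OF k] by auto
          qed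
          then show ?thesis using 9 by simp
        qed
        then show False using core.done_gone[OF c _ full] 9 by blast
      qed
    qed
  next
    case (10 l j)
    have j: "j \<in> arrived J (now (X l))" using 10 by (simp add: arrived_def e_def)
    show ?case
    proof (cases "j \<in> waits (X l) \<or> (\<exists>h s. run (X l) h = Some (j, s))")
      case True
      then show ?thesis using run_act[OF _ 10(1)] by (fastforce simp: act_def)
    next
      case False
      then obtain a where a: "a \<in> segs (X l)" "job a = j" "fin a - start a = proc J j"
        using core.accounted[OF c j] by blast
      have aM: "a \<in> segs (X M)" using a segs_mono[of l M] 10 by auto
      have "completion S j \<le> fin a" unfolding completion_def
      proof (rule Max.boundedI)
        show "finite (fin ` {x \<in> S. job x = j})" using core.fin_segs[OF c] S by simp
        show "fin ` {x \<in> S. job x = j} \<noteq> {}" using aM a S by auto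
        fix y assume "y \<in> fin ` {x \<in> S. job x = j}"
        then obtain b where b: "b \<in> segs (X M)" "job b = j" "y = fin b" using S by blast
        show "y \<le> fin a"
          using core.done_last[OF c aM _ b(1)] a b core.segs[OF c aM] by (cases "b = a") fastforce+
      qed
      also have "fin a \<le> e l" using core.segs[OF c a(1)] by (simp add: e_def)
      finally show ?thesis using 10 by simp
    qed
  next
    case (11 l a)
    then show ?case using act_run[of a l] g[of l] by (auto simp: good_def few_smaller_waiting_def act_def e_def)
  next
    case (12 l h)
    then have "h < m" by simp
    then have "run (X l) h \<noteq> None" using g[of l] 12 unfolding good_def covered_def by blast
    then show ?case using run_act[OF _ 12(1)] by (fastforce simp: act_def)
  next
    case (13 l q h)
    then have "run (X l) h \<noteq> None" using g[of l] by (fastforce simp: good_def covered_def small_def e_def)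
    then show ?case using run_act[OF _ 13(1)] by (fastforce simp: act_def)
  next
    case (14 l a q)
    then show ?case using act_run[of a l] core.later[OF c] by (fastforce simp: act_def)
  next
    case (15 a) then show ?case using core.kill_arr[OF c, of a M] S by auto
  next
    case (16 a) then show ?case using core.seg_small[OF c, of a M] S by (auto simp: small_def)
  qed
  show ?thesis using flow_bound[OF P] by (simp add: S_def)
qed

text \<open>The factor does not depend on the compared schedule, so dividing by it yields one lower
  bound for all flow times whose infimum is taken.\<close>

lemma competitive_simulate:
  assumes m: "2 \<le> m"
  shows "competitive m (\<lambda>n. 40000 * max 1 (real n powr ((sqrt 5 - 1) / 2) / sqrt (real m))) (simulate m)"
  unfolding competitive_def
proof (intro allI impI)
  fix J assume v: "valid_jobs J"
  define c where "c = 40000 * max 1 (real (length J) powr ((sqrt 5 - 1) / 2) / sqrt (real m))"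
  have c: "0 < c" by (simp add: c_def)
  have "total_flow J (simulate m J) / c \<le> OPT m J"
    unfolding OPT_def
  proof (rule cInf_greatest)
    show "{total_flow J S | S. preemptive_schedule m J S} \<noteq> {}"
      using preemptive_exists[OF v, of m] m by auto
    fix y assume "y \<in> {total_flow J S | S. preemptive_schedule m J S}"
    then obtain P where "preemptive_schedule m J P" "y = total_flow J P" by blast
    then show "total_flow J (simulate m J) / c \<le> y"
      using simulate_flow[OF m v] c by (simp add: c_def divide_le_eq mult.commute)
  qed
  then show "total_flow J (simulate m J) \<le> 40000 * max 1 (real (length J) powr ((sqrt 5 - 1) / 2) / sqrt (real m)) * OPT m J"
    using c by (simp add: c_def[symmetric] divide_le_eq mult.commute)
qed

section \<open>Non-anticipation\<close>

text \<open>By sortedness the released jobs form a prefix, so equal released lists give the same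
  names to the same jobs.\<close>

lemma released_take:
  assumes "sorted (map fst J)"
  shows "\<exists>k\<le>length J. released t J = take k J \<and> arrived J t = {..<k}"
  using assms
proof (induction J)
  case Nil
  then show ?case by (simp add: released_def arrived_def)
next
  case (Cons a J)
  obtain k where k: "k \<le> length J" "released t J = take k J" "arrived J t = {..<k}"
    using Cons by auto
  show ?case
  proof (cases "fst a \<le> t")
    case True
    have "j \<in> arrived (a # J) t \<longleftrightarrow> j < Suc k" for j
      using True k(3) by (cases j) (auto simp: arrived_def set_eq_iff)
    then have "arrived (a # J) t = {..<Suc k}" by blast
    moreover have "released t (a # J) = take (Suc k) (a # J)"
      using True k(2) by (cases a) (simp add: released_def)
    ultimately show ?thesis using k(1) by (intro exI[of _ "Suc k"]) simp
  next
    case False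
    have "\<not> release (a # J) j \<le> t" if "j < length (a # J)" for j
      using that False Cons.prems by (cases j) (auto simp: order_trans[of "fst a"] dest!: nth_mem)
    then have "arrived (a # J) t = {}" by (auto simp: arrived_def)
    moreover have "released t (a # J) = []"
      using False Cons.prems by (fastforce simp: released_def filter_empty_conv)
    ultimately show ?thesis by (intro exI[of _ 0]) simp
  qed
qed

lemma released_agree:
  assumes "valid_jobs J" "valid_jobs J'" "released t J = released t J'"
  shows "arrived J t = arrived J' t" "\<And>j. j \<in> arrived J t \<Longrightarrow> J ! j = J' ! j"
proof -
  obtain k where k: "k \<le> length J" "released t J = take k J" "arrived J t = {..<k}"
    using released_take[of J t] assms(1) unfolding valid_jobs_def by blast
  obtain k' where k': "k' \<le> length J'" "released t J' = take k' J'" "arrived J' t = {..<k'}"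
    using released_take[of J' t] assms(2) unfolding valid_jobs_def by blast
  have eq: "take k J = take k' J'" using assms(3) k k' by simp
  then have "k = k'" using k(1) k'(1) by (metis length_take min.absorb2)
  then show "arrived J t = arrived J' t" using k k' by simp
  show "J ! j = J' ! j" if "j \<in> arrived J t" for j
    using that eq k(3) \<open>k = k'\<close> by (metis lessThan_iff nth_take)
qed

section \<open>Steps on two instances that agree up to a time\<close>

locale agreeing =
  fixes J J' :: jobs and t :: real
  assumes arrived_eq: "arrived J t = arrived J' t"
    and nth_eq: "j \<in> arrived J t \<Longrightarrow> J ! j = J' ! j"
begin

lemma arrived_cong:
  assumes "t' \<le> t" shows "arrived J t' = arrived J' t'"
proof -
  have "arrived J t' = {j \<in> arrived J t. release J j \<le> t'}" using assms by (auto simp: arrived_def)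
  also have "\<dots> = {j \<in> arrived J t. release J' j \<le> t'}" using nth_eq by auto
  also have "\<dots> = arrived J' t'" unfolding arrived_eq using assms by (auto simp: arrived_def)
  finally show ?thesis .
qed

lemma volume_cong: "t' \<le> t \<Longrightarrow> volume J t' = volume J' t'"
  unfolding volume_def using arrived_cong arrived_mono[of t' t J] nth_eq
  by (intro sum.cong) auto

lemma prec_cong: "i \<in> arrived J t \<Longrightarrow> j \<in> arrived J t \<Longrightarrow> prec J i j = prec J' i j"
  using nth_eq by (simp add: prec_def)

text \<open>The state mentions only jobs on which the instances agree, so every quantity read by a
  phase is the same for both.\<close>

definition jobs_known :: "state \<Rightarrow> bool" where
  "jobs_known x \<longleftrightarrow> waits x \<subseteq> arrived J t \<and> (\<forall>h j s. run x h = Some (j, s) \<longrightarrow> j \<in> arrived J t)"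

lemma smallest_cong: "A \<subseteq> arrived J t \<Longrightarrow> smallest J A = smallest J' A"
proof -
  assume "A \<subseteq> arrived J t"
  then have "(q \<in> A \<and> (\<forall>i\<in>A. \<not> prec J i q)) = (q \<in> A \<and> (\<forall>i\<in>A. \<not> prec J' i q))" for q
    using prec_cong by blast
  then show ?thesis unfolding smallest_def by simp
qed

lemma finish_cong: "jobs_known x \<Longrightarrow> finish J t' H x = finish J' t' H x"
proof -
  assume "jobs_known x"
  then have "finishes J t' x h = finishes J' t' x h" for h
    using nth_eq unfolding finishes_def jobs_known_def by metis
  then show ?thesis unfolding finish_def by simp
qed

lemma finish_known: "jobs_known x \<Longrightarrow> jobs_known (finish J t' H x)"
  by (auto simp: jobs_known_def finish_def stop_def)

lemma kill_cong: "t' \<le> t \<Longrightarrow> jobs_known x \<Longrightarrow> kill m J t' H x = kill m J' t' H x"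
proof -
  assume t: "t' \<le> t" and x: "jobs_known x"
  have "{q \<in> waits x. prec J q j} = {q \<in> waits x. prec J' q j}" if "run x h = Some (j, s)" for h j s
    using that x prec_cong unfolding jobs_known_def by blast
  then have "hit m J t' x h = hit m J' t' x h" for h
    by (cases "run x h") (auto simp: hit_def arrived_cong[OF t])
  then show ?thesis unfolding kill_def by simp
qed

lemma kill_known: "jobs_known x \<Longrightarrow> jobs_known (kill m J t' H x)"
  by (auto simp: jobs_known_def kill_def stop_def)

lemma launch_cong:
  "t' \<le> t \<Longrightarrow> jobs_known x \<Longrightarrow> launch m J t' h x = launch m J' t' h x \<and> jobs_known (launch m J t' h x)"
proof -
  assume t: "t' \<le> t" and x: "jobs_known x"
  have fin: "finite (waits x)" using x finite_subset[OF _ finite_arrived] by (auto simp: jobs_known_def)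
  have "smallest J (waits x) = smallest J' (waits x)" using x by (intro smallest_cong) (simp add: jobs_known_def)
  moreover have "smallest J (waits x) \<in> arrived J t" if "waits x \<noteq> {}"
    using smallest(1)[OF fin that] x by (auto simp: jobs_known_def)
  moreover have "small m J t' j = small m J' t' j" if "j \<in> arrived J t" for j
    using nth_eq[OF that] arrived_cong[OF t] volume_cong[OF t] by (simp add: small_def)
  ultimately show ?thesis using x by (auto simp: launch_def jobs_known_def)
qed

lemma launch_all_cong:
  "t' \<le> t \<Longrightarrow> jobs_known x \<Longrightarrow>
     launch_all m J t' h x = launch_all m J' t' h x \<and> jobs_known (launch_all m J t' h x)"
proof (induction h)
  case (Suc h)
  then have IH: "launch_all m J t' h x = launch_all m J' t' h x" "jobs_known (launch_all m J t' h x)" by auto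
  show ?case
    using launch_cong[OF Suc.prems(1) IH(2), of m h] IH(1) unfolding launch_all.simps by metis
qed simp

lemma advance_cong:
  assumes "now x \<le> t'" "t' \<le> t" "jobs_known x"
  shows "advance m J t' x = advance m J' t' x \<and> jobs_known (advance m J t' x)"
proof -
  have y: "arrive J t' x = arrive J' t' x"
    using arrived_cong[of t'] arrived_cong[of "now x"] assms by (simp add: arrive_def)
  have ky: "jobs_known (arrive J t' x)"
    using assms arrived_mono[of t' t J] by (auto simp: jobs_known_def arrive_def)
  define z where "z = finish J t' m (arrive J t' x)"
  have z: "z = finish J' t' m (arrive J' t' x)" "jobs_known z"
    unfolding z_def using finish_cong[OF ky] finish_known[OF ky] y by metis+
  define w where "w = kill m J t' m z"
  have w: "w = kill m J' t' m z" "jobs_known w"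
    unfolding w_def using kill_cong[OF assms(2) z(2)] kill_known[OF z(2)] by metis+
  have "advance m J t' x = launch_all m J t' m w" by (simp add: advance_def w_def z_def)
  moreover have "advance m J' t' x = launch_all m J' t' m w" using w(1) z(1) by (simp add: advance_def)
  ultimately show ?thesis using launch_all_cong[OF assms(2) w(2)] by metis
qed

text \<open>Later releases may differ, but all running jobs are known, and releases up to
  \<open>t\<close> belong to known jobs.\<close>

lemma events_cong:
  assumes "jobs_known x"
  shows "{ev \<in> events m J x. ev \<le> t} = {ev \<in> events m J' x. ev \<le> t}"
proof -
  have run: "s + proc J j = s + proc J' j" if "run x h = Some (j, s)" for h j s
    using assms that nth_eq unfolding jobs_known_def by metis
  have "{release J j | j. j < length J \<and> now x < release J j \<and> release J j \<le> t}
     = {release J j | j. j \<in> arrived J t \<and> now x < release J j}" by (auto simp: arrived_def)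
  also have "\<dots> = {release J' j | j. j \<in> arrived J' t \<and> now x < release J' j}"
    using nth_eq arrived_eq by (metis (no_types, opaque_lifting))
  also have "\<dots> = {release J' j | j. j < length J' \<and> now x < release J' j \<and> release J' j \<le> t}"
    by (auto simp: arrived_def)
  finally have r: "{release J j | j. j < length J \<and> now x < release J j \<and> release J j \<le> t}
     = {release J' j | j. j < length J' \<and> now x < release J' j \<and> release J' j \<le> t}" .
  have c: "{s + proc J j | h j s. h < m \<and> run x h = Some (j, s) \<and> s + proc J j \<le> t}
     = {s + proc J' j | h j s. h < m \<and> run x h = Some (j, s) \<and> s + proc J' j \<le> t}"
    using run by (metis (no_types, opaque_lifting))
  have split: "{ev \<in> events m K x. ev \<le> t}
     = {release K j | j. j < length K \<and> now x < release K j \<and> release K j \<le> t} \<union>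
       {s + proc K j | h j s. h < m \<and> run x h = Some (j, s) \<and> s + proc K j \<le> t}" for K
    by (auto simp: events_def)
  show ?thesis unfolding split r c ..
qed

end

text \<open>The history up to time \<open>t\<close>, read off a state that may be later than \<open>t\<close>.\<close>

definition trace :: "real \<Rightarrow> state \<Rightarrow> schedule" where
  "trace t x = history t (segs x) \<union> {seg_of h j s t | h j s. run x h = Some (j, s) \<and> s \<le> t}"

text \<open>A segment that ends after \<open>t\<close> is cut back to \<open>t\<close>, which is
  exactly what a run still in progress contributes. Runs started by the step begin after
  \<open>t\<close>.\<close>

lemma trace_step:
  assumes e: "events m J x \<noteq> {}" and v: "valid_jobs J" and g: "good m J x" and t: "t < now (step m J x)"
  shows "trace t (step m J x) = trace t x"
proof -
  note tr = step_trace[OF e v g]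
  let ?y = "step m J x"
  let ?cut = "\<lambda>a::segment. a\<lparr>fin := min (fin a) t\<rparr>"
  have cut: "?cut a = seg_of (machine a) (job a) (start a) t" if "fin a = now ?y" for a
    using that t by (cases a) (simp add: seg_of_def)
  show ?thesis
  proof (intro equalityI subsetI)
    fix b assume "b \<in> trace t ?y"
    then consider a where "a \<in> segs ?y" "start a \<le> t" "b = ?cut a"
      | h j s where "run ?y h = Some (j, s)" "s \<le> t" "b = seg_of h j s t"
      by (auto simp: trace_def history_def)
    then show "b \<in> trace t x"
    proof cases
      case 1
      then show ?thesis using tr(2)[OF 1(1)] cut[of a] by (auto simp: trace_def history_def)
    next
      case 2
      then have "run x h = Some (j, s)" using tr(4)[OF 2(1)] t by auto
      then show ?thesis using 2 by (auto simp: trace_def)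
    qed
  next
    fix b assume "b \<in> trace t x"
    then consider a where "a \<in> segs x" "start a \<le> t" "b = ?cut a"
      | h j s where "run x h = Some (j, s)" "s \<le> t" "b = seg_of h j s t"
      by (auto simp: trace_def history_def)
    then show "b \<in> trace t ?y"
    proof cases
      case 1
      then show ?thesis using tr(1) by (auto simp: trace_def history_def)
    next
      case 2
      from tr(3)[OF 2(1)] show ?thesis
      proof
        assume "seg_of h j s (now ?y) \<in> segs ?y"
        then have "?cut (seg_of h j s (now ?y)) \<in> history t (segs ?y)"
          using 2 unfolding history_def by (intro imageI) simp
        then show ?thesis using cut[of "seg_of h j s (now ?y)"] 2 by (simp add: trace_def)
      qed (use 2 in \<open>auto simp: trace_def\<close>)
    qed
  qed
qed

lemma trace_stable:
  assumes v: "valid_jobs J" and late: "\<And>ev. ev \<in> events m J (states m J l) \<Longrightarrow> t < ev" and l: "l \<le> k"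
  shows "trace t (states m J k) = trace t (states m J l)"
proof -
  have "trace t (states m J k) = trace t (states m J l) \<and> (\<forall>ev\<in>events m J (states m J k). t < ev)"
    using l
  proof (induction k rule: dec_induct)
    case base
    then show ?case using late by blast
  next
    case (step k)
    let ?x = "states m J k"
    have g: "good m J ?x" by (rule good_states[OF v])
    show ?case
    proof (cases "events m J ?x = {}")
      case True
      then show ?thesis using step by (simp add: step_idle)
    next
      case False
      have n: "now (step m J ?x) = Min (events m J ?x)" using good_step(2)[OF g v False] .
      have "Min (events m J ?x) \<in> events m J ?x" using finite_events False by (rule Min_in)
      then have t: "t < now (step m J ?x)" using step n by auto
      have "t < ev" if "ev \<in> events m J (step m J ?x)" for ev
      proof -
        have "events m J (step m J ?x) \<noteq> {}" using that by blast
        then have "now (step m J ?x) < Min (events m J (step m J ?x))"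
          by (rule Min_events_greater[OF good_step(1)[OF g v]])
        also have "\<dots> \<le> ev" using that finite_events by (intro Min_le)
        finally show ?thesis using t by simp
      qed
      then show ?thesis using trace_step[OF False v g t] step by simp
    qed
  qed
  then show ?thesis ..
qed

lemma trace_final:
  assumes v: "valid_jobs J" and m: "0 < m" and k: "2 * length J \<le> k"
  shows "trace t (states m J k) = history t (simulate m J)"
proof -
  have "states m J k = states m J (2 * length J)"
    using states_stable[OF simulation_ends[OF v] k] .
  moreover have "run (states m J (2 * length J)) h = None" for h
    by (rule no_events(2)[OF good_states[OF v] simulation_ends[OF v] m])
  ultimately show ?thesis by (simp add: trace_def simulate_def)
qed

text \<open>Both simulations pass through the same states until all remaining events lie after
  \<open>t\<close>. From then on they may diverge and take different numbers of steps, but the trace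
  up to \<open>t\<close> is frozen.\<close>

lemma non_anticipating_simulate:
  assumes m: "0 < m"
  shows "non_anticipating (simulate m)"
  unfolding non_anticipating_def
proof (intro allI impI)
  fix J J' t assume "valid_jobs J \<and> valid_jobs J' \<and> released t J = released t J'"
  then have v: "valid_jobs J" and v': "valid_jobs J'" and r: "released t J = released t J'" by auto
  interpret agreeing J J' t
    by unfold_locales (use released_agree[OF v v' r] in auto)
  let ?X = "states m J" and ?X' = "states m J'"
  define late where "late l \<longleftrightarrow> (\<forall>ev\<in>events m J (?X l). t < ev)" for l
  define N where "N = (LEAST l. late l)"
  have ends: "late (2 * length J)" using simulation_ends[OF v] by (simp add: late_def)
  have N: "late N" "N \<le> 2 * length J"
    unfolding N_def by (rule LeastI, rule ends) (rule Least_le, rule ends)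
  have early: "\<not> late l" if "l < N" for l using that not_less_Least unfolding N_def by blast
  have same: "?X l = ?X' l \<and> jobs_known (?X l)" if "l \<le> N" for l
    using that
  proof (induction l)
    case 0
    then show ?case by (simp add: jobs_known_def init_def)
  next
    case (Suc l)
    let ?x = "?X l"
    have x: "?x = ?X' l" "jobs_known ?x" using Suc by auto
    have g: "good m J ?x" by (rule good_states[OF v])
    obtain ev where ev: "ev \<in> events m J ?x" "ev \<le> t" using early[of l] Suc.prems by (auto simp: late_def)
    then have ne: "events m J ?x \<noteq> {}" by blast
    define t' where "t' = Min (events m J ?x)"
    have t': "t' \<in> events m J ?x" "t' \<le> t"
      unfolding t'_def using Min_in[OF finite_events ne] Min_le[OF finite_events ev(1)] ev(2) by auto
    have t'': "t' \<in> events m J' ?x" using events_cong[OF x(2), of m] t' by blast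
    have "t' \<le> b" if "b \<in> events m J' ?x" for b
    proof (cases "b \<le> t")
      case True
      then have "b \<in> events m J ?x" using events_cong[OF x(2), of m] that by blast
      then show ?thesis unfolding t'_def using finite_events by (intro Min_le)
    qed (use t' in simp)
    then have "Min (events m J' ?x) = t'" using t'' finite_events by (intro Min_eqI)
    then have "step m J' ?x = advance m J' t' ?x" using t'' by (auto simp: step_def)
    moreover have "step m J ?x = advance m J t' ?x" using ne by (simp add: step_def t'_def)
    moreover have "now ?x \<le> t'" unfolding t'_def using Min_events_greater[OF g ne] by simp
    ultimately have "step m J ?x = step m J' ?x \<and> jobs_known (step m J ?x)"
      using advance_cong[OF _ t'(2) x(2), of m] by metis
    then show ?case unfolding funpow.simps(2) comp_apply x(1)[symmetric] .
  qed
  have XN: "?X N = ?X' N" "jobs_known (?X N)" using same[of N] by blast+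
  have late': "t < ev" if "ev \<in> events m J' (?X' N)" for ev
    using that XN events_cong[OF XN(2), of m] N(1) by (force simp: late_def)
  define K where "K = max N (max (2 * length J) (2 * length J'))"
  have K: "N \<le> K" "2 * length J \<le> K" "2 * length J' \<le> K" by (auto simp: K_def)
  have "history t (simulate m J) = trace t (?X K)" using trace_final[OF v m K(2)] by simp
  also have "\<dots> = trace t (?X N)" using N(1) K(1) by (intro trace_stable[OF v]) (auto simp: late_def)
  also have "\<dots> = trace t (?X' N)" using XN by simp
  also have "\<dots> = trace t (?X' K)" using late' K(1) by (intro trace_stable[OF v', symmetric]) auto
  also have "\<dots> = history t (simulate m J')" by (rule trace_final[OF v' m K(3)])
  finally show "history t (simulate m J) = history t (simulate m J')" .
qed

lemma online_simulate: "0 < m \<Longrightarrow> online_kill_restart_algorithm m (simulate m)"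
  by (simp add: online_kill_restart_algorithm_def non_anticipating_simulate kill_restart_simulate)

section \<open>Programs with bounded loops\<close>

text \<open>Every loop has a bound fixed on entry. This gives programs a total functional semantics
  and makes the running time a matter of program structure.\<close>

datatype prog =
    SetN vname nexp nexp
  | SetR vname nexp rexp
  | Then prog prog (infixr ";;" 60)
  | When bexp prog
  | For vname nexp prog

abbreviation nvar :: "vname \<Rightarrow> nexp" where "nvar v \<equiv> NArr v (NConst 0)"
abbreviation rvar :: "vname \<Rightarrow> rexp" where "rvar v \<equiv> RArr v (NConst 0)"

primrec compile :: "prog \<Rightarrow> com" where
  "compile (SetN a i e) = NAssign a i e"
| "compile (SetR a i e) = RAssign a i e"
| "compile (p ;; q) = Seq (compile p) (compile q)"
| "compile (When b p) = Cond b (compile p) Skip"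
| "compile (For v b p) = Seq (NAssign v (NConst 0) (NConst 0))
     (While (NLess (nvar v) b) (Seq (compile p) (NAssign v (NConst 0) (NAdd (nvar v) (NConst 1)))))"

primrec den :: "prog \<Rightarrow> store \<Rightarrow> store" where
  "den (SetN a i e) s = nupdate a (nval i s) (nval e s) s"
| "den (SetR a i e) s = rupdate a (nval i s) (rval e s) s"
| "den (p ;; q) s = den q (den p s)"
| "den (When b p) s = (if bval b s then den p s else s)"
| "den (For v b p) s =
     ((\<lambda>s. nupdate v 0 (Suc (nmem s v 0)) (den p s)) ^^ nval b s) (nupdate v 0 0 s)"

primrec nwrites :: "prog \<Rightarrow> vname set" where
  "nwrites (SetN a i e) = {a}"
| "nwrites (SetR a i e) = {}"
| "nwrites (p ;; q) = nwrites p \<union> nwrites q"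
| "nwrites (When b p) = nwrites p"
| "nwrites (For v b p) = insert v (nwrites p)"

primrec rwrites :: "prog \<Rightarrow> vname set" where
  "rwrites (SetN a i e) = {}"
| "rwrites (SetR a i e) = {a}"
| "rwrites (p ;; q) = rwrites p \<union> rwrites q"
| "rwrites (When b p) = rwrites p"
| "rwrites (For v b p) = rwrites p"

text \<open>Loop bounds depend on the input size alone. As \<open>''n''\<close> and
  \<open>''m''\<close> are never written, a loop multiplies the time by a factor linear in that
  size.\<close>

definition size_exps :: "nexp set" where
  "size_exps = {nvar ''n'', nvar ''m'', NAdd (nvar ''n'') (nvar ''n''), NAdd (nvar ''n'') (nvar ''m'')}"

primrec bounded_loops :: "prog \<Rightarrow> bool" where
  "bounded_loops (SetN a i e) \<longleftrightarrow> a \<noteq> ''n'' \<and> a \<noteq> ''m''"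
| "bounded_loops (SetR a i e) \<longleftrightarrow> True"
| "bounded_loops (p ;; q) \<longleftrightarrow> bounded_loops p \<and> bounded_loops q"
| "bounded_loops (When b p) \<longleftrightarrow> bounded_loops p"
| "bounded_loops (For v b p) \<longleftrightarrow>
     bounded_loops p \<and> v \<notin> nwrites p \<and> v \<noteq> ''n'' \<and> v \<noteq> ''m'' \<and> b \<in> size_exps"

lemma nmem_nupdate [simp]: "nmem (nupdate a i v s) = (nmem s)(a := (nmem s a)(i := v))"
  by (simp add: nupdate_def)
lemma rmem_nupdate [simp]: "rmem (nupdate a i v s) = rmem s"
  by (simp add: nupdate_def)
lemma nmem_rupdate [simp]: "nmem (rupdate a i v s) = nmem s"
  by (simp add: rupdate_def)
lemma rmem_rupdate [simp]: "rmem (rupdate a i v s) = (rmem s)(a := (rmem s a)(i := v))"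
  by (simp add: rupdate_def)

lemma den_nframe: "a \<notin> nwrites p \<Longrightarrow> nmem (den p s) a = nmem s a"
proof (induction p arbitrary: s)
  case (For v b p)
  have "nmem (((\<lambda>s. nupdate v 0 (Suc (nmem s v 0)) (den p s)) ^^ k) s') a = nmem s' a" for k s'
    using For by (induction k) auto
  then show ?case using For.prems by simp
qed auto

lemma den_rframe: "a \<notin> rwrites p \<Longrightarrow> rmem (den p s) a = rmem s a"
proof (induction p arbitrary: s)
  case (For v b p)
  have "rmem (((\<lambda>s. nupdate v 0 (Suc (nmem s v 0)) (den p s)) ^^ k) s') a = rmem s' a" for k s'
    using For by (induction k) auto
  then show ?case using For.prems by simp
qed auto

lemma bounded_loops_writes: "bounded_loops p \<Longrightarrow> ''n'' \<notin> nwrites p \<and> ''m'' \<notin> nwrites p"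
  by (induction p) auto

section \<open>Running time of compiled programs\<close>

definition store_size :: "store \<Rightarrow> nat" where
  "store_size s = nmem s ''n'' 0 + nmem s ''m'' 0"

text \<open>\<open>k\<close> is the number of remaining iterations. Each costs the body, one step
  for the counter and one for the test; the final failing test costs 1.\<close>

lemma while_exec:
  assumes body: "\<And>s'. nmem s' ''n'' = n \<Longrightarrow> nmem s' ''m'' = m \<Longrightarrow>
      \<exists>T. exec (compile p) s' T (den p s') \<and> T \<le> B"
    and p: "bounded_loops (For v b p)"
    and N: "\<And>s'. nmem s' ''n'' = n \<Longrightarrow> nmem s' ''m'' = m \<Longrightarrow> nval b s' = N"
    and s: "nmem s ''n'' = n" "nmem s ''m'' = m" "nmem s v 0 + k = N"
  shows "\<exists>T. exec (While (NLess (nvar v) b) (Seq (compile p) (NAssign v (NConst 0) (NAdd (nvar v) (NConst 1)))))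
     s T (((\<lambda>s. nupdate v 0 (Suc (nmem s v 0)) (den p s)) ^^ k) s) \<and> T \<le> k * (B + 2) + 1"
  using s
proof (induction k arbitrary: s)
  case 0
  then have "\<not> bval (NLess (nvar v) b) s" using N by simp
  then show ?case by (auto intro!: exI[of _ 1] exec.WhileFalse)
next
  case (Suc k)
  obtain T1 where T1: "exec (compile p) s T1 (den p s)" "T1 \<le> B" using body Suc.prems by blast
  let ?s = "nupdate v 0 (Suc (nmem s v 0)) (den p s)"
  have v: "nmem (den p s) v = nmem s v" using p by (simp add: den_nframe)
  have "exec (NAssign v (NConst 0) (NAdd (nvar v) (NConst 1))) (den p s) 1
     (nupdate v (nval (NConst 0) (den p s)) (nval (NAdd (nvar v) (NConst 1)) (den p s)) (den p s))"
    by (rule exec.NAssign)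
  then have "exec (NAssign v (NConst 0) (NAdd (nvar v) (NConst 1))) (den p s) 1 ?s"
    using v by simp
  then have b: "exec (Seq (compile p) (NAssign v (NConst 0) (NAdd (nvar v) (NConst 1)))) s (T1 + 1) ?s"
    using T1(1) by (rule exec.Seq[rotated])
  have "nmem ?s ''n'' = n" "nmem ?s ''m'' = m" "nmem ?s v 0 + k = N"
    using Suc.prems p bounded_loops_writes[of p] by (auto simp: den_nframe)
  from Suc.IH[OF this] obtain T2 where
    T2: "exec (While (NLess (nvar v) b) (Seq (compile p) (NAssign v (NConst 0) (NAdd (nvar v) (NConst 1)))))
     ?s T2 (((\<lambda>s. nupdate v 0 (Suc (nmem s v 0)) (den p s)) ^^ k) ?s)" "T2 \<le> k * (B + 2) + 1" by blast
  have "bval (NLess (nvar v) b) s" using N[OF Suc.prems(1,2)] Suc.prems(3) by simp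
  from exec.WhileTrue[OF this b T2(1)] show ?case
    using T1(2) T2(2) by (auto simp: funpow_Suc_right simp del: funpow.simps intro!: exI)
qed

lemma size_exps_eq:
  assumes "b \<in> size_exps" "nmem s' ''n'' = nmem s ''n''" "nmem s' ''m'' = nmem s ''m''"
  shows "nval b s' = nval b s" "nval b s \<le> 2 * store_size s"
  using assms by (auto simp: size_exps_def store_size_def)

text \<open>Structural induction: times of consecutive programs add, and a loop raises the degree by
  one, because \<open>store_size\<close> never changes.\<close>

lemma compile_time:
  assumes "bounded_loops p"
  shows "\<exists>C d. \<forall>s. \<exists>T. exec (compile p) s T (den p s) \<and> T \<le> C * (store_size s + 1) ^ d"
  using assms
proof (induction p)
  case (SetN a i e)
  then show ?case by (intro exI[of _ 1] exI[of _ 0]) (auto intro: exec.NAssign)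
next
  case (SetR a i e)
  then show ?case by (intro exI[of _ 1] exI[of _ 0]) (auto intro: exec.RAssign)
next
  case (Then p q)
  obtain C d where p: "\<And>s. \<exists>T. exec (compile p) s T (den p s) \<and> T \<le> C * (store_size s + 1) ^ d"
    using Then by fastforce
  obtain C' d' where q: "\<And>s. \<exists>T. exec (compile q) s T (den q s) \<and> T \<le> C' * (store_size s + 1) ^ d'"
    using Then by fastforce
  have "\<exists>T. exec (compile (p ;; q)) s T (den (p ;; q) s) \<and> T \<le> (C + C') * (store_size s + 1) ^ (d + d')" for s
  proof -
    let ?z = "store_size s + 1"
    obtain T where T: "exec (compile p) s T (den p s)" "T \<le> C * ?z ^ d" using p by blast
    obtain T' where T': "exec (compile q) (den p s) T' (den q (den p s))"
      "T' \<le> C' * (store_size (den p s) + 1) ^ d'" using q by blast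
    have "store_size (den p s) = store_size s"
      using Then.prems bounded_loops_writes[of p] by (simp add: store_size_def den_nframe)
    then have "T + T' \<le> C * ?z ^ d + C' * ?z ^ d'" using T T' by simp
    also have "\<dots> \<le> C * ?z ^ (d + d') + C' * ?z ^ (d + d')"
      by (intro add_mono mult_left_mono power_increasing) auto
    finally show ?thesis using exec.Seq[OF T(1) T'(1)] by (auto simp: algebra_simps)
  qed
  then show ?case by blast
next
  case (When b p)
  obtain C d where p: "\<And>s. \<exists>T. exec (compile p) s T (den p s) \<and> T \<le> C * (store_size s + 1) ^ d"
    using When by fastforce
  have "\<exists>T. exec (compile (When b p)) s T (den (When b p) s) \<and> T \<le> (C + 2) * (store_size s + 1) ^ d" for s
  proof -
    define z where "z = (store_size s + 1) ^ d"
    have z: "1 \<le> z" unfolding z_def by (rule one_le_power) simp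
    show ?thesis
    proof (cases "bval b s")
      case True
      obtain T where T: "exec (compile p) s T (den p s)" "T \<le> C * z" using p z_def by blast
      have "Suc T \<le> (C + 2) * z" using T(2) z by (simp add: algebra_simps)
      then have "Suc T \<le> (C + 2) * (store_size s + 1) ^ d" unfolding z_def .
      then show ?thesis using exec.CondTrue[OF True T(1)] True by auto
    next
      case False
      have "Suc 1 \<le> (C + 2) * z" using z by (simp add: algebra_simps)
      then have "Suc 1 \<le> (C + 2) * (store_size s + 1) ^ d" unfolding z_def .
      then show ?thesis using exec.CondFalse[OF False exec.Skip] False by auto
    qed
  qed
  then show ?case by blast
next
  case (For v b p)
  obtain C d where p: "\<And>s. \<exists>T. exec (compile p) s T (den p s) \<and> T \<le> C * (store_size s + 1) ^ d"
    using For by fastforce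
  have "\<exists>T. exec (compile (For v b p)) s T (den (For v b p) s) \<and> T \<le> (2 * C + 6) * (store_size s + 1) ^ (d + 1)" for s
  proof -
    let ?z = "store_size s + 1"
    let ?B = "C * ?z ^ d"
    let ?s = "nupdate v 0 0 s"
    have vb: "b \<in> size_exps" "v \<noteq> ''n''" "v \<noteq> ''m''" using For.prems by auto
    have "\<exists>T. exec (While (NLess (nvar v) b) (Seq (compile p) (NAssign v (NConst 0) (NAdd (nvar v) (NConst 1)))))
       ?s T (((\<lambda>s. nupdate v 0 (Suc (nmem s v 0)) (den p s)) ^^ nval b s) ?s) \<and> T \<le> nval b s * (?B + 2) + 1"
    proof (rule while_exec[OF _ For.prems])
      fix s' :: store assume "nmem s' ''n'' = nmem s ''n''" "nmem s' ''m'' = nmem s ''m''"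
      then show "\<exists>T. exec (compile p) s' T (den p s') \<and> T \<le> ?B" "nval b s' = nval b s"
        using p[of s'] size_exps_eq(1)[OF vb(1), of s' s] by (auto simp: store_size_def)
    qed (use vb in auto)
    then obtain T where T: "exec (While (NLess (nvar v) b) (Seq (compile p) (NAssign v (NConst 0) (NAdd (nvar v) (NConst 1)))))
       ?s T (den (For v b p) s)" "T \<le> nval b s * (?B + 2) + 1" by auto
    have "exec (NAssign v (NConst 0) (NConst 0)) s 1 (nupdate v (nval (NConst 0) s) (nval (NConst 0) s) s)"
      by (rule exec.NAssign)
    then have e: "exec (compile (For v b p)) s (1 + T) (den (For v b p) s)"
      using exec.Seq[OF _ T(1), of "NAssign v (NConst 0) (NConst 0)" s 1] by simp
    have z: "1 \<le> ?z ^ d" by (rule one_le_power) simp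
    have "1 + T \<le> 2 * ?z * (?B + 2) + 2"
      using T(2) mult_right_mono[of "nval b s" "2 * ?z" "?B + 2"] size_exps_eq(2)[OF vb(1), of s s] by simp
    also have "\<dots> \<le> 2 * ?z * (C * ?z ^ d + 2 * ?z ^ d) + 2 * (?z * ?z ^ d)"
    proof (intro add_mono mult_left_mono)
      show "2 \<le> 2 * (?z * ?z ^ d)" using mult_le_mono[of 1 ?z 1 "?z ^ d"] z by simp
      show "2 \<le> 2 * ?z ^ d" using z by simp
    qed auto
    also have "\<dots> = (2 * C + 6) * ?z ^ (d + 1)" by (simp add: algebra_simps)
    finally show ?thesis using e by blast
  qed
  then show ?case by blast
qed

lemma polynomial_time_compile:
  assumes p: "bounded_loops p"
    and A: "\<And>m J. valid_jobs J \<Longrightarrow> output_schedule (den p (input_store m J)) = A m J"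
  shows "polynomial_time A"
proof -
  obtain C d where C: "\<And>s. \<exists>T. exec (compile p) s T (den p s) \<and> T \<le> C * (store_size s + 1) ^ d"
    using compile_time[OF p] by blast
  have "store_size (input_store m J) = length J + m" for m J
    by (simp add: store_size_def input_store_def)
  then have "\<exists>T s. exec (compile p) (input_store m J) T s \<and> output_schedule s = A m J \<and>
      T \<le> C * (length J + m + 1) ^ d" if "valid_jobs J" for m J
    using C[of "input_store m J"] A[OF that] by metis
  then show ?thesis unfolding polynomial_time_def by blast
qed

text \<open>The counter equals the number of finished iterations, so invariants can refer to partial
  operations such as \<open>finish J t h x\<close>.\<close>

lemma For_invariant:
  assumes "v \<notin> nwrites p" and "nval b s = N" and "I 0 (nupdate v 0 0 s)"
    and "\<And>k s'. k < N \<Longrightarrow> nmem s' v 0 = k \<Longrightarrow> I k s' \<Longrightarrow> I (Suc k) (nupdate v 0 (Suc k) (den p s'))"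
  shows "I N (den (For v b p) s)"
proof -
  let ?f = "\<lambda>s. nupdate v 0 (Suc (nmem s v 0)) (den p s)"
  have "k \<le> N \<Longrightarrow> nmem ((?f ^^ k) (nupdate v 0 0 s)) v 0 = k \<and> I k ((?f ^^ k) (nupdate v 0 0 s))" for k
  proof (induction k)
    case (Suc k)
    then show ?case using assms(4)[of k "(?f ^^ k) (nupdate v 0 0 s)"] by simp
  qed (use assms(3) in simp)
  then show ?thesis using assms(2) by simp
qed

section \<open>Implementation\<close>

definition bor :: "bexp \<Rightarrow> bexp \<Rightarrow> bexp" where
  "bor b c = BNot (BAnd (BNot b) (BNot c))"

definition prec_test :: "nexp \<Rightarrow> nexp \<Rightarrow> bexp" where
  "prec_test i j = bor (RLess (RArr ''p'' i) (RArr ''p'' j))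
     (BAnd (BNot (RLess (RArr ''p'' j) (RArr ''p'' i))) (NLess i j))"

lemma bval_bor [simp]: "bval (bor b c) s \<longleftrightarrow> bval b s \<or> bval c s"
  by (simp add: bor_def)

text \<open>Array \<open>b\<close> holds 0 for an idle machine and the running job plus one otherwise.\<close>

definition cur :: nexp where "cur = NSub (NArr ''b'' (nvar ''h'')) (NConst 1)"
definition is_busy :: bexp where "is_busy = NLess (NConst 0) (NArr ''b'' (nvar ''h''))"
definition cur_end :: rexp where "cur_end = RAdd (RArr ''s'' (nvar ''h'')) (RArr ''p'' cur)"

text \<open>\<open>k\<close> is the next job to arrive; by sortedness its release is the earliest
  one left. The flag \<open>ev\<close> tells whether \<open>t\<close> already holds a
  candidate.\<close>

definition next_event_prog :: prog where
  "next_event_prog =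
     SetN ''ev'' (NConst 0) (NConst 0) ;;
     When (NLess (nvar ''k'') (nvar ''n''))
       (SetR ''t'' (NConst 0) (RArr ''r'' (nvar ''k'')) ;; SetN ''ev'' (NConst 0) (NConst 1)) ;;
     For ''h'' (nvar ''m'')
       (When (BAnd is_busy (bor (NLess (nvar ''ev'') (NConst 1)) (RLess cur_end (rvar ''t''))))
         (SetR ''t'' (NConst 0) cur_end ;; SetN ''ev'' (NConst 0) (NConst 1)))"

definition stop_prog :: prog where
  "stop_prog =
     SetN ''job'' (nvar ''count'') cur ;;
     SetN ''machine'' (nvar ''count'') (nvar ''h'') ;;
     SetR ''start'' (nvar ''count'') (RArr ''s'' (nvar ''h'')) ;;
     SetR ''fin'' (nvar ''count'') (rvar ''t'') ;;
     SetN ''count'' (NConst 0) (NAdd (nvar ''count'') (NConst 1)) ;;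
     SetN ''b'' (nvar ''h'') (NConst 0)"

text \<open>\<open>sq\<close> and \<open>nm\<close> hold \<open>K * K\<close> and
  \<open>(k + m) * m\<close>. Both are updated by additions, so the recursion of \<open>cap\<close>
  runs without multiplication.\<close>

definition arrive_prog :: prog where
  "arrive_prog =
     For ''j'' (nvar ''n'')
       (When (BAnd (NLess (nvar ''k'') (nvar ''n'')) (BNot (RLess (rvar ''t'') (RArr ''r'' (nvar ''k'')))))
         (SetN ''w'' (nvar ''k'') (NConst 1) ;;
          SetR ''L'' (NConst 0) (RAdd (rvar ''L'') (RArr ''p'' (nvar ''k''))) ;;
          SetN ''k'' (NConst 0) (NAdd (nvar ''k'') (NConst 1)) ;;
          SetN ''nm'' (NConst 0) (NAdd (nvar ''nm'') (nvar ''m'')) ;;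
          When (NLess (nvar ''sq'') (nvar ''nm''))
            (SetN ''sq'' (NConst 0) (NAdd (nvar ''sq'') (NAdd (nvar ''K'') (NAdd (nvar ''K'') (NConst 1)))) ;;
             SetN ''K'' (NConst 0) (NAdd (nvar ''K'') (NConst 1)))))"

definition finish_prog :: prog where
  "finish_prog = For ''h'' (nvar ''m'')
     (When (BAnd is_busy (BNot (RLess (rvar ''t'') cur_end))) stop_prog)"

definition count_prog :: prog where
  "count_prog =
     SetN ''c'' (NConst 0) (NConst 0) ;;
     For ''j'' (nvar ''n'')
       (When (BAnd (NLess (NConst 0) (NArr ''w'' (nvar ''j''))) (prec_test (nvar ''j'') cur))
         (SetN ''c'' (NConst 0) (NAdd (nvar ''c'') (NConst 1))))"

definition kill_prog :: prog where
  "kill_prog = For ''h'' (nvar ''m'')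
     (When is_busy
       (count_prog ;;
        When (NLess (nvar ''K'') (nvar ''c''))
          (SetN ''w'' cur (NConst 1) ;; stop_prog)))"

text \<open>\<open>best\<close> holds the job plus one, so that 0 can mean that nothing
  waits.\<close>

definition best_prog :: prog where
  "best_prog =
     SetN ''best'' (NConst 0) (NConst 0) ;;
     For ''j'' (nvar ''n'')
       (When (BAnd (NLess (NConst 0) (NArr ''w'' (nvar ''j'')))
           (bor (NLess (nvar ''best'') (NConst 1))
                (prec_test (nvar ''j'') (NSub (nvar ''best'') (NConst 1)))))
         (SetN ''best'' (NConst 0) (NAdd (nvar ''j'') (NConst 1))))"

text \<open>Multiplication by \<open>K\<close> as repeated addition. The capacity is not an
  admissible loop bound, so the loop runs \<open>n + m\<close> times and adds only in the first
  \<open>K\<close> rounds.\<close>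

definition scale_prog :: prog where
  "scale_prog =
     SetR ''acc'' (NConst 0) (RConst 0) ;;
     For ''i'' (NAdd (nvar ''n'') (nvar ''m''))
       (When (NLess (nvar ''i'') (nvar ''K''))
         (SetR ''acc'' (NConst 0) (RAdd (rvar ''acc'') (RArr ''p'' (NSub (nvar ''best'') (NConst 1))))))"

definition launch_prog :: prog where
  "launch_prog = For ''h'' (nvar ''m'')
     (When (BNot is_busy)
       (best_prog ;;
        When (NLess (NConst 0) (nvar ''best''))
          (scale_prog ;;
           When (bor (NLess (NAdd (nvar ''h'') (nvar ''h'')) (nvar ''m'')) (RLess (rvar ''acc'') (rvar ''L'')))
             (SetN ''b'' (nvar ''h'') (nvar ''best'') ;;
              SetR ''s'' (nvar ''h'') (rvar ''t'') ;;
              SetN ''w'' (NSub (nvar ''best'') (NConst 1)) (NConst 0)))))"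

definition step_prog :: prog where
  "step_prog = next_event_prog ;;
     When (NLess (NConst 0) (nvar ''ev'')) (arrive_prog ;; finish_prog ;; kill_prog ;; launch_prog)"

definition simulate_prog :: prog where
  "simulate_prog =
     SetN ''K'' (NConst 0) (nvar ''m'') ;;
     For ''h'' (nvar ''m'') (SetN ''sq'' (NConst 0) (NAdd (nvar ''sq'') (nvar ''m''))) ;;
     SetN ''nm'' (NConst 0) (nvar ''sq'') ;;
     For ''x'' (NAdd (nvar ''n'') (nvar ''n'')) step_prog"

lemmas prog_defs = next_event_prog_def stop_prog_def arrive_prog_def finish_prog_def count_prog_def
  kill_prog_def best_prog_def scale_prog_def launch_prog_def step_prog_def simulate_prog_def

section \<open>Correctness of the program\<close>

lemma bounded_loops_simulate: "bounded_loops simulate_prog"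
  by (simp add: prog_defs size_exps_def)

text \<open>Queue, machines and record are separate arguments, so that arrivals can be verified job
  by job without intermediate states. Scratch variables do not occur, which lets
  \<open>rep_cong\<close> absorb the updates of loop counters.\<close>

definition rep :: "nat \<Rightarrow> jobs \<Rightarrow> nat \<Rightarrow> nat set \<Rightarrow> (nat \<Rightarrow> (nat \<times> real) option) \<Rightarrow> schedule \<Rightarrow> store \<Rightarrow> bool" where
  "rep m J k W R Z s \<longleftrightarrow>
     nmem s ''n'' 0 = length J \<and> nmem s ''m'' 0 = m \<and>
     (\<forall>j<length J. rmem s ''r'' j = release J j \<and> rmem s ''p'' j = proc J j) \<and>
     nmem s ''k'' 0 = k \<and> k \<le> length J \<and> nmem s ''K'' 0 = cap m k \<and>
     nmem s ''sq'' 0 = cap m k * cap m k \<and> nmem s ''nm'' 0 = (k + m) * m \<and>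
     rmem s ''L'' 0 = (\<Sum>j<k. proc J j) \<and>
     (\<forall>j<length J. (0 < nmem s ''w'' j) = (j \<in> W)) \<and> W \<subseteq> {..<length J} \<and>
     (\<forall>h<m. nmem s ''b'' h = (case R h of None \<Rightarrow> 0 | Some (j, u) \<Rightarrow> Suc j)) \<and>
     (\<forall>h<m. \<forall>j u. R h = Some (j, u) \<longrightarrow> rmem s ''s'' h = u \<and> j < length J) \<and>
     output_schedule s = Z"

lemma rep_cong:
  assumes "rep m J k W R Z s"
    and "\<And>a. a \<notin> {''h'', ''j'', ''i'', ''x'', ''c'', ''best'', ''ev''} \<Longrightarrow> nmem s' a = nmem s a"
    and "\<And>a. a \<notin> {''t'', ''acc''} \<Longrightarrow> rmem s' a = rmem s a"
  shows "rep m J k W R Z s'"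
  using assms by (simp add: rep_def output_schedule_def)

lemma repD:
  assumes "rep m J k W R Z s"
  shows "nmem s ''n'' 0 = length J" "nmem s ''m'' 0 = m"
    "j < length J \<Longrightarrow> rmem s ''r'' j = release J j" "j < length J \<Longrightarrow> rmem s ''p'' j = proc J j"
    "nmem s ''k'' 0 = k" "k \<le> length J" "nmem s ''K'' 0 = cap m k"
    "nmem s ''sq'' 0 = cap m k * cap m k" "nmem s ''nm'' 0 = (k + m) * m"
    "rmem s ''L'' 0 = (\<Sum>j<k. proc J j)"
    "j < length J \<Longrightarrow> (0 < nmem s ''w'' j) = (j \<in> W)" "W \<subseteq> {..<length J}"
    "h < m \<Longrightarrow> R h = None \<Longrightarrow> nmem s ''b'' h = 0"
    "h < m \<Longrightarrow> R h = Some (j, u) \<Longrightarrow> nmem s ''b'' h = Suc j \<and> rmem s ''s'' h = u \<and> j < length J"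
    "output_schedule s = Z"
  using assms unfolding rep_def by auto

lemma rep_den:
  assumes "rep m J k W R Z s" "nwrites p \<subseteq> {''h'', ''j'', ''i'', ''x'', ''c'', ''best'', ''ev''}"
    "rwrites p \<subseteq> {''t'', ''acc''}"
  shows "rep m J k W R Z (den p s)"
proof (rule rep_cong[OF assms(1)])
  show "nmem (den p s) a = nmem s a" if "a \<notin> {''h'', ''j'', ''i'', ''x'', ''c'', ''best'', ''ev''}" for a
    using that assms(2) by (intro den_nframe) blast
  show "rmem (den p s) a = rmem s a" if "a \<notin> {''t'', ''acc''}" for a
    using that assms(3) by (intro den_rframe) blast
qed

abbreviation rep_state :: "nat \<Rightarrow> jobs \<Rightarrow> nat \<Rightarrow> state \<Rightarrow> store \<Rightarrow> bool" where
  "rep_state m J k x s \<equiv> rep m J k (waits x) (run x) (segs x) s"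

lemma is_busy_iff:
  assumes "rep m J k W R Z s" "nmem s ''h'' 0 < m"
  shows "bval is_busy s \<longleftrightarrow> R (nmem s ''h'' 0) \<noteq> None"
  using repD(13,14)[OF assms(1,2)] by (cases "R (nmem s ''h'' 0)") (auto simp: is_busy_def)

lemma cur_vals:
  assumes "rep m J k W R Z s" "nmem s ''h'' 0 < m" "R (nmem s ''h'' 0) = Some (j, u)"
  shows "nval cur s = j" "rval cur_end s = u + proc J j" "j < length J"
  using repD(14)[OF assms] repD(4)[OF assms(1)] by (auto simp: cur_def cur_end_def)

lemma output_append:
  assumes "nmem s' ''count'' 0 = Suc (nmem s ''count'' 0)"
    "nmem s' ''job'' = (nmem s ''job'')(nmem s ''count'' 0 := j)"
    "nmem s' ''machine'' = (nmem s ''machine'')(nmem s ''count'' 0 := h)"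
    "rmem s' ''start'' = (rmem s ''start'')(nmem s ''count'' 0 := u)"
    "rmem s' ''fin'' = (rmem s ''fin'')(nmem s ''count'' 0 := t)"
  shows "output_schedule s' = insert (seg_of h j u t) (output_schedule s)"
  using assms by (auto simp: output_schedule_def lessThan_Suc seg_of_def)

lemma stop_single:
  assumes "run x h = Some (j, u)"
  shows "waits (stop ((=) h) t x) = waits x" "run (stop ((=) h) t x) = (run x)(h := None)"
    "segs (stop ((=) h) t x) = insert (seg_of h j u t) (segs x)"
  using assms by (auto simp: stop_def)

lemma stop_prog:
  assumes r: "rep_state m J k x s" and h: "nmem s ''h'' 0 = h" "h < m" and R: "run x h = Some (j, u)"
    and t: "rmem s ''t'' 0 = t"
  shows "rep_state m J k (stop ((=) h) t x) (den stop_prog s)"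
proof -
  have b: "nmem s ''b'' h = Suc j" "rmem s ''s'' h = u" "j < length J" using repD(14)[OF r h(2) R] by auto
  have c: "nval cur s = j" using b h by (simp add: cur_def)
  have o: "output_schedule (den stop_prog s) = insert (seg_of h j u t) (output_schedule s)"
    by (rule output_append) (use c h b t in \<open>simp_all add: stop_prog_def\<close>)
  have b': "nmem (den stop_prog s) ''b'' = (nmem s ''b'')(h := 0)"
    using h by (simp add: stop_prog_def)
  have fr: "nmem (den stop_prog s) a = nmem s a" if "a \<notin> {''job'', ''machine'', ''count'', ''b''}" for a
    using that by (intro den_nframe) (simp add: stop_prog_def)
  have frr: "rmem (den stop_prog s) a = rmem s a" if "a \<notin> {''start'', ''fin''}" for a
    using that by (intro den_rframe) (simp add: stop_prog_def)
  show ?thesis unfolding stop_single[OF R]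
    using r o unfolding rep_def by (simp add: b' fr frr)
qed

text \<open>Stopping one machine does not affect the others, so the simultaneous operation is a
  sequence of single stops.\<close>

lemma stop_Suc:
  "stop (\<lambda>i. i < Suc h \<and> P i) t x =
     (if P h then stop ((=) h) t (stop (\<lambda>i. i < h \<and> P i) t x) else stop (\<lambda>i. i < h \<and> P i) t x)"
proof -
  define y where "y = stop (\<lambda>i. i < h \<and> P i) t x"
  have y: "run y h = run x h" by (simp add: y_def stop_def)
  have "{seg_of i j s t | i j s. (i < Suc h \<and> P i) \<and> run x i = Some (j, s)} =
     {seg_of i j s t | i j s. (i < h \<and> P i) \<and> run x i = Some (j, s)} \<union>
     {seg_of h j s t | j s. P h \<and> run x h = Some (j, s)}"
    by (auto simp: less_Suc_eq)
  moreover have "{seg_of i j s t | i j s. h = i \<and> run y i = Some (j, s)} =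
     {seg_of h j s t | j s. run x h = Some (j, s)}" using y by auto
  ultimately have "segs (stop (\<lambda>i. i < Suc h \<and> P i) t x) =
     segs (if P h then stop ((=) h) t y else y)"
    by (auto simp: y_def stop_def)
  moreover have "run (stop (\<lambda>i. i < Suc h \<and> P i) t x) = run (if P h then stop ((=) h) t y else y)"
    by (auto simp: y_def stop_def less_Suc_eq fun_eq_iff)
  ultimately show ?thesis unfolding y_def[symmetric]
    by (intro state.equality) (auto simp: y_def stop_def)
qed

lemma finish_Suc:
  "finish J t (Suc h) x =
     (if finishes J t x h then stop ((=) h) t (finish J t h x) else finish J t h x)"
  unfolding finish_def by (rule stop_Suc)

lemma finish_run: "h \<le> h' \<Longrightarrow> run (finish J t h x) h' = run x h'"
  by (simp add: finish_def stop_def)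

lemma finish_prog:
  assumes r: "rep_state m J k x s" and t: "rmem s ''t'' 0 = t"
  shows "rep_state m J k (finish J t m x) (den finish_prog s) \<and> rmem (den finish_prog s) ''t'' 0 = t"
proof -
  define I where "I i s' \<longleftrightarrow> rep_state m J k (finish J t i x) s' \<and> rmem s' ''t'' 0 = t" for i s'
  have "I m (den finish_prog s)" unfolding finish_prog_def
  proof (rule For_invariant)
    show "''h'' \<notin> nwrites (When (BAnd is_busy (BNot (RLess (rvar ''t'') cur_end))) stop_prog)"
      by (simp add: stop_prog_def)
    show "nval (nvar ''m'') s = m" using repD(2)[OF r] by simp
    have "finish J t 0 x = x" by (simp add: finish_def stop_def)
    then show "I 0 (nupdate ''h'' 0 0 s)"
      using r t by (auto simp: I_def intro: rep_cong)
    fix h s' assume h: "h < m" "nmem s' ''h'' 0 = h" "I h s'"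
    let ?y = "finish J t h x"
    have r': "rep_state m J k ?y s'" "rmem s' ''t'' 0 = t" using h by (auto simp: I_def)
    have run: "run ?y h = run x h" by (rule finish_run) simp
    let ?c = "BAnd is_busy (BNot (RLess (rvar ''t'') cur_end))"
    have c: "bval ?c s' \<longleftrightarrow> finishes J t x h"
    proof (cases "run x h")
      case None
      then show ?thesis using is_busy_iff[OF r'(1)] h run by (simp add: finishes_def)
    next
      case (Some ju)
      obtain j u where ju: "run x h = Some (j, u)" using Some by (cases ju) auto
      then show ?thesis using is_busy_iff[OF r'(1)] cur_vals(2)[OF r'(1), of j u] h run r'(2)
        by (auto simp: finishes_def)
    qed
    have "rep_state m J k (finish J t (Suc h) x) (den (When ?c stop_prog) s') \<and>
      rmem (den (When ?c stop_prog) s') ''t'' 0 = t"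
    proof (cases "finishes J t x h")
      case True
      then obtain j u where "run ?y h = Some (j, u)" using run by (auto simp: finishes_def)
      from stop_prog[OF r'(1) h(2,1) this r'(2)] True show ?thesis
        using c r'(2) by (simp add: finish_Suc den_rframe) (simp add: stop_prog_def)
    next
      case False
      then show ?thesis using c r' by (simp add: finish_Suc del: bval.simps)
    qed
    then show "I (Suc h) (nupdate ''h'' 0 (Suc h) (den (When ?c stop_prog) s'))"
      unfolding I_def by (auto intro: rep_cong)
  qed
  then show ?thesis by (simp add: I_def)
qed

lemma prec_test_val:
  assumes "rep m J k W R Z s" "nval i s < length J" "nval j s < length J"
  shows "bval (prec_test i j) s \<longleftrightarrow> prec J (nval i s) (nval j s)"
  using repD(4)[OF assms(1)] assms(2,3) by (auto simp: prec_test_def prec_def)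

lemma count_prog:
  assumes r: "rep m J k W R Z s" and h: "nmem s ''h'' 0 = h" "h < m" and R: "R h = Some (j, u)"
  shows "nmem (den count_prog s) ''c'' 0 = card {q \<in> W. prec J q j}"
proof -
  let ?b = "BAnd (NLess (NConst 0) (NArr ''w'' (nvar ''j''))) (prec_test (nvar ''j'') cur)"
  let ?body = "When ?b (SetN ''c'' (NConst 0) (NAdd (nvar ''c'') (NConst 1)))"
  let ?s = "nupdate ''c'' 0 0 s"
  define I where "I i s' \<longleftrightarrow> rep m J k W R Z s' \<and> nmem s' ''h'' 0 = h \<and>
     nmem s' ''c'' 0 = card {q \<in> W. q < i \<and> prec J q j}" for i s'
  have r0: "rep m J k W R Z ?s" by (rule rep_cong[OF r]) auto
  have "I (length J) (den (For ''j'' (nvar ''n'') ?body) ?s)"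
  proof (rule For_invariant)
    show "''j'' \<notin> nwrites ?body" by simp
    show "nval (nvar ''n'') ?s = length J" using repD(1)[OF r0] by simp
    show "I 0 (nupdate ''j'' 0 0 ?s)" using h by (auto simp: I_def intro: rep_cong[OF r])
    fix i s' assume i: "i < length J" "nmem s' ''j'' 0 = i" "I i s'"
    then have r': "rep m J k W R Z s'" "nmem s' ''h'' 0 = h" "nmem s' ''c'' 0 = card {q \<in> W. q < i \<and> prec J q j}"
      by (auto simp: I_def)
    have cv: "nval cur s' = j" "j < length J" using cur_vals[OF r'(1), of j u] r'(2) h R by auto
    have b: "bval ?b s' \<longleftrightarrow> i \<in> W \<and> prec J i j"
      using prec_test_val[OF r'(1), of "nvar ''j''" cur] repD(11)[OF r'(1) i(1)] i cv by simp
    have "{q \<in> W. q < Suc i \<and> prec J q j} = (if i \<in> W \<and> prec J i j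
       then insert i {q \<in> W. q < i \<and> prec J q j} else {q \<in> W. q < i \<and> prec J q j})"
      by (auto simp: less_Suc_eq)
    then have "nmem (den ?body s') ''c'' 0 = card {q \<in> W. q < Suc i \<and> prec J q j}"
      using b r'(3) by simp
    moreover have "rep m J k W R Z (nupdate ''j'' 0 (Suc i) (den ?body s'))"
      by (rule rep_cong[OF r'(1)]) auto
    ultimately show "I (Suc i) (nupdate ''j'' 0 (Suc i) (den ?body s'))"
      using r'(2) by (simp add: I_def)
  qed
  moreover have "{q \<in> W. q < length J \<and> prec J q j} = {q \<in> W. prec J q j}" using repD(12)[OF r] by auto
  ultimately show ?thesis by (simp add: I_def count_prog_def)
qed

text \<open>The program counts on a queue that already contains the jobs killed on earlier machines.
  If \<open>h\<close> is not hit, none of these is smaller than its job, by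
  \<open>hit_larger\<close>; if it is hit, they can only increase the count.\<close>

lemma kill_hit:
  assumes fin: "finite (waits x)" and R: "run x h = Some (j, u)"
  shows "capacity m J t < card {q \<in> waits (kill m J t h x). prec J q j} \<longleftrightarrow> hit m J t x h"
proof -
  let ?y = "kill m J t h x"
  have w: "waits ?y = waits x \<union> {j. \<exists>h' s. h' < h \<and> hit m J t x h' \<and> run x h' = Some (j, s)}"
    by (simp add: kill_def)
  have "{j. \<exists>h' s. h' < h \<and> hit m J t x h' \<and> run x h' = Some (j, s)} \<subseteq> (\<lambda>h. fst (the (run x h))) ` {..<h}"
    by force
  then have finy: "finite (waits ?y)" unfolding w using fin finite_subset by fastforce
  have mono: "card {q \<in> waits x. prec J q j} \<le> card {q \<in> waits ?y. prec J q j}"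
    using finy w by (intro card_mono) auto
  show ?thesis
  proof (cases "hit m J t x h")
    case True
    then show ?thesis using mono R by (auto simp: hit_def)
  next
    case False
    have "{q \<in> waits ?y. prec J q j} = {q \<in> waits x. prec J q j}"
      using False hit_larger[OF fin _ _ R] w by blast
    then show ?thesis using R by (simp add: hit_def)
  qed
qed

lemma kill_run: "h \<le> h' \<Longrightarrow> run (kill m J t h x) h' = run x h'"
  by (simp add: kill_def stop_def)

lemma stop_waits: "stop P t (x\<lparr>waits := W\<rparr>) = (stop P t x)\<lparr>waits := W\<rparr>"
  by (rule state.equality) (auto simp: stop_def)

lemma kill_Suc:
  "kill m J t (Suc h) x = (if hit m J t x h
     then (stop ((=) h) t (kill m J t h x))
       \<lparr>waits := insert (fst (the (run x h))) (waits (kill m J t h x))\<rparr>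
     else kill m J t h x)"
proof -
  have "{j. \<exists>i s. i < Suc h \<and> hit m J t x i \<and> run x i = Some (j, s)} =
     {j. \<exists>i s. i < h \<and> hit m J t x i \<and> run x i = Some (j, s)} \<union>
     (if hit m J t x h then {fst (the (run x h))} else {})"
    by (auto simp: less_Suc_eq hit_def)
  then show ?thesis unfolding kill_def stop_Suc by (auto simp: stop_waits)
qed

lemma kill_prog:
  assumes r: "rep_state m J k x s" and t: "rmem s ''t'' 0 = t" and k: "k = card (arrived J t)"
  shows "rep_state m J k (kill m J t m x) (den kill_prog s) \<and> rmem (den kill_prog s) ''t'' 0 = t"
proof -
  have finw: "finite (waits x)" using repD(12)[OF r] finite_subset by blast
  let ?inner = "When (NLess (nvar ''K'') (nvar ''c'')) (SetN ''w'' cur (NConst 1) ;; stop_prog)"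
  let ?body = "When is_busy (count_prog ;; ?inner)"
  define I where "I i s' \<longleftrightarrow> rep_state m J k (kill m J t i x) s' \<and> rmem s' ''t'' 0 = t" for i s'
  have "I m (den kill_prog s)" unfolding kill_prog_def
  proof (rule For_invariant)
    show "''h'' \<notin> nwrites ?body" by (simp add: stop_prog_def count_prog_def)
    show "nval (nvar ''m'') s = m" using repD(2)[OF r] by simp
    have "kill m J t 0 x = x" by (simp add: kill_def stop_def)
    then show "I 0 (nupdate ''h'' 0 0 s)" using r t by (auto simp: I_def intro: rep_cong)
    fix h s' assume h: "h < m" "nmem s' ''h'' 0 = h" "I h s'"
    let ?y = "kill m J t h x"
    have r': "rep_state m J k ?y s'" "rmem s' ''t'' 0 = t" using h by (auto simp: I_def)
    have run: "run ?y h = run x h" by (rule kill_run) simp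
    have busy: "bval is_busy s' \<longleftrightarrow> run x h \<noteq> None" using is_busy_iff[OF r'(1)] h run by simp
    have "rep_state m J k (kill m J t (Suc h) x) (den ?body s') \<and> rmem (den ?body s') ''t'' 0 = t"
    proof (cases "run x h")
      case None
      then have "\<not> hit m J t x h" by (simp add: hit_def)
      then show ?thesis using r' busy None by (simp add: kill_Suc)
    next
      case (Some ju)
      obtain j u where ju: "run x h = Some (j, u)" using Some by (cases ju) auto
      have R: "run ?y h = Some (j, u)" using ju run by simp
      define z where "z = den count_prog s'"
      have z: "rep_state m J k ?y z" "nmem z ''h'' 0 = h" "rmem z ''t'' 0 = t"
        unfolding z_def using r' h(2) rep_den[OF r'(1), of count_prog]
          den_nframe[of "''h''" count_prog s'] den_rframe[of "''t''" count_prog s']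
        by (simp_all add: count_prog_def del: den.simps)
      have c: "nmem z ''c'' 0 = card {q \<in> waits ?y. prec J q j}"
        unfolding z_def by (rule count_prog[OF r'(1) h(2,1) R])
      have test: "bval (NLess (nvar ''K'') (nvar ''c'')) z \<longleftrightarrow> hit m J t x h"
        using c repD(7)[OF z(1)] kill_hit[OF finw ju, of m J t] k by simp
      have body: "den ?body s' = den ?inner z" using busy ju by (simp add: z_def)
      show ?thesis
      proof (cases "hit m J t x h")
        case False
        then show ?thesis unfolding body using test z by (simp add: kill_Suc)
      next
        case True
        have cv: "nval cur z = j" "j < length J" using cur_vals[OF z(1), of j u] z(2) h(1) R by auto
        let ?z = "nupdate ''w'' j 1 z"
        let ?y' = "?y\<lparr>waits := insert j (waits ?y)\<rparr>"
        have "rep_state m J k ?y' ?z"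
          using z(1) cv(2) unfolding rep_def by (auto simp: output_schedule_def)
        then have "rep_state m J k (stop ((=) h) t ?y') (den stop_prog ?z)"
          by (rule stop_prog) (use z h R in auto)
        moreover have "kill m J t (Suc h) x = stop ((=) h) t ?y'"
          using True ju by (simp add: kill_Suc stop_waits)
        moreover have "den ?inner z = den stop_prog ?z" using test True cv by simp
        moreover have "rmem (den stop_prog ?z) ''t'' 0 = t"
          using z by (simp add: den_rframe stop_prog_def)
        ultimately show ?thesis unfolding body by simp
      qed
    qed
    then show "I (Suc h) (nupdate ''h'' 0 (Suc h) (den ?body s'))"
      unfolding I_def by (auto intro: rep_cong)
  qed
  then show ?thesis by (simp add: I_def)
qed


text \<open>The update of \<open>sq\<close> expands the square of \<open>K + 1\<close>, and
  \<open>nm\<close> grows by \<open>m\<close>; this is one step of the recursion of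
  \<open>cap\<close>.\<close>

lemma arrive_step:
  assumes r: "rep m J k W R Z s" and k: "k < length J"
  shows "rep m J (Suc k) (insert k W) R Z (den
         (SetN ''w'' (nvar ''k'') (NConst 1) ;;
          SetR ''L'' (NConst 0) (RAdd (rvar ''L'') (RArr ''p'' (nvar ''k''))) ;;
          SetN ''k'' (NConst 0) (NAdd (nvar ''k'') (NConst 1)) ;;
          SetN ''nm'' (NConst 0) (NAdd (nvar ''nm'') (nvar ''m'')) ;;
          When (NLess (nvar ''sq'') (nvar ''nm''))
            (SetN ''sq'' (NConst 0) (NAdd (nvar ''sq'') (NAdd (nvar ''K'') (NAdd (nvar ''K'') (NConst 1)))) ;;
             SetN ''K'' (NConst 0) (NAdd (nvar ''K'') (NConst 1)))) s)"
proof -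
  have nm: "(k + m) * m + m = (Suc k + m) * m" by simp
  have "cap m k * cap m k + (cap m k + (cap m k + 1)) = Suc (cap m k) * Suc (cap m k)" by simp
  then show ?thesis
    using r k unfolding rep_def output_schedule_def by (auto simp: nm)
qed

lemma arrive_prog:
  assumes r: "rep m J k W R Z s" and t: "rmem s ''t'' 0 = t" and v: "valid_jobs J"
    and N: "N = card (arrived J t)" "k \<le> N"
  shows "rep m J N (W \<union> {k..<N}) R Z (den arrive_prog s) \<and> rmem (den arrive_prog s) ''t'' 0 = t"
proof -
  have arr: "arrived J t = {..<N}" "N \<le> length J"
    using released_take[of J t] v N(1) unfolding valid_jobs_def by auto
  let ?c = "BAnd (NLess (nvar ''k'') (nvar ''n'')) (BNot (RLess (rvar ''t'') (RArr ''r'' (nvar ''k''))))"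
  let ?p = "SetN ''w'' (nvar ''k'') (NConst 1) ;;
          SetR ''L'' (NConst 0) (RAdd (rvar ''L'') (RArr ''p'' (nvar ''k''))) ;;
          SetN ''k'' (NConst 0) (NAdd (nvar ''k'') (NConst 1)) ;;
          SetN ''nm'' (NConst 0) (NAdd (nvar ''nm'') (nvar ''m'')) ;;
          When (NLess (nvar ''sq'') (nvar ''nm''))
            (SetN ''sq'' (NConst 0) (NAdd (nvar ''sq'') (NAdd (nvar ''K'') (NAdd (nvar ''K'') (NConst 1)))) ;;
             SetN ''K'' (NConst 0) (NAdd (nvar ''K'') (NConst 1)))"
  \<comment> \<open>Each iteration admits at most one job; once the next release lies after
    \<open>t\<close>, the remaining iterations do nothing.\<close>
  define l where "l i = min (k + i) N" for i
  define I where "I i s' \<longleftrightarrow> rep m J (l i) (W \<union> {k..<l i}) R Z s' \<and> rmem s' ''t'' 0 = t" for i s'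
  have "I (length J) (den arrive_prog s)" unfolding arrive_prog_def
  proof (rule For_invariant)
    show "''j'' \<notin> nwrites (When ?c ?p)" by simp
    show "nval (nvar ''n'') s = length J" using repD(1)[OF r] by simp
    have "l 0 = k" using N by (simp add: l_def)
    then show "I 0 (nupdate ''j'' 0 0 s)" using r t by (auto simp: I_def intro: rep_cong)
    fix i s' assume "I i s'"
    then have r': "rep m J (l i) (W \<union> {k..<l i}) R Z s'" "rmem s' ''t'' 0 = t" by (auto simp: I_def)
    have c: "bval ?c s' \<longleftrightarrow> l i < N"
    proof -
      have "bval ?c s' \<longleftrightarrow> l i \<in> arrived J t"
        using repD(1,5)[OF r'(1)] repD(3)[OF r'(1), of "l i"] r'(2) by (auto simp: arrived_def)
      then show ?thesis using arr by simp
    qed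
    have tt: "rmem (den (When ?c ?p) s') ''t'' 0 = t"
      using r'(2) by (subst den_rframe) simp_all
    have "rep m J (l (Suc i)) (W \<union> {k..<l (Suc i)}) R Z (den (When ?c ?p) s')"
    proof (cases "l i < N")
      case True
      then have "l (Suc i) = Suc (l i)" "{k..<l (Suc i)} = insert (l i) {k..<l i}"
        using N(2) by (auto simp: l_def)
      then show ?thesis using arrive_step[OF r'(1)] True c arr(2) by (simp del: nval.simps bval.simps)
    next
      case False
      then have "l (Suc i) = l i" by (simp add: l_def)
      then show ?thesis using r' False c by (simp del: bval.simps)
    qed
    then show "I (Suc i) (nupdate ''j'' 0 (Suc i) (den (When ?c ?p) s'))"
      unfolding I_def using tt by (auto intro: rep_cong)
  qed
  moreover have "l (length J) = N" using arr by (simp add: l_def)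
  ultimately show ?thesis by (simp add: I_def)
qed

lemma smallest_singleton: "smallest J {i} = i"
  using smallest(1)[of "{i}" J] by simp

lemma smallest_insert:
  assumes "finite A" "A \<noteq> {}"
  shows "smallest J (insert i A) = (if prec J i (smallest J A) then i else smallest J A)"
proof -
  have q: "smallest J A \<in> A" "\<And>j. j \<in> A \<Longrightarrow> \<not> prec J j (smallest J A)" using smallest[OF assms] by auto
  let ?q = "smallest J (insert i A)"
  have q': "?q \<in> insert i A" "\<And>j. j \<in> insert i A \<Longrightarrow> \<not> prec J j ?q"
    using smallest[of "insert i A"] assms by auto
  show ?thesis
  proof (cases "prec J i (smallest J A)")
    case True
    have "?q = i"
    proof (rule ccontr)
      assume "?q \<noteq> i"
      then have "?q \<in> A" using q'(1) by blast
      then have "\<not> prec J ?q (smallest J A)" "\<not> prec J i ?q" using q(2) q'(2) by blast+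
      then show False using True prec_total[of ?q i J] prec_trans[of J ?q i "smallest J A"] \<open>?q \<noteq> i\<close> by blast
    qed
    then show ?thesis using True by simp
  next
    case False
    have "?q = smallest J A"
    proof (rule ccontr)
      assume "?q \<noteq> smallest J A"
      then have "prec J ?q (smallest J A)" using prec_total q(1) q'(2) by blast
      moreover have "?q = i \<or> ?q \<in> A" using q'(1) by blast
      ultimately show False using q(2) False by auto
    qed
    then show ?thesis using False by simp
  qed
qed

lemma best_prog:
  assumes r: "rep m J k W R Z s"
  shows "nmem (den best_prog s) ''best'' 0 = (if W = {} then 0 else Suc (smallest J W))"
proof -
  let ?b = "BAnd (NLess (NConst 0) (NArr ''w'' (nvar ''j'')))
     (bor (NLess (nvar ''best'') (NConst 1)) (prec_test (nvar ''j'') (NSub (nvar ''best'') (NConst 1))))"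
  let ?body = "When ?b (SetN ''best'' (NConst 0) (NAdd (nvar ''j'') (NConst 1)))"
  let ?s = "nupdate ''best'' 0 0 s"
  define A where "A i = {q \<in> W. q < i}" for i
  have A: "finite (A i)" for i by (simp add: A_def)
  define I where "I i s' \<longleftrightarrow> rep m J k W R Z s' \<and>
     nmem s' ''best'' 0 = (if A i = {} then 0 else Suc (smallest J (A i)))" for i s'
  have r0: "rep m J k W R Z ?s" by (rule rep_cong[OF r]) auto
  have "I (length J) (den (For ''j'' (nvar ''n'') ?body) ?s)"
  proof (rule For_invariant)
    show "''j'' \<notin> nwrites ?body" by simp
    show "nval (nvar ''n'') ?s = length J" using repD(1)[OF r0] by simp
    show "I 0 (nupdate ''j'' 0 0 ?s)" by (auto simp: I_def A_def intro: rep_cong[OF r])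
    fix i s' assume i: "i < length J" "nmem s' ''j'' 0 = i" "I i s'"
    then have r': "rep m J k W R Z s'" "nmem s' ''best'' 0 = (if A i = {} then 0 else Suc (smallest J (A i)))"
      by (auto simp: I_def)
    have b: "bval ?b s' \<longleftrightarrow> i \<in> W \<and> (A i = {} \<or> prec J i (smallest J (A i)))"
    proof (cases "A i = {}")
      case True
      then show ?thesis using r'(2) repD(11)[OF r'(1) i(1)] i by simp
    next
      case False
      have "smallest J (A i) < i" using smallest(1)[OF A False, of J] by (simp add: A_def)
      then have "smallest J (A i) < length J" using i(1) by simp
      then show ?thesis
        using False r'(2) repD(11)[OF r'(1) i(1)] i
          prec_test_val[OF r'(1), of "nvar ''j''" "NSub (nvar ''best'') (NConst 1)"] by simp
    qed
    have AS: "A (Suc i) = (if i \<in> W then insert i (A i) else A i)" by (auto simp: A_def less_Suc_eq)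
    have "nmem (den ?body s') ''best'' 0 = (if A (Suc i) = {} then 0 else Suc (smallest J (A (Suc i))))"
    proof (cases "i \<in> W")
      case True
      have body: "den ?body s' = (if bval ?b s' then nupdate ''best'' 0 (Suc i) s' else s')"
        using i(2) by simp
      show ?thesis
      proof (cases "A i = {}")
        case empty: True
        then show ?thesis unfolding body using True b AS smallest_singleton[of J i] by (simp del: bval.simps)
      next
        case False
        show ?thesis unfolding body
          using True False b r'(2) AS smallest_insert[OF A False, of J i] by (simp del: bval.simps)
      qed
    next
      case False
      then show ?thesis using b r'(2) AS by (simp del: bval.simps)
    qed
    moreover have "rep m J k W R Z (nupdate ''j'' 0 (Suc i) (den ?body s'))"
      by (rule rep_cong[OF r'(1)]) auto
    ultimately show "I (Suc i) (nupdate ''j'' 0 (Suc i) (den ?body s'))"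
      by (simp add: I_def)
  qed
  moreover have "A (length J) = W" using repD(12)[OF r] by (auto simp: A_def)
  ultimately show ?thesis by (simp add: I_def best_prog_def)
qed

lemma scale_prog:
  assumes r: "rep m J k W R Z s" and b: "nmem s ''best'' 0 = Suc q" "q < length J"
  shows "rmem (den scale_prog s) ''acc'' 0 = proc J q * real (cap m k)"
proof -
  let ?body = "When (NLess (nvar ''i'') (nvar ''K''))
         (SetR ''acc'' (NConst 0) (RAdd (rvar ''acc'') (RArr ''p'' (NSub (nvar ''best'') (NConst 1)))))"
  let ?s = "rupdate ''acc'' 0 0 s"
  define I where "I i s' \<longleftrightarrow> rep m J k W R Z s' \<and> nmem s' ''best'' 0 = Suc q \<and>
     rmem s' ''acc'' 0 = proc J q * real (min i (cap m k))" for i s'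
  have r0: "rep m J k W R Z ?s" by (rule rep_cong[OF r]) auto
  have "I (length J + m) (den (For ''i'' (NAdd (nvar ''n'') (nvar ''m'')) ?body) ?s)"
  proof (rule For_invariant)
    show "''i'' \<notin> nwrites ?body" by simp
    show "nval (NAdd (nvar ''n'') (nvar ''m'')) ?s = length J + m" using repD(1,2)[OF r0] by simp
    have "rep m J k W R Z (nupdate ''i'' 0 0 ?s)" by (rule rep_cong[OF r]) auto
    then show "I 0 (nupdate ''i'' 0 0 ?s)" using b by (simp add: I_def)
    fix i s' assume i: "nmem s' ''i'' 0 = i" "I i s'"
    then have r': "rep m J k W R Z s'" "nmem s' ''best'' 0 = Suc q"
      "rmem s' ''acc'' 0 = proc J q * real (min i (cap m k))" by (auto simp: I_def)
    have "rmem (den ?body s') ''acc'' 0 = proc J q * real (min (Suc i) (cap m k))"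
      using r' i(1) repD(7)[OF r'(1)] repD(4)[OF r'(1) b(2)] by (auto simp: algebra_simps min_def)
    moreover have "rep m J k W R Z (nupdate ''i'' 0 (Suc i) (den ?body s'))"
      by (rule rep_cong[OF r'(1)]) auto
    ultimately show "I (Suc i) (nupdate ''i'' 0 (Suc i) (den ?body s'))"
      using r'(2) by (simp add: I_def)
  qed
  \<comment> \<open>There are enough iterations, since the capacity is at most
    \<open>k + m\<close>.\<close>
  moreover have "min (length J + m) (cap m k) = cap m k"
    using cap_le[of m k] repD(6)[OF r] by (simp add: min_def)
  ultimately show ?thesis by (simp add: I_def scale_prog_def)
qed

lemma launch_prog:
  assumes r: "rep_state m J k x s" and t: "rmem s ''t'' 0 = t" and k: "arrived J t = {..<k}"
  shows "rep_state m J k (launch_all m J t m x) (den launch_prog s)"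
proof -
  let ?set = "SetN ''b'' (nvar ''h'') (nvar ''best'') ;;
              SetR ''s'' (nvar ''h'') (rvar ''t'') ;;
              SetN ''w'' (NSub (nvar ''best'') (NConst 1)) (NConst 0)"
  let ?may = "bor (NLess (NAdd (nvar ''h'') (nvar ''h'')) (nvar ''m'')) (RLess (rvar ''acc'') (rvar ''L''))"
  let ?inner = "When (NLess (NConst 0) (nvar ''best'')) (scale_prog ;; When ?may ?set)"
  let ?body = "When (BNot is_busy) (best_prog ;; ?inner)"
  define I where "I i s' \<longleftrightarrow> rep_state m J k (launch_all m J t i x) s' \<and> rmem s' ''t'' 0 = t" for i s'
  have "I m (den launch_prog s)" unfolding launch_prog_def
  proof (rule For_invariant)
    show "''h'' \<notin> nwrites ?body" by (simp add: best_prog_def scale_prog_def)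
    show "nval (nvar ''m'') s = m" using repD(2)[OF r] by simp
    show "I 0 (nupdate ''h'' 0 0 s)" using r t by (auto simp: I_def intro: rep_cong)
    fix h s' assume h: "h < m" "nmem s' ''h'' 0 = h" "I h s'"
    let ?y = "launch_all m J t h x"
    have r': "rep_state m J k ?y s'" "rmem s' ''t'' 0 = t" using h by (auto simp: I_def)
    have tt: "rmem (den ?body s') ''t'' 0 = t"
      using r'(2) by (subst den_rframe) (simp_all add: best_prog_def scale_prog_def)
    have busy: "bval is_busy s' \<longleftrightarrow> run ?y h \<noteq> None" using is_busy_iff[OF r'(1)] h by simp
    have "rep_state m J k (launch m J t h ?y) (den ?body s')"
    proof (cases "run ?y h = None")
      case False
      then have "launch m J t h ?y = ?y" by (auto simp: launch_def)
      then show ?thesis using False r' busy by simp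
    next
      case True
      define z where "z = den best_prog s'"
      have z: "rep_state m J k ?y z" "nmem z ''h'' 0 = h" "rmem z ''t'' 0 = t"
        unfolding z_def using r' h(2) rep_den[OF r'(1), of best_prog]
          den_nframe[of "''h''" best_prog s'] den_rframe[of "''t''" best_prog s']
        by (simp_all add: best_prog_def del: den.simps)
      have best: "nmem z ''best'' 0 = (if waits ?y = {} then 0 else Suc (smallest J (waits ?y)))"
        unfolding z_def by (rule best_prog[OF r'(1)])
      have body: "den ?body s' = den ?inner z" using busy True by (simp add: z_def)
      show ?thesis
      proof (cases "waits ?y = {}")
        case empty: True
        then show ?thesis unfolding body using best z by (simp add: launch_def)
      next
        case False
        define q where "q = smallest J (waits ?y)"
        have "finite (waits ?y)" using repD(12)[OF r'(1)] finite_subset by blast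
        then have q: "q \<in> waits ?y" "q < length J"
          using smallest(1)[of "waits ?y" J] False repD(12)[OF r'(1)] by (auto simp: q_def)
        define u where "u = den scale_prog z"
        have u: "rep_state m J k ?y u" "nmem u ''h'' 0 = h" "rmem u ''t'' 0 = t" "nmem u ''best'' 0 = Suc q"
          unfolding u_def using z best False rep_den[OF z(1), of scale_prog]
            den_nframe[of "''h''" scale_prog z] den_nframe[of "''best''" scale_prog z]
            den_rframe[of "''t''" scale_prog z]
          by (simp_all add: scale_prog_def q_def del: den.simps)
        have acc: "rmem u ''acc'' 0 = proc J q * real (cap m k)"
          unfolding u_def using best False q(2) by (intro scale_prog[OF z(1)]) (simp_all add: q_def)
        have may: "bval ?may u \<longleftrightarrow> 2 * h < m \<or> small m J t q"
          using u acc repD(2)[OF u(1)] repD(10)[OF u(1)] k by (simp add: small_def volume_def mult_2)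
        have inner: "den ?inner z = (if bval ?may u then den ?set u else u)"
          using best False by (simp add: u_def)
        show ?thesis
        proof (cases "2 * h < m \<or> small m J t q")
          case False
          then show ?thesis unfolding body inner using may u by (simp add: launch_def q_def)
        next
          case may': True
          have l: "launch m J t h ?y = ?y\<lparr>run := (run ?y)(h := Some (q, t)), waits := waits ?y - {q}\<rparr>"
            using may' True False by (simp add: launch_def q_def)
          have "den ?set u = nupdate ''w'' q 0 (rupdate ''s'' h t (nupdate ''b'' h (Suc q) u))"
            using u by simp
          moreover have "rep_state m J k (launch m J t h ?y)
              (nupdate ''w'' q 0 (rupdate ''s'' h t (nupdate ''b'' h (Suc q) u)))"
            unfolding l using u(1) q unfolding rep_def output_schedule_def by auto
          ultimately show ?thesis unfolding body inner using may may' by simp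
        qed
      qed
    qed
    then show "I (Suc h) (nupdate ''h'' 0 (Suc h) (den ?body s'))"
      unfolding I_def using tt by (auto intro: rep_cong)
  qed
  then show ?thesis by (simp add: I_def)
qed

text \<open>The program examines only the next release, while \<open>events\<close> contains all
  future ones; those left out are dominated.\<close>

lemma Min_cofinal:
  fixes A :: "real set"
  assumes "finite B" "A \<subseteq> B" "A \<noteq> {}" "\<And>b. b \<in> B \<Longrightarrow> \<exists>a\<in>A. a \<le> b"
  shows "Min A = Min B"
proof (rule antisym)
  have "B \<noteq> {}" "finite A" using assms finite_subset by auto
  then obtain a where "a \<in> A" "a \<le> Min B" using assms(4)[OF Min_in[OF assms(1)]] by blast
  then show "Min A \<le> Min B" using \<open>finite A\<close> by (meson Min_le order_trans)
  show "Min B \<le> Min A" using assms by (intro Min_antimono)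
qed

lemma next_event_prog:
  assumes r: "rep_state m J k x s" and k: "arrived J (now x) = {..<k}" and v: "valid_jobs J"
  shows "rep_state m J k x (den next_event_prog s)"
    "(0 < nmem (den next_event_prog s) ''ev'' 0) = (events m J x \<noteq> {})"
    "events m J x \<noteq> {} \<Longrightarrow> rmem (den next_event_prog s) ''t'' 0 = Min (events m J x)"
proof -
  let ?b = "BAnd is_busy (bor (NLess (nvar ''ev'') (NConst 1)) (RLess cur_end (rvar ''t'')))"
  let ?body = "When ?b (SetR ''t'' (NConst 0) cur_end ;; SetN ''ev'' (NConst 0) (NConst 1))"
  let ?first = "When (NLess (nvar ''k'') (nvar ''n''))
       (SetR ''t'' (NConst 0) (RArr ''r'' (nvar ''k'')) ;; SetN ''ev'' (NConst 0) (NConst 1))"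
  let ?s0 = "nupdate ''ev'' 0 0 s"
  let ?s = "den ?first ?s0"
  define E where "E i = (if k < length J then {release J k} else {}) \<union>
     {u + proc J j | h j u. h < i \<and> run x h = Some (j, u)}" for i
  have finE: "finite (E i)" for i
  proof -
    have "{u + proc J j | h j u. h < i \<and> run x h = Some (j, u)} \<subseteq>
       (\<lambda>h. snd (the (run x h)) + proc J (fst (the (run x h)))) ` {..<i}" by force
    then show ?thesis unfolding E_def using finite_subset by fastforce
  qed
  have E_Suc: "E (Suc h) = E h \<union> {u + proc J j | j u. run x h = Some (j, u)}" for h
    by (auto simp: E_def less_Suc_eq)
  define I where "I i s' \<longleftrightarrow> rep_state m J k x s' \<and> (0 < nmem s' ''ev'' 0) = (E i \<noteq> {}) \<and>
     (E i \<noteq> {} \<longrightarrow> rmem s' ''t'' 0 = Min (E i))" for i s'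
  have r0: "rep_state m J k x ?s" by (rule rep_cong[OF r]) auto
  have "I m (den (For ''h'' (nvar ''m'') ?body) ?s)"
  proof (rule For_invariant)
    show "''h'' \<notin> nwrites ?body" by simp
    show "nval (nvar ''m'') ?s = m" using repD(2)[OF r0] by simp
    have "(0 < nmem ?s ''ev'' 0) = (E 0 \<noteq> {}) \<and> (E 0 \<noteq> {} \<longrightarrow> rmem ?s ''t'' 0 = Min (E 0))"
      using repD(1,5)[OF r] repD(3)[OF r, of k] by (simp add: E_def)
    then show "I 0 (nupdate ''h'' 0 0 ?s)"
      using rep_cong[OF r0, of "nupdate ''h'' 0 0 ?s"] by (simp add: I_def del: den.simps)
    fix h s' assume h: "h < m" "nmem s' ''h'' 0 = h" "I h s'"
    then have r': "rep_state m J k x s'" "(0 < nmem s' ''ev'' 0) = (E h \<noteq> {})"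
      "E h \<noteq> {} \<Longrightarrow> rmem s' ''t'' 0 = Min (E h)" by (auto simp: I_def)
    have busy: "bval is_busy s' \<longleftrightarrow> run x h \<noteq> None" using is_busy_iff[OF r'(1)] h by simp
    have "(0 < nmem (den ?body s') ''ev'' 0) = (E (Suc h) \<noteq> {}) \<and>
      (E (Suc h) \<noteq> {} \<longrightarrow> rmem (den ?body s') ''t'' 0 = Min (E (Suc h)))"
    proof (cases "run x h")
      case None
      then show ?thesis using busy r' by (simp add: E_Suc)
    next
      case (Some ju)
      obtain j u where ju: "run x h = Some (j, u)" using Some by (cases ju) auto
      have e: "rval cur_end s' = u + proc J j" using cur_vals(2)[OF r'(1)] h ju by simp
      have E': "E (Suc h) = insert (u + proc J j) (E h)" using E_Suc ju by auto
      show ?thesis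
      proof (cases "E h = {}")
        case True
        then show ?thesis using busy ju r'(2) e E' by simp
      next
        case False
        have "Min (insert (u + proc J j) (E h)) = min (u + proc J j) (Min (E h))"
          using finE False by (rule Min_insert)
        then show ?thesis using busy ju r'(2,3) e E' False by (simp add: min_def)
      qed
    qed
    moreover have "rep_state m J k x (nupdate ''h'' 0 (Suc h) (den ?body s'))"
      by (rule rep_cong[OF r'(1)]) auto
    ultimately show "I (Suc h) (nupdate ''h'' 0 (Suc h) (den ?body s'))"
      by (simp add: I_def del: den.simps)
  qed
  then have fin: "I m (den next_event_prog s)" by (simp add: next_event_prog_def)
  have sub: "E m \<subseteq> events m J x"
  proof -
    have "now x < release J k" if "k < length J"
      using k that by (fastforce simp: arrived_def set_eq_iff not_le)
    then show ?thesis by (auto simp: E_def events_def)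
  qed
  have cof: "\<exists>a\<in>E m. a \<le> b" if b: "b \<in> events m J x" for b
  proof -
    from b consider (rel) j where "j < length J" "now x < release J j" "b = release J j"
      | (fin) h j u where "h < m" "run x h = Some (j, u)" "b = u + proc J j" by (auto simp: events_def)
    then show ?thesis
    proof cases
      case rel
      then have "j \<notin> arrived J (now x)" by (simp add: arrived_def)
      then have kj: "k \<le> j" using k by simp
      have "map fst J ! k \<le> map fst J ! j"
        using v rel(1) kj by (intro sorted_nth_mono) (auto simp: valid_jobs_def)
      then show ?thesis using rel kj by (intro bexI[of _ "release J k"]) (auto simp: E_def)
    next
      case fin
      then show ?thesis by (intro bexI[of _ b]) (auto simp: E_def)
    qed
  qed
  have empty: "(E m = {}) = (events m J x = {})" using sub cof by blast
  show "rep_state m J k x (den next_event_prog s)"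
    "(0 < nmem (den next_event_prog s) ''ev'' 0) = (events m J x \<noteq> {})"
    using fin empty by (auto simp: I_def)
  show "rmem (den next_event_prog s) ''t'' 0 = Min (events m J x)" if "events m J x \<noteq> {}"
    using fin empty that Min_cofinal[OF finite_events sub _ cof] by (auto simp: I_def)
qed

lemma step_prog:
  assumes r: "rep_state m J (card (arrived J (now x))) x s" and g: "good m J x" and v: "valid_jobs J"
  shows "rep_state m J (card (arrived J (now (step m J x)))) (step m J x) (den step_prog s)"
proof -
  have arr: "arrived J u = {..<card (arrived J u)}" for u
    using released_take[of J u] v unfolding valid_jobs_def by auto
  define k where "k = card (arrived J (now x))"
  have r': "rep_state m J k x s" using r by (simp add: k_def)
  have ak: "arrived J (now x) = {..<k}" unfolding k_def by (rule arr)
  define s1 where "s1 = den next_event_prog s"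
  note ne = next_event_prog[OF r' ak v, folded s1_def]
  show ?thesis
  proof (cases "events m J x = {}")
    case True
    then show ?thesis using ne(1,2) by (simp add: step_idle step_prog_def s1_def[symmetric] k_def)
  next
    case False
    define t where "t = Min (events m J x)"
    define N where "N = card (arrived J t)"
    have aN: "arrived J t = {..<N}" unfolding N_def by (rule arr)
    have "now x < t" unfolding t_def by (rule Min_events_greater[OF g False])
    then have kN: "k \<le> N" unfolding k_def N_def by (intro card_mono arrived_mono) auto
    have t1: "rmem s1 ''t'' 0 = t" using ne(3)[OF False] by (simp add: t_def)
    define s2 where "s2 = den arrive_prog s1"
    define y where "y = arrive J t x"
    have "arrived J t - arrived J (now x) = {k..<N}" using ak aN by auto
    then have "rep_state m J N y s2 \<and> rmem s2 ''t'' 0 = t"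
      using arrive_prog[OF ne(1) t1 v N_def kN] by (simp add: s2_def y_def arrive_def)
    then have 2: "rep_state m J N y s2" "rmem s2 ''t'' 0 = t" by auto
    define s3 where "s3 = den finish_prog s2"
    have 3: "rep_state m J N (finish J t m y) s3" "rmem s3 ''t'' 0 = t"
      using finish_prog[OF 2] by (auto simp: s3_def)
    define s4 where "s4 = den kill_prog s3"
    have 4: "rep_state m J N (kill m J t m (finish J t m y)) s4" "rmem s4 ''t'' 0 = t"
      using kill_prog[OF 3 N_def] by (auto simp: s4_def)
    have 5: "rep_state m J N (advance m J t x) (den launch_prog s4)"
      using launch_prog[OF 4 aN] by (simp add: advance_def y_def)
    have "den step_prog s = den launch_prog s4"
      using ne(2) False by (simp add: step_prog_def s1_def[symmetric] s2_def s3_def s4_def)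
    moreover have "step m J x = advance m J t x" using False by (simp add: step_def t_def)
    moreover have "now (step m J x) = t" using good_step(2)[OF g v False] by (simp add: t_def)
    ultimately show ?thesis using 5 by (simp add: N_def)
  qed
qed

lemma simulate_prog:
  assumes v: "valid_jobs J"
  shows "output_schedule (den simulate_prog (input_store m J)) = simulate m J"
proof -
  let ?s0 = "nupdate ''K'' 0 m (input_store m J)"
  let ?sq = "SetN ''sq'' (NConst 0) (NAdd (nvar ''sq'') (nvar ''m''))"
  define s1 where "s1 = den (For ''h'' (nvar ''m'') ?sq) ?s0"
  define s2 where "s2 = nupdate ''nm'' 0 (nmem s1 ''sq'' 0) s1"
  define I where "I i s' \<longleftrightarrow> nmem s' ''sq'' 0 = i * m \<and> nmem s' ''m'' 0 = m" for i and s' :: store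
  \<comment> \<open>Starting from 0 in the input store, \<open>m\<close> additions of
    \<open>m\<close> produce \<open>m * m\<close>, the initial value of both \<open>sq\<close> and
    \<open>nm\<close>.\<close>
  have "I m s1" unfolding s1_def
    by (rule For_invariant) (auto simp: I_def input_store_def)
  then have sq: "nmem s1 ''sq'' 0 = m * m" by (simp add: I_def)
  have fr: "nmem s1 a = nmem ?s0 a" if "a \<noteq> ''h''" "a \<noteq> ''sq''" for a
    unfolding s1_def using that by (intro den_nframe) simp
  have frr: "rmem s1 a = rmem ?s0 a" for a
    unfolding s1_def by (intro den_rframe) simp
  have rep0: "rep_state m J 0 init s2"
    unfolding rep_def by (simp add: s2_def fr frr sq init_def input_store_def output_schedule_def)
  define P where "P i s' \<longleftrightarrow> rep_state m J (card (arrived J (now (states m J i)))) (states m J i) s'" for i s'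
  have "P (length J + length J) (den (For ''x'' (NAdd (nvar ''n'') (nvar ''n'')) step_prog) s2)"
  proof (rule For_invariant)
    show "''x'' \<notin> nwrites step_prog" by (simp add: prog_defs)
    show "nval (NAdd (nvar ''n'') (nvar ''n'')) s2 = length J + length J" using repD(1)[OF rep0] by simp
    show "P 0 (nupdate ''x'' 0 0 s2)"
      using rep0 arrived_init[OF v] by (auto simp: P_def intro: rep_cong)
    fix i s' assume "P i s'"
    then have "P (Suc i) (den step_prog s')"
      using step_prog[OF _ good_states[OF v] v] by (simp add: P_def)
    then show "P (Suc i) (nupdate ''x'' 0 (Suc i) (den step_prog s'))"
      unfolding P_def by (rule rep_cong) auto
  qed
  moreover have "den simulate_prog (input_store m J) = den (For ''x'' (NAdd (nvar ''n'') (nvar ''n'')) step_prog) s2"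
  proof -
    have "nmem (input_store m J) ''m'' 0 = m" by (simp add: input_store_def)
    then show ?thesis unfolding s2_def s1_def simulate_prog_def by simp
  qed
  ultimately show ?thesis by (simp add: P_def repD(15) simulate_def mult_2 del: den.simps)
qed

lemma polynomial_time_simulate: "polynomial_time simulate"
  using bounded_loops_simulate simulate_prog by (rule polynomial_time_compile)

text \<open>The maximum with 1 fixes the meaning of the O-notation for few jobs: on a single job
  every ratio is at least 1, whereas \<open>real n powr \<alpha> / sqrt (real m)\<close> tends to 0
  for fixed \<open>n\<close> and growing \<open>m\<close>. The algorithm and the constant are chosen
  before \<open>m\<close>.\<close>

theorem mainTheorem9:
  fixes \<alpha> :: real
  assumes "\<alpha> = (sqrt 5 - 1) / 2"
  shows "\<exists>A :: nat \<Rightarrow> jobs \<Rightarrow> schedule. polynomial_time A \<and>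
           (\<exists>C>0. \<forall>m\<ge>2. online_kill_restart_algorithm m (A m) \<and>
              competitive m (\<lambda>n. C * max 1 (real n powr \<alpha> / sqrt (real m))) (A m))"
  unfolding assms using polynomial_time_simulate online_simulate competitive_simulate
  by (intro exI[of _ simulate] conjI exI[of _ 40000]) auto

end
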